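(* Let $m,n\in\mathbb{N}$, let $F\in C(\mathbb{R}^n,\mathbb{C}^{m\times m})$, and suppose there exists $c\in\mathbb{R}$ such that $$\operatorname{Re}(F(x)_{j,k})\le c,\quad x\in\mathbb{R}^n,\ 1\le j,k\le m.$$ Then the following conditions (i)–(iii) are equivalent: (i) For all $t>0$, $(\exp_H(tF))(-i\nabla)|_{C_0^\infty(\mathbb{R}^n,\mathbb{C}^{m\times m})}$ extends to a bounded operator on $L^1(\mathbb{R}^n,\mathbb{C}^{m\times m})$, and $$\operatorname{tr}_{\mathbb{C}^m}\big(((\exp_H(tF))(-i\nabla)f)(0)\big)\ge 0\quad\text{for all } 0\le f\in C_0^\infty(\mathbb{R}^n,\mathbb{C}^{m\times m}),\ t>0.$$ (ii) For all $t>0$, $\exp_H(tF)\colon\mathbb{R}^n\to\mathbb{C}^{m\times m}$ is positive semidefinite. (iii) $F$ is conditionally positive semidefinite. In addition, if one of the conditions (i)–(iii) holds, then the inequality in (i) can be replaced by $$\operatorname{tr}_{\mathbb{C}^m}\big(((\exp_H(tF))(-i\nabla)f)(x)\big)\ge 0\quad\text{for all } 0\le f\in C_0^\infty(\mathbb{R}^n,\mathbb{C}^{m\times m}),\ x\in\mathbb{R}^n,\ t>0.$$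
   Context: A matrix $A\in\mathbb{C}^{M\times M}$ is positive semidefinite ($A\ge 0$) if $\sum_{j,k}\overline{c_j}A_{j,k}c_k\ge 0$ for all $c\in\mathbb{C}^M$. A self-adjoint matrix $A=A^*\in\mathbb{C}^{M\times M}$ is conditionally positive semidefinite if this inequality holds for all $c\in\mathbb{C}^M$ with $\sum_{j=1}^M c_j=0$. A function $F\colon\mathbb{R}^n\to\mathbb{C}^{m\times m}$ is positive semidefinite (respectively, conditionally positive semidefinite) if for all $N\in\mathbb{N}$ and $x_1,\dots,x_N\in\mathbb{R}^n$ the block matrix $\{F(x_p-x_q)\}_{1\le p,q\le N}\in\mathbb{C}^{mN\times mN}$ is positive semidefinite (respectively, conditionally positive semidefinite, which includes self-adjointness). For a matrix-valued function $f$, $f\ge 0$ means that $f(x)$ is a positive semidefinite matrix for all $x$. The Hadamard exponential is entrywise: $\exp_H(G(x))_{j,k}=\exp(G(x)_{j,k})$. $L^p(\mathbb{R}^n,\mathbb{C}^{m\times m})$ is the space of measurable $f\colon\mathbb{R}^n\to\mathbb{C}^{m\times m}$ with $\|f\|_{p,m}=\big(\int_{\mathbb{R}^n}\|f(x)\|_{\mathcal{B}(\mathbb{C}^m)}^p\,d^nx\big)^{1/p}<\infty$ (essential supremum for $p=\infty$), $\|\cdot\|_{\mathcal{B}(\mathbb{C}^m)}$ being the operator norm with respect to the Euclidean norm. Fourier transforms (entrywise): $f^\wedge(y)=(2\pi)^{-n/2}\int_{\mathbb{R}^n}e^{-iy\cdot x}f(x)\,d^nx$, $g^\vee(x)=(2\pi)^{-n/2}\int_{\mathbb{R}^n}e^{ix\cdot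 y}g(y)\,d^ny$, with the usual extensions to $L^1$ and $L^2$. For $G\in L^\infty(\mathbb{R}^n,\mathbb{C}^{m\times m})$, $G(-i\nabla)f=(f^\wedge G)^\vee$, where $f^\wedge G$ is the pointwise matrix product with $G$ on the right. For $f\in C_0^\infty(\mathbb{R}^n,\mathbb{C}^{m\times m})$ one has $f^\wedge\exp_H(tF)\in L^1(\mathbb{R}^n,\mathbb{C}^{m\times m})$, so $(\exp_H(tF))(-i\nabla)f=(f^\wedge\exp_H(tF))^\vee$ is a continuous function (vanishing at infinity), and pointwise evaluation is well-defined. *)

theory Defs
  imports "HOL-Analysis.Analysis"
begin

text \<open>
  \<open>\<real>\<^sub>\<ge>\<^sub>0\<close> at type complex is the set of nonnegative reals, so membership says that the number is real
  and nonnegative. Matrices whose size varies inside a statement are functions on a finite index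
  set \<open>I\<close>; the block matrices below have \<open>I = {..<N} \<times> UNIV\<close>.
\<close>

definition psd_on :: "'i set \<Rightarrow> ('i \<Rightarrow> 'i \<Rightarrow> complex) \<Rightarrow> bool" where
  "psd_on I A \<longleftrightarrow> (\<forall>c. (\<Sum>j\<in>I. \<Sum>k\<in>I. cnj (c j) * A j k * c k) \<in> \<real>\<^sub>\<ge>\<^sub>0)"

definition cond_psd_on :: "'i set \<Rightarrow> ('i \<Rightarrow> 'i \<Rightarrow> complex) \<Rightarrow> bool" where
  "cond_psd_on I A \<longleftrightarrow>
     (\<forall>j\<in>I. \<forall>k\<in>I. A j k = cnj (A k j)) \<and>
     (\<forall>c. (\<Sum>j\<in>I. c j) = 0 \<longrightarrow> (\<Sum>j\<in>I. \<Sum>k\<in>I. cnj (c j) * A j k * c k) \<in> \<real>\<^sub>\<ge>\<^sub>0)"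

definition psd_mat :: "complex^'m^'m \<Rightarrow> bool" where
  "psd_mat A \<longleftrightarrow> psd_on UNIV (\<lambda>j k. A $ j $ k)"

definition block_matrix ::
    "(real^'n \<Rightarrow> complex^'m^'m) \<Rightarrow> (nat \<Rightarrow> real^'n) \<Rightarrow> nat \<times> 'm \<Rightarrow> nat \<times> 'm \<Rightarrow> complex" where
  "block_matrix F x = (\<lambda>(p, j) (q, k). F (x p - x q) $ j $ k)"

definition psd_fun :: "(real^'n \<Rightarrow> complex^'m^'m) \<Rightarrow> bool" where
  "psd_fun F \<longleftrightarrow> (\<forall>N x. psd_on ({..<N} \<times> UNIV) (block_matrix F x))"

definition cond_psd_fun :: "(real^'n \<Rightarrow> complex^'m^'m) \<Rightarrow> bool" where
  "cond_psd_fun F \<longleftrightarrow> (\<forall>N x. cond_psd_on ({..<N} \<times> UNIV) (block_matrix F x))"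

definition hadamard_exp :: "complex^'m^'m \<Rightarrow> complex^'m^'m" where
  "hadamard_exp A = (\<chi> j k. exp (A $ j $ k))"

text \<open>
  \<open>f\<close> is \<open>C\<^sup>k\<close> iff it is continuous (\<open>k = 0\<close>), or differentiable with all partial derivatives in
  \<open>C\<^sup>k\<^sup>-\<^sup>1\<close>; continuity of the partial derivatives makes this the usual notion.
\<close>

primrec C_k :: "nat \<Rightarrow> (real^'n \<Rightarrow> 'b::real_normed_vector) \<Rightarrow> bool" where
  "C_k 0 f \<longleftrightarrow> continuous_on UNIV f"
| "C_k (Suc k) f \<longleftrightarrow>
     (\<forall>x. f differentiable (at x)) \<and> (\<forall>i. C_k k (\<lambda>x. frechet_derivative f (at x) (axis i 1)))"

definition Cc_infinity :: "(real^'n \<Rightarrow> 'b::real_normed_vector) set" where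
  "Cc_infinity = {f. (\<forall>k. C_k k f) \<and> compact (closure {x. f x \<noteq> 0})}"

definition mat_opnorm :: "complex^'m^'m \<Rightarrow> real" where
  "mat_opnorm A = onorm (\<lambda>v. A *v v)"

text \<open>
  Elements of \<open>L\<^sup>1\<close> are represented by functions; operators on \<open>L\<^sup>1\<close> are maps on representatives
  that respect equality almost everywhere.
\<close>

definition L1 :: "(real^'n \<Rightarrow> complex^'m^'m) set" where
  "L1 = {f. f \<in> borel_measurable lebesgue \<and> integrable lebesgue (\<lambda>x. mat_opnorm (f x))}"

definition L1_norm :: "(real^'n \<Rightarrow> complex^'m^'m) \<Rightarrow> real" where
  "L1_norm f = (LINT x|lebesgue. mat_opnorm (f x))"

definition cscale_mat :: "complex \<Rightarrow> complex^'m^'m \<Rightarrow> complex^'m^'m" where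
  "cscale_mat a A = (\<chi> j k. a * A $ j $ k)"

definition bounded_operator_L1 ::
    "((real^'n \<Rightarrow> complex^'m^'m) \<Rightarrow> (real^'n \<Rightarrow> complex^'m^'m)) \<Rightarrow> bool" where
  "bounded_operator_L1 T \<longleftrightarrow>
     (\<forall>f\<in>L1. T f \<in> L1) \<and>
     (\<forall>f\<in>L1. \<forall>g\<in>L1. (AE x in lebesgue. f x = g x) \<longrightarrow> (AE x in lebesgue. T f x = T g x)) \<and>
     (\<forall>f\<in>L1. \<forall>g\<in>L1. AE x in lebesgue. T (\<lambda>y. f y + g y) x = T f x + T g x) \<and>
     (\<forall>a. \<forall>f\<in>L1. AE x in lebesgue. T (\<lambda>y. cscale_mat a (f y)) x = cscale_mat a (T f x)) \<and>
     (\<exists>C. \<forall>f\<in>L1. L1_norm (T f) \<le> C * L1_norm f)"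

text \<open>
  The integrals are the classical ones and give the Fourier transforms of \<open>L\<^sup>1\<close> functions. The
  extension to \<open>L\<^sup>2\<close> is not needed: for \<open>f \<in> C\<^sub>0\<^sup>\<infinity>\<close> and continuous bounded \<open>G\<close>, both \<open>f\<close> and
  \<open>f\<^sup>\<and> G\<close> lie in \<open>L\<^sup>1\<close>, and \<open>fourier_multiplier G f\<close> is the continuous representative.
\<close>

definition fourier :: "(real^'n \<Rightarrow> complex^'m^'m) \<Rightarrow> real^'n \<Rightarrow> complex^'m^'m" where
  "fourier f y = (\<chi> j k. of_real ((2 * pi) powr (- real CARD('n) / 2)) *
     (LINT x|lebesgue. exp (- \<i> * of_real (y \<bullet> x)) * f x $ j $ k))"

definition inv_fourier :: "(real^'n \<Rightarrow> complex^'m^'m) \<Rightarrow> real^'n \<Rightarrow> complex^'m^'m" where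
  "inv_fourier g x = (\<chi> j k. of_real ((2 * pi) powr (- real CARD('n) / 2)) *
     (LINT y|lebesgue. exp (\<i> * of_real (x \<bullet> y)) * g y $ j $ k))"

definition fourier_multiplier ::
    "(real^'n \<Rightarrow> complex^'m^'m) \<Rightarrow> (real^'n \<Rightarrow> complex^'m^'m) \<Rightarrow> real^'n \<Rightarrow> complex^'m^'m" where
  "fourier_multiplier G f = inv_fourier (\<lambda>y. fourier f y ** G y)"

definition extends_bounded_L1 :: "(real^'n \<Rightarrow> complex^'m^'m) \<Rightarrow> bool" where
  "extends_bounded_L1 G \<longleftrightarrow>
     (\<exists>T. bounded_operator_L1 T \<and>
        (\<forall>f\<in>Cc_infinity. AE x in lebesgue. T f x = fourier_multiplier G f x))"

end

theory Submission
  imports Defs "HOL-Probability.Probability"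
begin

text \<open>
  (ii) and (iii) are equivalent by Schoenberg's argument: the conditionally positive matrix \<open>A\<close>
  becomes positive after subtracting a row and a column, and Schur products turn this into
  positivity of the entrywise exponential; conversely one differentiates \<open>exp (t A)\<close> at \<open>t = 0\<close>.

  For (ii) \<open>\<Longrightarrow>\<close> (i) Bochner's representing measure is avoided. If \<open>G\<close> is continuous, bounded and
  positive definite, then the Fourier transform \<open>k\<^sub>e\<close> of \<open>G(y) exp(-e|y|\<^sup>2/2)\<close> has positive
  semidefinite values, and its mass is bounded uniformly in \<open>e\<close>. The multiplier with the damped
  symbol is convolution with \<open>k\<^sub>e\<close>, so Fatou's lemma as \<open>e \<rightarrow> 0\<close> gives the \<open>L\<^sup>1\<close> bound, and the
  trace inequality holds at every point because the trace of a product of positive semidefinite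
  matrices is nonnegative.

  For (i) \<open>\<Longrightarrow>\<close> (ii) the trace inequality is tested with a dilated cutoff times the rank one matrix
  of a vector of trigonometric polynomials.
\<close>

section \<open>Positive semidefinite matrices\<close>

text \<open>The obstacle in (ii) ==> (i) is that \<open>G\<close> need not be the transform of any
  function, so there is no kernel to which Fubini or Young's inequality could be applied; damping
  makes the symbol integrable. The damping is Gaussian because positive definiteness is tested with
  a modulated Gaussian, and the autocorrelation of a Gaussian is a Gaussian again: the test returns
  exactly the damped transform at one point. Positivity then identifies the \<open>L^1\<close> norm
  of the kernel with its plain integral, which is bounded by \<open>(2 * pi) ^ n * B\<close> for
  every \<open>e\<close> without any inversion theorem. All this is scalar; it applies to the
  contractions of \<open>G\<close> with a fixed vector, hence to diagonal entries, and the
  off-diagonal kernels are dominated by the diagonal ones.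

  In (i) ==> (ii) the samples of \<open>G\<close> arrive multiplied by the integral of the transform
  of the cutoff, so Fourier inversion is established at the origin to show that this weight is
  positive.

  The bound on the real parts enters as \<open>B = exp (t * c)\<close>.\<close>

lemma nonneg_Reals_limI:
  fixes f :: "nat \<Rightarrow> complex"
  assumes "f \<longlonglongrightarrow> l" "\<And>n. f n \<in> \<real>\<^sub>\<ge>\<^sub>0"
  shows "l \<in> \<real>\<^sub>\<ge>\<^sub>0"
  using closed_sequentially[OF closed_nonneg_Reals_complex, of f l] assms by auto

lemma sum_nonneg_Reals:
  fixes f :: "'i \<Rightarrow> complex"
  shows "(\<And>i. i \<in> I \<Longrightarrow> f i \<in> \<real>\<^sub>\<ge>\<^sub>0) \<Longrightarrow> sum f I \<in> \<real>\<^sub>\<ge>\<^sub>0"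
  by (induction I rule: infinite_finite_induct) auto

lemma cnj_mult_self_nonneg: "cnj z * z \<in> \<real>\<^sub>\<ge>\<^sub>0"
  by (simp add: complex_nonneg_Reals_iff)

lemma psd_onD: "psd_on I A \<Longrightarrow> (\<Sum>j\<in>I. \<Sum>k\<in>I. cnj (c j) * A j k * c k) \<in> \<real>\<^sub>\<ge>\<^sub>0"
  by (simp add: psd_on_def)

lemma psd_on_cong:
  "(\<And>j k. j \<in> I \<Longrightarrow> k \<in> I \<Longrightarrow> A j k = B j k) \<Longrightarrow> psd_on I A \<longleftrightarrow> psd_on I B"
  by (simp add: psd_on_def cong: sum.cong)

lemma psd_on_subset:
  assumes "psd_on J A" "I \<subseteq> J" "finite J"
  shows "psd_on I A"
  unfolding psd_on_def
proof
  fix c :: "'a \<Rightarrow> complex"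
  define d where "d = (\<lambda>j. if j \<in> I then c j else 0)"
  have "(\<Sum>j\<in>I. \<Sum>k\<in>I. cnj (c j) * A j k * c k) = (\<Sum>j\<in>J. \<Sum>k\<in>J. cnj (d j) * A j k * d k)"
    using assms(2,3) by (intro sum.mono_neutral_cong_left) (auto simp: d_def intro!: sum.mono_neutral_cong_left)
  then show "(\<Sum>j\<in>I. \<Sum>k\<in>I. cnj (c j) * A j k * c k) \<in> \<real>\<^sub>\<ge>\<^sub>0"
    using psd_onD[OF assms(1), of d] by simp
qed

text \<open>Test vectors supported on two indices extract a 2 by 2 block; \<open>a\<close> sits at
  \<open>j\<close> and \<open>b\<close> at \<open>k\<close>.\<close>

lemma quadratic_form_two_point:
  fixes A :: "'i \<Rightarrow> 'i \<Rightarrow> complex"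
  assumes "finite I" "j \<in> I" "k \<in> I" "j \<noteq> k"
  defines "c \<equiv> \<lambda>a b i. if i = j then a else if i = k then b else 0"
  shows "(\<Sum>p\<in>I. \<Sum>q\<in>I. cnj (c a b p) * A p q * c a b q) =
    cnj a * A j j * a + cnj a * A j k * b + cnj b * A k j * a + cnj b * A k k * b"
proof -
  have "(\<Sum>p\<in>I. \<Sum>q\<in>I. cnj (c a b p) * A p q * c a b q)
      = (\<Sum>p\<in>{j,k}. \<Sum>q\<in>{j,k}. cnj (c a b p) * A p q * c a b q)"
    using assms by (intro sum.mono_neutral_cong_right) (auto simp: c_def intro!: sum.mono_neutral_cong_right)
  then show ?thesis using assms(4) by (simp add: c_def)
qed

lemma psd_on_diag:
  assumes "psd_on I A" "finite I" "j \<in> I"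
  shows "A j j \<in> \<real>\<^sub>\<ge>\<^sub>0"
proof -
  have "psd_on {j} A" using psd_on_subset assms by (metis empty_subsetI insert_subset)
  from psd_onD[OF this, of "\<lambda>_. 1"] show ?thesis by simp
qed

text \<open>Self-adjointness is not part of \<open>psd_on\<close>; it is forced because the form has
  to be real for all complex test vectors.\<close>

lemma psd_on_hermitian:
  assumes "psd_on I A" "finite I" "j \<in> I" "k \<in> I"
  shows "A j k = cnj (A k j)"
proof (cases "j = k")
  case True
  then show ?thesis using psd_on_diag[OF assms(1,2,3)]
    by (auto simp: complex_nonneg_Reals_iff complex_eq_iff)
next
  case False
  have d: "Im (A j j) = 0" "Im (A k k) = 0"
    using psd_on_diag[OF assms(1,2)] assms(3,4) by (auto simp: complex_nonneg_Reals_iff)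
  have q: "cnj a * A j j * a + cnj a * A j k * b + cnj b * A k j * a + cnj b * A k k * b \<in> \<real>\<^sub>\<ge>\<^sub>0" for a b
    using psd_onD[OF assms(1), of "\<lambda>i. if i = j then a else if i = k then b else 0"]
    unfolding quadratic_form_two_point[OF assms(2-4) False] .
  \<comment> \<open>Reality at (1, 1) makes the imaginary parts of \<open>A j k\<close> and
    \<open>A k j\<close> opposite; reality at (1, i) makes their real parts equal.\<close>
  from q[of 1 1] q[of 1 \<i>] show ?thesis
    using d by (auto simp: complex_nonneg_Reals_iff complex_eq_iff algebra_simps)
qed

text \<open>With a zero diagonal entry the form is affine in the component at \<open>j\<close>, so a
  nonzero \<open>A j k\<close> would make it negative somewhere. This settles the singular pivot in
  the factorisation below.\<close>

lemma psd_on_zero_diag: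
  assumes "psd_on I A" "finite I" "j \<in> I" "k \<in> I" "A j j = 0"
  shows "A j k = 0"
proof (rule ccontr)
  assume n: "A j k \<noteq> 0"
  then have "j \<noteq> k" using assms(5) by auto
  have h: "A k j = cnj (A j k)" using psd_on_hermitian[OF assms(1,2,4,3)] .
  have d: "Im (A k k) = 0" "Re (A k k) \<ge> 0" using psd_on_diag[OF assms(1,2,4)] by (auto simp: complex_nonneg_Reals_iff)
  \<comment> \<open>With this \<open>r\<close> the form at \<open>a\<close>, 1 equals
    \<open>- 2 * (Re (A k k) + 1) + Re (A k k)\<close>, which is negative.\<close>
  define r where "r = (Re (A k k) + 1) / (cmod (A j k))\<^sup>2"
  define a where "a = - (complex_of_real r * A j k)"
  have "cnj a * A j j * a + cnj a * A j k * 1 + cnj 1 * A k j * a + cnj 1 * A k k * 1 \<in> \<real>\<^sub>\<ge>\<^sub>0"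
    using psd_onD[OF assms(1), of "\<lambda>i. if i = j then a else if i = k then 1 else 0"]
    unfolding quadratic_form_two_point[OF assms(2-4) \<open>j \<noteq> k\<close>] .
  then have "Re (cnj a * A j k + cnj (A j k) * a + A k k) \<ge> 0"
    using assms(5) h by (simp add: complex_nonneg_Reals_iff)
  moreover have "Re (cnj a * A j k + cnj (A j k) * a) = - 2 * (r * (cmod (A j k))\<^sup>2)"
    unfolding cmod_power2 by (simp add: a_def power2_eq_square algebra_simps)
  moreover have "r * (cmod (A j k))\<^sup>2 = Re (A k k) + 1" using n by (simp add: r_def)
  ultimately show False using d by simp
qed

text \<open>Induction on the index set by Schur complements: a vanishing pivot has a vanishing row
  and column, a positive pivot is eliminated and leaves a positive semidefinite matrix on the other
  indices. The Gram form gives quick access to Schur products, traces and off-diagonal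
  bounds.\<close>

lemma psd_on_Cholesky:
  assumes "finite I" "psd_on I A"
  shows "\<exists>V. \<forall>j\<in>I. \<forall>k\<in>I. A j k = (\<Sum>l\<in>I. V l j * cnj (V l k))"
  using assms
proof (induction I arbitrary: A rule: finite_induct)
  case empty
  then show ?case by simp
next
  case (insert i I)
  note fin = finite.insertI[OF insert.hyps(1), of i]
  have herm: "cnj (A j k) = A k j" if "j \<in> insert i I" "k \<in> insert i I" for j k
    using psd_on_hermitian[OF insert.prems fin that(2,1)] by simp
  show ?case
  proof (cases "A i i = 0")
    case True
    have z: "A i k = 0" "A k i = 0" if "k \<in> insert i I" for k
      using psd_on_zero_diag[OF insert.prems fin _ that True] herm[of i k] that by auto
    obtain V where V: "A j k = (\<Sum>l\<in>I. V l j * cnj (V l k))" if "j \<in> I" "k \<in> I" for j k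
      using insert.IH[OF psd_on_subset[OF insert.prems subset_insertI fin]] by blast
    show ?thesis
      by (rule exI[of _ "\<lambda>l j. if l = i \<or> j = i then 0 else V l j"])
        (use insert.hyps z V in \<open>auto intro!: sum.cong\<close>)
  next
    case False
    define a where "a = Re (A i i)"
    have a: "A i i = of_real a" "a > 0"
      using psd_on_diag[OF insert.prems fin, of i] False
      by (auto simp: a_def complex_nonneg_Reals_iff complex_eq_iff)
    define B where "B = (\<lambda>j k. A j k - A j i * A i k / of_real a)"
    have "psd_on I B"
      unfolding psd_on_def
    proof
      fix c
      define s where "s = (\<Sum>k\<in>I. A i k * c k)"
      \<comment> \<open>The value at \<open>i\<close> minimises the form of \<open>A\<close> with
        the other components fixed to \<open>c\<close>; completing the square leaves the form of
        \<open>B\<close> at \<open>c\<close>.\<close>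
      define d where "d = (\<lambda>j. if j = i then - s / of_real a else c j)"
      have cs: "(\<Sum>j\<in>I. cnj (c j) * A j i) = cnj s"
        unfolding s_def cnj_sum using herm by (auto intro!: sum.cong simp: mult.commute)
      have dd: "(\<Sum>j\<in>I. f (d j) j) = (\<Sum>j\<in>I. f (c j) j)" for f :: "complex \<Rightarrow> 'a \<Rightarrow> complex"
        using insert.hyps by (intro sum.cong) (auto simp: d_def)
      have di: "d i = - s / of_real a" by (simp add: d_def)
      have "(\<Sum>j\<in>insert i I. \<Sum>k\<in>insert i I. cnj (d j) * A j k * d k) =
         cnj (d i) * of_real a * d i + cnj (d i) * (\<Sum>k\<in>I. A i k * d k)
         + (\<Sum>j\<in>I. cnj (d j) * A j i) * d i + (\<Sum>j\<in>I. \<Sum>k\<in>I. cnj (d j) * A j k * d k)"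
        using insert.hyps
        by (simp add: sum.distrib sum_distrib_left sum_distrib_right a mult.assoc)
      also have "(\<Sum>k\<in>I. A i k * d k) = s"
        unfolding s_def by (rule dd[of "\<lambda>x k. A i k * x"])
      also have "(\<Sum>j\<in>I. cnj (d j) * A j i) = cnj s"
        unfolding cs[symmetric] by (rule dd[of "\<lambda>x k. cnj x * A k i"])
      also have "(\<Sum>j\<in>I. \<Sum>k\<in>I. cnj (d j) * A j k * d k) = (\<Sum>j\<in>I. \<Sum>k\<in>I. cnj (c j) * A j k * c k)"
        using insert.hyps by (intro sum.cong) (auto simp: d_def)
      also have "cnj (d i) * of_real a * d i + cnj (d i) * s + cnj s * d i = - (cnj s * s / of_real a)"
        unfolding di using a(2) by (simp add: field_simps)
      also have "cnj s * s / of_real a = (\<Sum>j\<in>I. \<Sum>k\<in>I. cnj (c j) * (A j i * A i k / of_real a) * c k)"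
        by (subst cs[symmetric], subst s_def, unfold sum_product sum_divide_distrib)
          (intro sum.cong refl, simp)
      also have "- \<dots> + (\<Sum>j\<in>I. \<Sum>k\<in>I. cnj (c j) * A j k * c k) =
          (\<Sum>j\<in>I. \<Sum>k\<in>I. cnj (c j) * B j k * c k)"
        by (simp add: B_def sum_subtractf algebra_simps)
      finally show "(\<Sum>j\<in>I. \<Sum>k\<in>I. cnj (c j) * B j k * c k) \<in> \<real>\<^sub>\<ge>\<^sub>0"
        using psd_onD[OF insert.prems, of d] by simp
    qed
    then obtain V where V: "\<forall>j\<in>I. \<forall>k\<in>I. B j k = (\<Sum>l\<in>I. V l j * cnj (V l k))"
      using insert.IH by blast
    \<comment> \<open>The pivot contributes its column divided by the square root of the pivot; the
      vectors for \<open>B\<close> are extended by zero at \<open>i\<close>.\<close>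
    define W where "W = (\<lambda>l j. if l = i then A j i / of_real (sqrt a) else if j = i then 0 else V l j)"
    have sq: "complex_of_real (sqrt a) * complex_of_real (sqrt a) = of_real a"
      using a(2) by (simp flip: of_real_mult)
    have "A j k = (\<Sum>l\<in>insert i I. W l j * cnj (W l k))" if jk: "j \<in> insert i I" "k \<in> insert i I" for j k
    proof -
      have e: "W i j * cnj (W i k) = A j i * A i k / of_real a"
        using herm[of k i] jk sq by (simp add: W_def)
      have "(\<Sum>l\<in>I. W l j * cnj (W l k)) = (if j = i \<or> k = i then 0 else B j k)"
        using insert.hyps V jk by (auto simp: W_def intro!: sum.cong sum.neutral)
      then show ?thesis
        using insert.hyps e a False by (auto simp: B_def)
    qed
    then show ?thesis by blast
  qed
qed

lemma sum_swap3:
  "(\<Sum>j\<in>J. \<Sum>k\<in>K. \<Sum>l\<in>L. f j k l) = (\<Sum>l\<in>L. \<Sum>j\<in>J. \<Sum>k\<in>K. f j k l)"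
proof -
  have "(\<Sum>j\<in>J. \<Sum>k\<in>K. \<Sum>l\<in>L. f j k l) = (\<Sum>j\<in>J. \<Sum>l\<in>L. \<Sum>k\<in>K. f j k l)"
    by (intro sum.cong refl sum.swap)
  also have "\<dots> = (\<Sum>l\<in>L. \<Sum>j\<in>J. \<Sum>k\<in>K. f j k l)"
    by (rule sum.swap)
  finally show ?thesis .
qed

text \<open>Inserting the Gram form of \<open>A\<close> splits the quadratic form of the product
  into forms of \<open>B\<close> at the vectors \<open>cnj (V l k) * c k\<close>.\<close>

lemma psd_on_Schur_product:
  assumes "finite I" "psd_on I A" "psd_on I B"
  shows "psd_on I (\<lambda>j k. A j k * B j k)"
  unfolding psd_on_def
proof
  fix c
  obtain V where V: "\<forall>j\<in>I. \<forall>k\<in>I. A j k = (\<Sum>l\<in>I. V l j * cnj (V l k))"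
    using psd_on_Cholesky[OF assms(1,2)] by blast
  have "(\<Sum>j\<in>I. \<Sum>k\<in>I. cnj (c j) * (A j k * B j k) * c k) =
     (\<Sum>j\<in>I. \<Sum>k\<in>I. \<Sum>l\<in>I. cnj (cnj (V l j) * c j) * B j k * (cnj (V l k) * c k))"
    using V by (intro sum.cong refl) (simp add: sum_distrib_left sum_distrib_right mult_ac)
  also have "\<dots> = (\<Sum>l\<in>I. \<Sum>j\<in>I. \<Sum>k\<in>I. cnj (cnj (V l j) * c j) * B j k * (cnj (V l k) * c k))"
    by (rule sum_swap3)
  also have "\<dots> \<in> \<real>\<^sub>\<ge>\<^sub>0"
    by (intro sum_nonneg_Reals psd_onD assms(3))
  finally show "(\<Sum>j\<in>I. \<Sum>k\<in>I. cnj (c j) * (A j k * B j k) * c k) \<in> \<real>\<^sub>\<ge>\<^sub>0" .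
qed

lemma psd_on_rank_one: "psd_on I (\<lambda>j k. v j * cnj (v k))"
  unfolding psd_on_def
proof
  fix c
  have "(\<Sum>j\<in>I. \<Sum>k\<in>I. cnj (c j) * (v j * cnj (v k)) * c k) =
     cnj (\<Sum>k\<in>I. cnj (v k) * c k) * (\<Sum>k\<in>I. cnj (v k) * c k)"
    unfolding cnj_sum sum_product by (intro sum.cong refl) (simp add: mult_ac)
  then show "(\<Sum>j\<in>I. \<Sum>k\<in>I. cnj (c j) * (v j * cnj (v k)) * c k) \<in> \<real>\<^sub>\<ge>\<^sub>0"
    by (simp only: cnj_mult_self_nonneg)
qed

lemma psd_on_add:
  "psd_on I A \<Longrightarrow> psd_on I B \<Longrightarrow> psd_on I (\<lambda>j k. A j k + B j k)"
  unfolding psd_on_def by (simp add: distrib_left distrib_right sum.distrib nonneg_Reals_add_I)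

lemma psd_on_scale:
  "psd_on I A \<Longrightarrow> r \<in> \<real>\<^sub>\<ge>\<^sub>0 \<Longrightarrow> psd_on I (\<lambda>j k. r * A j k)"
proof -
  assume "psd_on I A" "r \<in> \<real>\<^sub>\<ge>\<^sub>0"
  then have "r * (\<Sum>j\<in>I. \<Sum>k\<in>I. cnj (c j) * A j k * c k) \<in> \<real>\<^sub>\<ge>\<^sub>0" for c
    by (intro nonneg_Reals_mult_I psd_onD)
  then show ?thesis by (simp add: psd_on_def sum_distrib_left mult_ac)
qed

lemma psd_on_limit:
  assumes "\<And>n. psd_on I (B n)" "\<And>j k. (\<lambda>n. B n j k) \<longlonglongrightarrow> A j k"
  shows "psd_on I A"
  unfolding psd_on_def
proof
  fix c
  have "(\<lambda>n. \<Sum>j\<in>I. \<Sum>k\<in>I. cnj (c j) * B n j k * c k) \<longlonglongrightarrow> (\<Sum>j\<in>I. \<Sum>k\<in>I. cnj (c j) * A j k * c k)"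
    by (intro tendsto_intros assms(2))
  then show "(\<Sum>j\<in>I. \<Sum>k\<in>I. cnj (c j) * A j k * c k) \<in> \<real>\<^sub>\<ge>\<^sub>0"
    by (rule nonneg_Reals_limI) (rule psd_onD[OF assms(1)])
qed

section \<open>Entrywise exponentials and conditional positivity\<close>

lemma psd_on_exp:
  assumes "finite I" "psd_on I A"
  shows "psd_on I (\<lambda>j k. exp (A j k))"
proof (rule psd_on_limit)
  fix n :: nat
  have pow: "psd_on I (\<lambda>j k. A j k ^ n)" for n
  proof (induction n)
    case 0
    then show ?case using psd_on_rank_one[of I "\<lambda>_. 1"] by simp
  next
    case (Suc n)
    then show ?case using psd_on_Schur_product[OF assms] by simp
  qed
  \<comment> \<open>The exponential series has nonnegative coefficients, so its partial sums stay in
    the cone, which is closed under Schur powers, sums and limits.\<close>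
  show "psd_on I (\<lambda>j k. \<Sum>i<n. inverse (of_nat (fact i)) * A j k ^ i)"
  proof (induction n)
    case 0
    then show ?case by (simp add: psd_on_def)
  next
    case (Suc n)
    have "inverse (of_nat (fact n)) \<in> (\<real>\<^sub>\<ge>\<^sub>0 :: complex set)"
      by (intro nonneg_Reals_inverse_I nonneg_Reals_of_nat_I)
    then show ?case
      unfolding sum.lessThan_Suc by (intro psd_on_add Suc.IH psd_on_scale pow)
  qed
  show "(\<lambda>n. \<Sum>i<n. inverse (of_nat (fact i)) * A j k ^ i) \<longlonglongrightarrow> exp (A j k)" for j k
    using exp_converges[of "A j k"] by (simp add: sums_def scaleR_conv_of_real)
qed

text \<open>Subtracting the row and column of a base point \<open>z\<close> turns conditional positivity into positivity,
  and exponentiates to a rank one Schur factor.\<close>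

lemma cond_psd_on_exp:
  assumes "finite I" "cond_psd_on I A"
  shows "psd_on I (\<lambda>j k. exp (A j k))"
proof (cases "I = {}")
  case True
  then show ?thesis by (simp add: psd_on_def)
next
  case False
  then obtain z where z: "z \<in> I" by blast
  have herm: "cnj (A j k) = A k j" if "j \<in> I" "k \<in> I" for j k
    using assms(2) that unfolding cond_psd_on_def by (metis complex_cnj_cnj)
  define B where "B = (\<lambda>j k. A j k - A j z - A z k + A z z)"
  have "psd_on I B"
    unfolding psd_on_def
  proof
    fix c :: "'a \<Rightarrow> complex"
    define s where "s = sum c I"
    \<comment> \<open>Subtracting the total of \<open>c\<close> at the base point makes the sum
      zero; the form of \<open>A\<close> at \<open>d\<close> is then the form of \<open>B\<close> at
      \<open>c\<close>.\<close>
    define d where "d = (\<lambda>j. c j - (if j = z then s else 0))"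
    have "sum d I = 0" using z assms(1) by (simp add: d_def s_def sum_subtractf)
    then have "(\<Sum>j\<in>I. \<Sum>k\<in>I. cnj (d j) * A j k * d k) \<in> \<real>\<^sub>\<ge>\<^sub>0"
      using assms(2) unfolding cond_psd_on_def by blast
    also have "(\<Sum>j\<in>I. \<Sum>k\<in>I. cnj (d j) * A j k * d k) = (\<Sum>j\<in>I. \<Sum>k\<in>I. cnj (c j) * B j k * c k)"
    proof -
      define R where "R = (\<lambda>j. \<Sum>k\<in>I. A j k * c k)"
      have "(\<Sum>k\<in>I. A j k * d k) = R j - A j z * s" for j
      proof -
        have "A j k * d k = A j k * c k - (if k = z then A j z * s else 0)" for k
          by (simp add: d_def right_diff_distrib)
        then show ?thesis using z assms(1) by (simp add: sum_subtractf R_def)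
      qed
      then have D: "(\<Sum>k\<in>I. cnj (d j) * A j k * d k) = cnj (d j) * (R j - A j z * s)" for j
        by (simp only: mult.assoc flip: sum_distrib_left)
      have "(\<Sum>k\<in>I. B j k * c k) = R j - A j z * s - R z + A z z * s" for j
        unfolding B_def R_def s_def
        by (simp add: distrib_right left_diff_distrib sum.distrib sum_subtractf sum_distrib_left)
      then have B: "(\<Sum>k\<in>I. cnj (c j) * B j k * c k) = cnj (c j) * (R j - A j z * s - R z + A z z * s)" for j
        by (simp only: mult.assoc flip: sum_distrib_left)
      have "(\<Sum>j\<in>I. cnj (d j) * X j) = (\<Sum>j\<in>I. cnj (c j) * X j) - cnj s * X z" for X
      proof -
        have "cnj (d j) * X j = cnj (c j) * X j - (if j = z then cnj s * X z else 0)" for j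
          by (simp add: d_def left_diff_distrib)
        then show ?thesis using z assms(1) by (simp add: sum_subtractf)
      qed
      moreover have "(\<Sum>j\<in>I. cnj (c j) * (R j - A j z * s - R z + A z z * s)) =
          (\<Sum>j\<in>I. cnj (c j) * (R j - A j z * s)) - cnj s * (R z - A z z * s)"
        unfolding s_def cnj_sum
        by (simp add: right_diff_distrib distrib_left sum.distrib sum_subtractf flip: sum_distrib_right)
      ultimately show ?thesis unfolding D B by simp
    qed
    finally show "(\<Sum>j\<in>I. \<Sum>k\<in>I. cnj (c j) * B j k * c k) \<in> \<real>\<^sub>\<ge>\<^sub>0" .
  qed
  \<comment> \<open>Solving for \<open>A\<close> gives
    \<open>A j k = B j k + A j z + A z k - A z z\<close>; the real number \<open>A z z\<close> is
    shared equally between the two rank one factors.\<close>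
  define v where "v = (\<lambda>j. exp (A j z - A z z / 2))"
  have "A z z / 2 = cnj (A z z / 2)" using herm[OF z z] by simp
  then have "exp (A j k) = exp (B j k) * (v j * cnj (v k))" if "j \<in> I" "k \<in> I" for j k
    using herm[OF that(2) z] herm[OF z z]
    by (simp add: v_def B_def exp_cnj flip: exp_add)
  then show ?thesis
    using psd_on_Schur_product[OF assms(1) psd_on_exp[OF assms(1) \<open>psd_on I B\<close>] psd_on_rank_one[of I v]]
    by (simp cong: psd_on_cong)
qed

text \<open>The derivative of \<open>exp (w * z)\<close> at \<open>w = 0\<close>, taken along
  \<open>w = 1 / (n + 1)\<close>. It serves both the passage from \<open>exp (t A)\<close> to
  \<open>A\<close> and, later, the derivative of phases.\<close>

lemma exp_difference_quotient_tendsto: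
  "(\<lambda>n. of_nat (Suc n) * (exp (of_real (inverse (real (Suc n))) * z) - 1)) \<longlonglongrightarrow> (z::complex)"
proof -
  have "((\<lambda>w. exp (w * z)) has_field_derivative z) (at 0)"
    by (auto intro!: derivative_eq_intros)
  then have d: "((\<lambda>w. (exp (w * z) - 1) / w) \<longlongrightarrow> z) (at 0)"
    by (simp add: has_field_derivative_iff)
  have l: "filterlim (\<lambda>n. complex_of_real (inverse (real (Suc n)))) (at 0) sequentially"
    unfolding filterlim_at
    using tendsto_of_real[OF LIMSEQ_inverse_real_of_nat, where ?'a = complex] by (auto simp del: of_nat_Suc)
  show ?thesis
    using filterlim_compose[OF d l]
    by (simp add: field_simps del: of_nat_Suc)
qed

text \<open>On vectors with sum zero the constant matrix 1 has vanishing form, so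
  \<open>(exp (t A) - 1) / t\<close> has a positive multiple of the form of
  \<open>exp (t A)\<close>, and \<open>t -> 0\<close> gives \<open>A\<close>. Since
  \<open>exp\<close> is not injective, self-adjointness too is read off from this limit and not from
  a single \<open>t\<close>.\<close>

lemma cond_psd_on_if_exp_psd:
  assumes "finite I" "\<And>t. t > 0 \<Longrightarrow> psd_on I (\<lambda>j k. exp (of_real t * A j k))"
  shows "cond_psd_on I A"
  unfolding cond_psd_on_def
proof (intro conjI ballI allI impI)
  fix j k assume jk: "j \<in> I" "k \<in> I"
  have "exp (of_real t * A j k) = exp (of_real t * cnj (A k j))" if "t > 0" for t
    using psd_on_hermitian[OF assms(2)[OF that] assms(1) jk] by (simp add: exp_cnj)
  then have "(\<lambda>n. of_nat (Suc n) * (exp (of_real (inverse (real (Suc n))) * A j k) - 1))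
       = (\<lambda>n. of_nat (Suc n) * (exp (of_real (inverse (real (Suc n))) * cnj (A k j)) - 1))"
    by (intro ext) (simp del: of_nat_Suc of_real_inverse)
  then show "A j k = cnj (A k j)"
    by (intro LIMSEQ_unique[OF exp_difference_quotient_tendsto])
      (simp only: exp_difference_quotient_tendsto)
next
  fix c :: "'a \<Rightarrow> complex" assume c: "sum c I = 0"
  let ?q = "\<lambda>n j k. of_nat (Suc n) * (exp (of_real (inverse (real (Suc n))) * A j k) - 1)"
  show "(\<Sum>j\<in>I. \<Sum>k\<in>I. cnj (c j) * A j k * c k) \<in> \<real>\<^sub>\<ge>\<^sub>0"
  proof (rule nonneg_Reals_limI)
    show "(\<lambda>n. \<Sum>j\<in>I. \<Sum>k\<in>I. cnj (c j) * ?q n j k * c k) \<longlonglongrightarrow> (\<Sum>j\<in>I. \<Sum>k\<in>I. cnj (c j) * A j k * c k)"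
      by (intro tendsto_intros exp_difference_quotient_tendsto)
    fix n
    define r where "r = inverse (real (Suc n))"
    have r: "r > 0" unfolding r_def by simp
    have "(\<Sum>j\<in>I. \<Sum>k\<in>I. cnj (c j) * c k) = 0"
      using c by (simp flip: sum_product cnj_sum)
    then have "(\<Sum>j\<in>I. \<Sum>k\<in>I. cnj (c j) * exp (of_real r * A j k) * c k) =
        (\<Sum>j\<in>I. \<Sum>k\<in>I. cnj (c j) * (exp (of_real r * A j k) - 1) * c k)"
      by (simp add: right_diff_distrib left_diff_distrib sum_subtractf)
    moreover have "(\<Sum>j\<in>I. \<Sum>k\<in>I. cnj (c j) * ?q n j k * c k) = of_nat (Suc n) *
        (\<Sum>j\<in>I. \<Sum>k\<in>I. cnj (c j) * (exp (of_real r * A j k) - 1) * c k)"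
      unfolding sum_distrib_left by (simp only: r_def[symmetric] mult_ac)
    ultimately show "(\<Sum>j\<in>I. \<Sum>k\<in>I. cnj (c j) * ?q n j k * c k) \<in> \<real>\<^sub>\<ge>\<^sub>0"
      using psd_onD[OF assms(2)[OF r], of c]
      by (simp only: nonneg_Reals_mult_I nonneg_Reals_of_nat_I)
  qed
qed

text \<open>Gram form and \<open>2 a b <= a^2 + b^2\<close>. Through this the kernels of
  off-diagonal entries are controlled by those of diagonal entries.\<close>

lemma psd_on_offdiag_le:
  assumes "finite I" "psd_on I A" "j \<in> I" "k \<in> I"
  shows "2 * cmod (A j k) \<le> Re (A j j) + Re (A k k)"
proof -
  obtain V where V: "\<forall>j\<in>I. \<forall>k\<in>I. A j k = (\<Sum>l\<in>I. V l j * cnj (V l k))"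
    using psd_on_Cholesky[OF assms(1,2)] by blast
  have r: "Re (A i i) = (\<Sum>l\<in>I. (cmod (V l i))\<^sup>2)" if "i \<in> I" for i
    unfolding cmod_power2 using V that by (simp add: power2_eq_square)
  have "2 * cmod (A j k) \<le> 2 * (\<Sum>l\<in>I. cmod (V l j * cnj (V l k)))"
    using V assms(3,4) by (simp add: norm_sum)
  also have "\<dots> = (\<Sum>l\<in>I. 2 * cmod (V l j) * cmod (V l k))"
    by (simp add: sum_distrib_left norm_mult mult_ac)
  also have "\<dots> \<le> (\<Sum>l\<in>I. (cmod (V l j))\<^sup>2 + (cmod (V l k))\<^sup>2)"
    by (intro sum_mono sum_squares_bound)
  finally show ?thesis using r assms by (simp add: sum.distrib)
qed

text \<open>For \<open>A\<close> in Gram form the trace of \<open>A B\<close> is a sum of quadratic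
  forms of \<open>B\<close>.\<close>

lemma psd_on_trace_mult:
  assumes "finite I" "psd_on I A" "psd_on I B"
  shows "(\<Sum>j\<in>I. \<Sum>l\<in>I. A j l * B l j) \<in> \<real>\<^sub>\<ge>\<^sub>0"
proof -
  obtain V where V: "\<forall>j\<in>I. \<forall>k\<in>I. A j k = (\<Sum>l\<in>I. V l j * cnj (V l k))"
    using psd_on_Cholesky[OF assms(1,2)] by blast
  have "(\<Sum>j\<in>I. \<Sum>l\<in>I. A j l * B l j) = (\<Sum>j\<in>I. \<Sum>l\<in>I. \<Sum>r\<in>I. cnj (V r l) * B l j * V r j)"
    using V by (intro sum.cong refl) (simp add: sum_distrib_right sum_distrib_left mult_ac)
  also have "\<dots> = (\<Sum>r\<in>I. \<Sum>l\<in>I. \<Sum>j\<in>I. cnj (V r l) * B l j * V r j)"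
    by (subst sum_swap3, intro sum.cong refl sum.swap)
  also have "\<dots> \<in> \<real>\<^sub>\<ge>\<^sub>0"
    by (intro sum_nonneg_Reals psd_onD assms(3))
  finally show ?thesis .
qed

section \<open>Gaussians\<close>

lemma lborel_prod_integral:
  fixes f :: "'a::euclidean_space \<Rightarrow> real \<Rightarrow> complex"
  assumes "\<And>b. b \<in> Basis \<Longrightarrow> integrable lborel (f b)"
  shows lborel_integrable_prod: "integrable lborel (\<lambda>x. \<Prod>b\<in>Basis. f b (x \<bullet> b))"
    and lborel_integral_prod:
      "(LINT x|lborel. (\<Prod>b\<in>Basis. f b (x \<bullet> b))) = (\<Prod>b\<in>Basis. integral\<^sup>L lborel (f b))"
proof -
  interpret product_sigma_finite "\<lambda>_::'a. lborel :: real measure" by standard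
  have m[measurable]: "(\<lambda>x. f b (x \<bullet> b)) \<in> borel_measurable borel" if "b \<in> Basis" for b
    using borel_measurable_integrable[OF assms[OF that]] by measurable
  have P: "(\<lambda>x::'a. \<Prod>b\<in>Basis. f b (x \<bullet> b)) \<in> borel_measurable borel"
    by (intro borel_measurable_prod m)
  have e: "(\<Prod>b\<in>Basis. f b ((\<Sum>b\<in>Basis. x b *\<^sub>R b) \<bullet> b)) = (\<Prod>b\<in>Basis. f b (x b))" for x
    by (intro prod.cong refl) simp
  show "integrable lborel (\<lambda>x. \<Prod>b\<in>Basis. f b (x \<bullet> b))"
    using product_integrable_prod[OF finite_Basis assms]
    by (subst lborel_eq, subst integrable_distr_eq) (auto simp: e P)
  show "(LINT x|lborel. (\<Prod>b\<in>Basis. f b (x \<bullet> b))) = (\<Prod>b\<in>Basis. integral\<^sup>L lborel (f b))"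
    using product_integral_prod[OF finite_Basis assms]
    by (subst lborel_eq, subst integral_distr) (auto simp: e P)
qed

lemma lborel_integral_affine:
  fixes f :: "'a::euclidean_space \<Rightarrow> 'b::{banach, second_countable_topology}"
  assumes "c \<noteq> 0" "f \<in> borel_measurable borel"
  shows "integral\<^sup>L lborel f = \<bar>c\<bar> ^ DIM('a) *\<^sub>R (LINT x|lborel. f (t + c *\<^sub>R x))"
  using assms by (subst lborel_affine[of c t]) (simp_all add: integral_density integral_distr)

lemma lborel_integrable_affine:
  fixes f :: "'a::euclidean_space \<Rightarrow> 'b::{banach, second_countable_topology}"
  assumes "c \<noteq> 0" "integrable lborel f"
  shows "integrable lborel (\<lambda>x. f (t + c *\<^sub>R x))"
proof -
  have [measurable]: "f \<in> borel_measurable borel" using assms(2) by auto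
  have "integrable (density (distr lborel borel (\<lambda>x. t + c *\<^sub>R x)) (\<lambda>_. \<bar>c\<bar> ^ DIM('a))) f"
    using assms(2) by (subst (asm) lborel_affine[OF assms(1), of t])
  then have "integrable lborel (\<lambda>x. \<bar>c\<bar> ^ DIM('a) *\<^sub>R f (t + c *\<^sub>R x))"
    using assms(1) by (simp add: integrable_density integrable_distr_eq)
  from integrable_scaleR_right[OF this, of "inverse (\<bar>c\<bar> ^ DIM('a))"] show ?thesis
    using assms(1) by simp
qed

text \<open>This is the characteristic function of the standard normal distribution at
  \<open>s / sqrt e\<close>, after the substitution that replaces \<open>x\<close> by
  \<open>sqrt e * x\<close>.\<close>

lemma gaussian_fourier_real:
  fixes e s :: real
  assumes "e > 0"
  shows "integrable lborel (\<lambda>x. complex_of_real (exp (- (e * x\<^sup>2 / 2))) * iexp (s * x))"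
    and "(CLINT x|lborel. complex_of_real (exp (- (e * x\<^sup>2 / 2))) * iexp (s * x)) =
      complex_of_real (sqrt (2 * pi / e) * exp (- (s\<^sup>2 / (2 * e))))"
proof -
  define r where "r = s / sqrt e"
  define f where "f = (\<lambda>x. complex_of_real (exp (- (x\<^sup>2 / 2))) * iexp (r * x))"
  have fd: "f x = complex_of_real (sqrt (2 * pi)) * (std_normal_density x *\<^sub>R iexp (r * x))" for x
    by (simp add: f_def std_normal_density_def scaleR_conv_of_real field_simps)
  have i: "integrable lborel (\<lambda>x. std_normal_density x *\<^sub>R iexp (r * x))"
    by (rule Bochner_Integration.integrable_bound[OF integrable_std_normal_moment[of 0]]) (auto simp: norm_mult)
  have fi: "integrable lborel f"
    unfolding fd[abs_def] by (intro integrable_mult_right i)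
  have "(CLINT x|lborel. std_normal_density x *\<^sub>R iexp (r * x)) = complex_of_real (exp (- (r^2) / 2))"
    using fun_cong[OF char_std_normal_distribution, of r]
    by (simp add: char_def integral_density)
  then have fI: "integral\<^sup>L lborel f = complex_of_real (sqrt (2 * pi) * exp (- (r^2) / 2))"
    unfolding fd[abs_def] integral_mult_right_zero by simp
  have c: "sqrt e \<noteq> 0" using assms by simp
  have sub: "f (0 + sqrt e * x) = complex_of_real (exp (- (e * x\<^sup>2 / 2))) * iexp (s * x)" for x
    using assms by (simp add: f_def r_def power_mult_distrib)
  show "integrable lborel (\<lambda>x. complex_of_real (exp (- (e * x\<^sup>2 / 2))) * iexp (s * x))"
    using lborel_integrable_real_affine[OF fi c, of 0] unfolding sub .
  have "integral\<^sup>L lborel f = sqrt e *\<^sub>R (CLINT x|lborel. complex_of_real (exp (- (e * x\<^sup>2 / 2))) * iexp (s * x))"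
    using lborel_integral_real_affine[OF c, of f 0] assms unfolding sub by simp
  then show "(CLINT x|lborel. complex_of_real (exp (- (e * x\<^sup>2 / 2))) * iexp (s * x)) =
      complex_of_real (sqrt (2 * pi / e) * exp (- (s\<^sup>2 / (2 * e))))"
    using assms unfolding fI
    by (simp add: r_def power_divide scaleR_conv_of_real real_sqrt_divide field_simps)
qed

text \<open>Left unnormalised so that it tends to 1 as \<open>e -> 0\<close> and can act as a
  damping factor. The parameter is the inverse variance; the Fourier transform turns it into
  \<open>1 / e\<close>.\<close>

definition gauss :: "real \<Rightarrow> 'a::euclidean_space \<Rightarrow> real" where
  "gauss e x = exp (- (e * (norm x)\<^sup>2 / 2))"

lemma gauss_nonneg[simp]: "gauss e x \<ge> 0"
  and gauss_minus[simp]: "gauss e (- x) = gauss e x"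
  by (simp_all add: gauss_def)

lemma gauss_le_1: "e \<ge> 0 \<Longrightarrow> gauss e x \<le> 1"
  by (simp add: gauss_def)

lemma continuous_gauss[continuous_intros]:
  "continuous_on S f \<Longrightarrow> continuous_on S (\<lambda>x. gauss e (f x))"
  unfolding gauss_def by (intro continuous_intros) auto

lemma measurable_gauss[measurable]: "gauss e \<in> borel_measurable borel"
  by (intro borel_measurable_continuous_onI continuous_gauss continuous_on_id)

lemma
  fixes x :: "'a::euclidean_space"
  assumes "e > 0"
  shows gauss_fourier_integrable: "integrable lborel (\<lambda>y::'a. of_real (gauss e y) * iexp (x \<bullet> y))"
    and gauss_fourier: "(CLINT y|lborel. of_real (gauss e y) * iexp (x \<bullet> y)) =
      complex_of_real (sqrt (2 * pi / e) ^ DIM('a) * gauss (1 / e) x)"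
proof -
  let ?f = "\<lambda>b t. complex_of_real (exp (- (e * t\<^sup>2 / 2))) * iexp ((x \<bullet> b) * t)"
  have n: "(norm y)\<^sup>2 = (\<Sum>b\<in>Basis. (y \<bullet> b)\<^sup>2)" for y :: 'a
    unfolding power2_norm_eq_inner by (subst euclidean_inner) (simp add: power2_eq_square)
  \<comment> \<open>Gaussian and character both factor over the coordinates, which reduces
    everything to the line.\<close>
  have p: "of_real (gauss e y) * iexp (x \<bullet> y) = (\<Prod>b\<in>Basis. ?f b (y \<bullet> b))" for y
    unfolding prod.distrib gauss_def n euclidean_inner[of x y]
    by (simp add: exp_sum sum_distrib_left sum_divide_distrib sum_negf[symmetric] of_real_prod)
  show "integrable lborel (\<lambda>y::'a. of_real (gauss e y) * iexp (x \<bullet> y))"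
    unfolding p using gaussian_fourier_real(1)[OF assms] by (rule lborel_integrable_prod)
  have "(CLINT y|lborel. of_real (gauss e y) * iexp (x \<bullet> y)) =
      (\<Prod>b\<in>Basis. complex_of_real (sqrt (2 * pi / e) * exp (- ((x \<bullet> b)\<^sup>2 / (2 * e)))))"
    unfolding p by (subst lborel_integral_prod) (simp_all only: gaussian_fourier_real[OF assms])
  also have "\<dots> = complex_of_real (sqrt (2 * pi / e) ^ DIM('a) * gauss (1 / e) x)"
    unfolding of_real_prod[symmetric] prod.distrib gauss_def n
    by (simp add: exp_sum sum_divide_distrib sum_negf[symmetric] field_simps)
  finally show "(CLINT y|lborel. of_real (gauss e y) * iexp (x \<bullet> y)) =
      complex_of_real (sqrt (2 * pi / e) ^ DIM('a) * gauss (1 / e) x)" .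
qed

lemma
  assumes "e > 0"
  shows gauss_integrable: "integrable lborel (gauss e :: 'a::euclidean_space \<Rightarrow> real)"
    and gauss_integral: "(LINT y::'a|lborel. gauss e y) = sqrt (2 * pi / e) ^ DIM('a)"
proof -
  have i: "integrable lborel (\<lambda>y::'a. complex_of_real (gauss e y))"
    using gauss_fourier_integrable[OF assms, of 0] by simp
  then show "integrable lborel (gauss e :: 'a \<Rightarrow> real)"
    by (simp add: complex_of_real_integrable_eq)
  show "(LINT y::'a|lborel. gauss e y) = sqrt (2 * pi / e) ^ DIM('a)"
    using gauss_fourier[OF assms, of "0::'a"]
    by (simp add: gauss_def integral_complex_of_real flip: of_real_power)
qed

section \<open>Positive definite functions\<close>

lemma borel_measurable_cnj[measurable (raw)]:
  "f \<in> borel_measurable M \<Longrightarrow> (\<lambda>x. cnj (f x)) \<in> borel_measurable M"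
  by (rule borel_measurable_continuous_on[of cnj]) (intro continuous_intros)

lemma gauss_inverse_Suc_tendsto: "(\<lambda>n. gauss (inverse (real (Suc n))) x) \<longlonglongrightarrow> 1"
proof -
  have "(\<lambda>n. exp (- (inverse (real (Suc n)) * (norm x)\<^sup>2 / 2))) \<longlonglongrightarrow> exp (- (0 * (norm x)\<^sup>2 / 2))"
    by (intro tendsto_intros LIMSEQ_inverse_real_of_nat) auto
  then show ?thesis by (simp add: gauss_def)
qed

text \<open>The form of Fatou's lemma that removes a damping: the limit becomes integrable together
  with its bound.\<close>

lemma L1_Fatou:
  fixes f :: "'a \<Rightarrow> 'b::{banach, second_countable_topology}"
  assumes f: "f \<in> borel_measurable M" and lim: "\<And>x. (\<lambda>n. a n x) \<longlonglongrightarrow> f x"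
    and a: "\<And>n. integrable M (a n)" "\<And>n. (LINT x|M. norm (a n x)) \<le> D"
  shows integrable_Fatou: "integrable M f" and integral_Fatou: "(LINT x|M. norm (f x)) \<le> D"
proof -
  have [measurable]: "f \<in> borel_measurable M" "a n \<in> borel_measurable M" for n using f a(1)[of n] by auto
  have "(0::real) \<le> (LINT x|M. norm (a 0 x))" by simp
  then have D: "D \<ge> 0" using a(2)[of 0] by linarith
  have "(\<integral>\<^sup>+x. ennreal (norm (f x)) \<partial>M) = (\<integral>\<^sup>+x. liminf (\<lambda>n. ennreal (norm (a n x))) \<partial>M)"
    using lim by (intro nn_integral_cong lim_imp_Liminf[symmetric] tendsto_ennrealI tendsto_norm) auto
  also have "\<dots> \<le> liminf (\<lambda>n. \<integral>\<^sup>+x. ennreal (norm (a n x)) \<partial>M)"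
    by (rule nn_integral_liminf) simp
  also have "\<dots> \<le> ennreal D"
  proof (intro Liminf_le always_eventually allI)
    fix n
    have "(\<integral>\<^sup>+x. ennreal (norm (a n x)) \<partial>M) = ennreal (LINT x|M. norm (a n x))"
      using a(1)[of n] by (intro nn_integral_eq_integral) auto
    also have "\<dots> \<le> ennreal D" by (intro ennreal_leI a(2))
    finally show "(\<integral>\<^sup>+x. ennreal (norm (a n x)) \<partial>M) \<le> ennreal D" .
  qed simp
  finally have le: "(\<integral>\<^sup>+x. ennreal (norm (f x)) \<partial>M) \<le> ennreal D" .
  then show i: "integrable M f"
    by (intro integrableI_bounded) (auto intro: le_less_trans)
  have "(\<integral>\<^sup>+x. ennreal (norm (f x)) \<partial>M) = ennreal (LINT x|M. norm (f x))"
    using i by (intro nn_integral_eq_integral) auto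
  then show "(LINT x|M. norm (f x)) \<le> D" using le D by (simp add: ennreal_le_iff)
qed

text \<open>The points themselves serve as indices, so the finite range of a simple function can be
  inserted directly.\<close>

definition psd_kernel :: "('a::ab_group_add \<Rightarrow> complex) \<Rightarrow> bool" where
  "psd_kernel g \<longleftrightarrow> (\<forall>A. finite A \<longrightarrow> psd_on A (\<lambda>s t. g (s - t)))"

text \<open>Simple functions converging to the identity discretise the double integral to quadratic forms.\<close>

lemma psd_kernel_double_integral:
  fixes g :: "'a::euclidean_space \<Rightarrow> complex"
  assumes g: "continuous_on UNIV g" "\<And>x. cmod (g x) \<le> B" "psd_kernel g"
    and \<psi>: "integrable lborel \<psi>"
  shows "(CLINT t|lborel. CLINT s|lborel. cnj (\<psi> s) * g (s - t) * \<psi> t) \<in> \<real>\<^sub>\<ge>\<^sub>0"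
proof -
  have [measurable]: "g \<in> borel_measurable borel" "\<psi> \<in> borel_measurable borel"
    using g(1) \<psi> by (auto intro: borel_measurable_continuous_onI)
  \<comment> \<open>Only the argument of \<open>g\<close> is discretised. Since
    \<open>\<psi>\<close> stays exact and \<open>g\<close> is bounded, one dominating function works
    for all \<open>i\<close>.\<close>
  obtain F where F: "\<And>i. simple_function lborel (F i)" "\<And>x::'a. (\<lambda>i. F i x) \<longlonglongrightarrow> x"
    using borel_measurable_implies_sequence_metric[of "\<lambda>x. x" lborel 0] by auto
  have Fm[measurable]: "F i \<in> borel_measurable borel" for i
    using borel_measurable_simple_function[OF F(1)] by simp
  define h where "h = (\<lambda>i t s. cnj (\<psi> s) * g (F i s - F i t) * \<psi> t)"
  have hm[measurable]: "(\<lambda>(t, s). h i t s) \<in> borel_measurable (borel \<Otimes>\<^sub>M borel)" for i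
    unfolding h_def by measurable
  have hm'[measurable]: "(\<lambda>t. integral\<^sup>L lborel (h i t)) \<in> borel_measurable lborel" for i
    using hm[of i] by (intro lborel.borel_measurable_lebesgue_integral) simp
  have hm2[measurable]: "(\<lambda>(t, s). cnj (\<psi> s) * g (s - t) * \<psi> t) \<in> borel_measurable (borel \<Otimes>\<^sub>M borel)"
    by measurable
  have h'[measurable]: "(\<lambda>t. CLINT s|lborel. cnj (\<psi> s) * g (s - t) * \<psi> t) \<in> borel_measurable lborel"
    using hm2 by (intro lborel.borel_measurable_lebesgue_integral) simp
  have hm3[measurable]: "h i t \<in> borel_measurable borel" for i t
    unfolding h_def by measurable
  have B: "B \<ge> 0" using norm_ge_zero[of "g 0"] g(2)[of 0] by linarith
  have bd: "cmod (h i t s) \<le> cmod (\<psi> s) * (B * cmod (\<psi> t))" for i t s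
    unfolding h_def norm_mult mult.assoc complex_mod_cnj
    by (intro mult_left_mono mult_right_mono g(2)) auto
  have hi: "integrable lborel (h i t)" for i t
    by (rule Bochner_Integration.integrable_bound[of _ "\<lambda>s. cmod (\<psi> s) * (B * cmod (\<psi> t))"])
      (use \<psi> bd B in auto)
  have pos: "(CLINT t|lborel. CLINT s|lborel. h i t s) \<in> \<real>\<^sub>\<ge>\<^sub>0" for i
  proof -
    define A where "A = range (F i)"
    have A: "finite A" using F(1)[of i] by (simp add: A_def simple_function_def)
    \<comment> \<open>\<open>P a\<close> is \<open>\<psi>\<close> cut to the cell on which
      \<open>F i\<close> takes the value \<open>a\<close>; the discretised double integral is the
      quadratic form of \<open>g (a - b)\<close> at the vector of integrals of the
      \<open>P a\<close>.\<close>
    define P where "P = (\<lambda>a s. indicator (F i -` {a}) s *\<^sub>R \<psi> s)"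
    have Pi: "integrable lborel (P a)" for a
      unfolding P_def by (intro integrable_mult_indicator \<psi>) (use measurable_sets[OF Fm, of "{a}" i] in simp)
    have Ps: "P a s = (if a = F i s then \<psi> s else 0)" for a s
      by (simp add: P_def)
    have FA: "F i s \<in> A" for s by (simp add: A_def)
    have "h i t s = (\<Sum>a\<in>A. \<Sum>b\<in>A. cnj (P a s) * g (a - b) * P b t)" for s t
      unfolding h_def Ps using FA A
      by (simp add: if_distrib[of cnj] if_distrib[of "\<lambda>x. x * _"] if_distrib[of "\<lambda>x. _ * x"] sum.delta' cong: if_cong)
    then have "(CLINT t|lborel. CLINT s|lborel. h i t s) =
      (\<Sum>a\<in>A. \<Sum>b\<in>A. cnj (integral\<^sup>L lborel (P a)) * g (a - b) * integral\<^sup>L lborel (P b))"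
      using Pi by simp
    then show ?thesis
      using psd_onD[of A "\<lambda>s t. g (s - t)" "\<lambda>a. integral\<^sup>L lborel (P a)"] g(3) A
      by (simp add: psd_kernel_def)
  qed
  have inner: "(\<lambda>i. CLINT s|lborel. h i t s) \<longlonglongrightarrow> (CLINT s|lborel. cnj (\<psi> s) * g (s - t) * \<psi> t)" for t
  proof (rule integral_dominated_convergence[where w="\<lambda>s. cmod (\<psi> s) * (B * cmod (\<psi> t))"])
    have "(\<lambda>i. h i t s) \<longlonglongrightarrow> cnj (\<psi> s) * g (s - t) * \<psi> t" for s
      unfolding h_def
      by (intro tendsto_intros F(2) continuous_on_tendsto_compose[OF g(1)]) auto
    then show "AE s in lborel. (\<lambda>i. h i t s) \<longlonglongrightarrow> cnj (\<psi> s) * g (s - t) * \<psi> t" by simp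
  qed (use \<psi> bd in auto)
  have "(\<lambda>i. CLINT t|lborel. CLINT s|lborel. h i t s) \<longlonglongrightarrow>
     (CLINT t|lborel. CLINT s|lborel. cnj (\<psi> s) * g (s - t) * \<psi> t)"
  proof (rule integral_dominated_convergence[where w="\<lambda>t. (LINT s|lborel. cmod (\<psi> s)) * (B * cmod (\<psi> t))"])
    fix i
    have "cmod (CLINT s|lborel. h i t s) \<le> (LINT s|lborel. cmod (\<psi> s)) * (B * cmod (\<psi> t))" for t
    proof -
      have "cmod (CLINT s|lborel. h i t s) \<le> (LINT s|lborel. cmod (\<psi> s) * (B * cmod (\<psi> t)))"
        using \<psi> bd by (intro Bochner_Integration.integral_norm_bound_integral hi) auto
      then show ?thesis using \<psi> by simp
    qed
    then show "AE t in lborel. cmod (CLINT s|lborel. h i t s) \<le> (LINT s|lborel. cmod (\<psi> s)) * (B * cmod (\<psi> t))"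
      by simp
  qed (use \<psi> inner in auto)
  then show ?thesis by (rule nonneg_Reals_limI) (rule pos)
qed

text \<open>Unnormalised and with the sign of the inverse transform: the convolution kernel of the
  damped multiplier. Powers of \<open>2 * pi\<close> reappear in the mass bound and in
  \<open>\<kappa>\<close>.\<close>

definition gauss_kernel :: "('a::euclidean_space \<Rightarrow> complex) \<Rightarrow> real \<Rightarrow> 'a \<Rightarrow> complex" where
  "gauss_kernel g e x = (CLINT y|lborel. iexp (x \<bullet> y) * g y * of_real (gauss e y))"

lemma gauss_mult_integrable:
  fixes g :: "'a::euclidean_space \<Rightarrow> complex"
  assumes [measurable]: "g \<in> borel_measurable borel" and B: "\<And>x. cmod (g x) \<le> B" and "e > 0"
  shows "integrable lborel (\<lambda>y. g y * of_real (gauss e y))"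
proof (rule Bochner_Integration.integrable_bound[of _ "\<lambda>y. B * gauss e y"])
  have "B \<ge> 0" using norm_ge_zero[of "g 0"] B[of 0] by linarith
  then show "AE y in lborel. norm (g y * of_real (gauss e y)) \<le> norm (B * gauss e y)"
    using B by (auto simp: norm_mult mult_right_mono)
qed (use gauss_integrable[OF assms(3)] in auto)

lemma iexp_measurable[measurable]:
  "(\<lambda>y. iexp (x \<bullet> y)) \<in> borel_measurable borel"
  by (intro borel_measurable_continuous_onI continuous_intros)

lemma iexp_pair_measurable[measurable]:
  "(\<lambda>(x, y). iexp (x \<bullet> y)) \<in> borel_measurable (borel \<Otimes>\<^sub>M (borel :: 'a::euclidean_space measure))"
  unfolding borel_prod by (intro borel_measurable_continuous_onI) (auto intro!: continuous_intros simp: split_beta)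

lemma iexp_mult_integrable_iff:
  fixes g :: "'a::euclidean_space \<Rightarrow> complex"
  assumes "g \<in> borel_measurable borel"
  shows "integrable lborel (\<lambda>y. iexp (x \<bullet> y) * g y) \<longleftrightarrow> integrable lborel g"
proof -
  have "integrable lborel (\<lambda>y. iexp (x \<bullet> y) * g y) \<longleftrightarrow> integrable lborel (\<lambda>y. norm (iexp (x \<bullet> y) * g y))"
    using assms by (subst integrable_norm_iff) auto
  also have "\<dots> \<longleftrightarrow> integrable lborel g"
    unfolding norm_mult norm_exp_i_times using assms by (simp add: integrable_norm_iff)
  finally show ?thesis .
qed

lemma gauss_kernel_integrable:
  fixes g :: "'a::euclidean_space \<Rightarrow> complex"
  assumes "g \<in> borel_measurable borel" "\<And>x. cmod (g x) \<le> B" "e > 0"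
  shows "integrable lborel (\<lambda>y. iexp (x \<bullet> y) * g y * of_real (gauss e y))"
proof -
  have [measurable]: "g \<in> borel_measurable borel" by fact
  show ?thesis
    unfolding mult.assoc
    by (subst iexp_mult_integrable_iff) (auto intro: gauss_mult_integrable[OF assms])
qed

lemma continuous_fourier_integral:
  fixes f :: "'a::euclidean_space \<Rightarrow> complex"
  assumes f: "integrable lborel f"
  shows "continuous_on UNIV (\<lambda>x. CLINT y|lborel. iexp (x \<bullet> y) * f y)"
proof (rule continuous_on_sequentiallyI)
  fix u :: "nat \<Rightarrow> 'a" and a assume u: "u \<longlonglongrightarrow> a"
  show "(\<lambda>n. CLINT y|lborel. iexp (u n \<bullet> y) * f y) \<longlonglongrightarrow> (CLINT y|lborel. iexp (a \<bullet> y) * f y)"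
  proof (rule integral_dominated_convergence[where w="\<lambda>y. cmod (f y)"])
    have "(\<lambda>i. iexp (u i \<bullet> y) * f y) \<longlonglongrightarrow> iexp (a \<bullet> y) * f y" for y
      by (intro tendsto_intros u)
    then show "AE y in lborel. (\<lambda>i. iexp (u i \<bullet> y) * f y) \<longlonglongrightarrow> iexp (a \<bullet> y) * f y" by simp
  qed (use f in \<open>auto simp: norm_mult\<close>)
qed

lemma continuous_gauss_kernel:
  fixes g :: "'a::euclidean_space \<Rightarrow> complex"
  assumes "g \<in> borel_measurable borel" "\<And>x. cmod (g x) \<le> B" "e > 0"
  shows "continuous_on UNIV (gauss_kernel g e)"
  using continuous_fourier_integral[OF gauss_mult_integrable[OF assms]]
  unfolding gauss_kernel_def mult.assoc .

text \<open>The parallelogram identity in the exponent. It separates the difference \<open>y\<close>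
  of the two arguments from their midpoint, so that integrating out \<open>t\<close> leaves a
  Gaussian in \<open>y\<close> alone.\<close>

lemma gauss_product:
  fixes y t :: "'a::euclidean_space"
  shows "gauss e (y + t) * gauss e t = gauss (e / 2) y * gauss (2 * e) (t + (1/2) *\<^sub>R y)"
proof -
  have "e * (norm (y + t))\<^sup>2 / 2 + e * (norm t)\<^sup>2 / 2
      = e / 2 * (norm y)\<^sup>2 / 2 + 2 * e * (norm (t + (1/2) *\<^sub>R y))\<^sup>2 / 2"
    unfolding power2_norm_eq_inner
    by (simp add: inner_add_left inner_add_right inner_commute field_simps)
  then show ?thesis
    by (simp add: gauss_def flip: exp_add)
qed

text \<open>The double integral is tested with a Gaussian modulated by the frequency
  \<open>- x\<close>. After \<open>s = t + y\<close> the phases combine to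
  \<open>iexp (x \<bullet> y)\<close> and the Gaussians to \<open>gauss e y\<close> times a factor
  whose mass in \<open>t\<close> is constant, so the double integral is a positive multiple of the
  kernel at \<open>x\<close>.\<close>

lemma gauss_kernel_nonneg:
  fixes g :: "'a::euclidean_space \<Rightarrow> complex"
  assumes g: "continuous_on UNIV g" "\<And>x. cmod (g x) \<le> B" "psd_kernel g" and e: "e > 0"
  shows "gauss_kernel g e x \<in> \<real>\<^sub>\<ge>\<^sub>0"
proof -
  have gm[measurable]: "g \<in> borel_measurable borel"
    using g(1) by (auto intro: borel_measurable_continuous_onI)
  \<comment> \<open>Autocorrelation halves the parameter of a Gaussian, so \<open>d = 2 * e\<close>
    produces the damping \<open>gauss e\<close>.\<close>
  define d where "d = 2 * e"
  have d: "d > 0" using e by (simp add: d_def)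
  define \<psi> where "\<psi> = (\<lambda>t. of_real (gauss d t) * iexp ((- x) \<bullet> t))"
  have \<psi>: "integrable lborel \<psi>"
    unfolding \<psi>_def by (rule gauss_fourier_integrable[OF d])
  define C where "C = sqrt (2 * pi / (2 * d)) ^ DIM('a)"
  have C: "C > 0" using d by (simp add: C_def)
  have shift: "(LINT t|lborel. gauss (2 * d) (t + y)) = C" for y :: 'a
    using lborel_integral_affine[of 1 "gauss (2 * d) :: 'a \<Rightarrow> real" y] gauss_integral[of "2 * d", where ?'a = 'a] d
    by (simp add: C_def add.commute)
  have shifti: "integrable lborel (\<lambda>t. gauss (2 * d) (t + y))" for y :: 'a
    using lborel_integrable_affine[of 1 "gauss (2 * d) :: 'a \<Rightarrow> real" y] gauss_integrable[of "2 * d", where ?'a = 'a] d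
    by (simp add: add.commute)
  define k where "k = (\<lambda>y t. (iexp (x \<bullet> y) * g y * of_real (gauss e y)) * of_real (gauss (2 * d) (t + (1/2) *\<^sub>R y)))"
  have km[measurable]: "(\<lambda>(y, t). k y t) \<in> borel_measurable (borel \<Otimes>\<^sub>M borel)"
    unfolding k_def by measurable
  have inner: "(CLINT s|lborel. cnj (\<psi> s) * g (s - t) * \<psi> t) = (CLINT y|lborel. k y t)" for t
  proof -
    have "(\<lambda>s. cnj (\<psi> s) * g (s - t) * \<psi> t) \<in> borel_measurable borel"
      using borel_measurable_integrable[OF \<psi>] by measurable
    then have "(CLINT s|lborel. cnj (\<psi> s) * g (s - t) * \<psi> t) = (CLINT y|lborel. cnj (\<psi> (t + y)) * g y * \<psi> t)"
      using lborel_integral_affine[of 1 "\<lambda>s. cnj (\<psi> s) * g (s - t) * \<psi> t" t] by simp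
    also have "\<dots> = (CLINT y|lborel. k y t)"
    proof (rule Bochner_Integration.integral_cong[OF refl])
      fix y
      have "cnj (\<psi> (t + y)) * g y * \<psi> t =
        of_real (gauss d (y + t) * gauss d t) * (iexp (x \<bullet> (t + y)) * iexp (- (x \<bullet> t))) * g y"
        by (simp add: \<psi>_def exp_cnj add.commute mult_ac)
      also have "iexp (x \<bullet> (t + y)) * iexp (- (x \<bullet> t)) = iexp (x \<bullet> y)"
        by (simp add: inner_add_right algebra_simps flip: exp_add)
      finally show "cnj (\<psi> (t + y)) * g y * \<psi> t = k y t"
        unfolding gauss_product by (simp add: k_def d_def mult_ac)
    qed
    finally show ?thesis .
  qed
  have ki: "integrable (lborel \<Otimes>\<^sub>M lborel) (\<lambda>(y, t). k y t)"
  proof (rule lborel_pair.Fubini_integrable)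
    have "(LINT t|lborel. norm (k y t)) = norm (iexp (x \<bullet> y) * g y * of_real (gauss e y)) * C" for y
      unfolding k_def norm_mult[of "iexp (x \<bullet> y) * g y * of_real (gauss e y)" for y]
      using shift by simp
    then show "integrable lborel (\<lambda>y. LINT t|lborel. norm (case (y, t) of (y, t) \<Rightarrow> k y t))"
      using integrable_norm[OF gauss_kernel_integrable[OF gm g(2) e, of x]] by simp
    show "AE y in lborel. integrable lborel (\<lambda>t. case (y, t) of (y, t) \<Rightarrow> k y t)"
      unfolding k_def using shifti by simp
  qed simp
  have "(CLINT t|lborel. CLINT s|lborel. cnj (\<psi> s) * g (s - t) * \<psi> t) = (CLINT y|lborel. CLINT t|lborel. k y t)"
    unfolding inner by (rule lborel_pair.Fubini_integral[OF ki])
  also have "\<dots> = gauss_kernel g e x * of_real C"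
    unfolding k_def gauss_kernel_def using shift by simp
  finally have "gauss_kernel g e x * of_real C \<in> \<real>\<^sub>\<ge>\<^sub>0"
    using psd_kernel_double_integral[OF g \<psi>] by simp
  then have "gauss_kernel g e x * of_real C / of_real C \<in> \<real>\<^sub>\<ge>\<^sub>0"
    by (rule nonneg_Reals_divide_I) (use C in simp)
  moreover have "gauss_kernel g e x * of_real C / of_real C = gauss_kernel g e x"
    using C by simp
  ultimately show ?thesis by (simp only:)
qed

text \<open>Pairing with a wide Gaussian, whose transform has constant mass, bounds the mass of the kernel.\<close>

lemma gauss_kernel_mass:
  fixes g :: "'a::euclidean_space \<Rightarrow> complex"
  assumes g: "continuous_on UNIV g" "\<And>x. cmod (g x) \<le> B" "psd_kernel g" and e: "e > 0"
  shows "integrable lborel (gauss_kernel g e)"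
    and "(LINT x|lborel. cmod (gauss_kernel g e x)) \<le> (2 * pi) ^ DIM('a) * B"
proof -
  have gm[measurable]: "g \<in> borel_measurable borel"
    using g(1) by (auto intro: borel_measurable_continuous_onI)
  have [measurable]: "gauss_kernel g e \<in> borel_measurable borel"
    by (intro borel_measurable_continuous_onI continuous_gauss_kernel[OF gm g(2) e])
  have B: "B \<ge> 0" using norm_ge_zero[of "g 0"] g(2)[of 0] by linarith
  \<comment> \<open>The kernel is nonnegative, so its \<open>L^1\<close> norm is its plain integral,
    which Fubini can reach.\<close>
  define u where "u = (\<lambda>x. Re (gauss_kernel g e x))"
  have u: "gauss_kernel g e x = of_real (u x)" "u x \<ge> 0" for x
    using gauss_kernel_nonneg[OF g e, of x] by (auto simp: u_def complex_nonneg_Reals_iff complex_eq_iff)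
  have um[measurable]: "u \<in> borel_measurable borel" unfolding u_def by measurable
  let ?G = "\<lambda>y. g y * of_real (gauss e y)"
  have G: "integrable lborel ?G" by (rule gauss_mult_integrable[OF gm g(2) e])
  have D: "integrable lborel (\<lambda>x. u x * gauss d x)"
     "(LINT x|lborel. u x * gauss d x) \<le> (2 * pi) ^ DIM('a) * B" if d: "d > 0" for d
  proof -
    define k where "k = (\<lambda>x y. iexp (x \<bullet> y) * ?G y * of_real (gauss d x))"
    have [measurable]: "(\<lambda>(x, y). k x y) \<in> borel_measurable (borel \<Otimes>\<^sub>M borel)"
      unfolding k_def by measurable
    have ki: "integrable (lborel \<Otimes>\<^sub>M lborel) (\<lambda>(x, y). k x y)"
    proof (rule lborel_pair.Fubini_integrable)
      have "(LINT y|lborel. norm (k x y)) = (LINT y|lborel. norm (?G y)) * gauss d x" for x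
        unfolding k_def by (simp add: norm_mult)
      then show "integrable lborel (\<lambda>x. LINT y|lborel. norm (case (x, y) of (x, y) \<Rightarrow> k x y))"
        using gauss_integrable[OF d, where ?'a = 'a] by simp
      show "AE x in lborel. integrable lborel (\<lambda>y. case (x, y) of (x, y) \<Rightarrow> k x y)"
      proof -
        have "integrable lborel (\<lambda>y. iexp (x \<bullet> y) * ?G y)" for x
          using gauss_kernel_integrable[OF gm g(2) e, of x] by (simp only: mult.assoc)
        then show ?thesis
          unfolding k_def prod.case by (intro always_eventually allI integrable_mult_left)
      qed
    qed simp
    have K: "(CLINT y|lborel. k x y) = of_real (u x * gauss d x)" for x
      unfolding k_def of_real_mult u(1)[symmetric] integral_mult_left_zero
      by (simp only: gauss_kernel_def mult.assoc)
    have "integrable lborel (\<lambda>x. CLINT y|lborel. k x y)"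
      using lborel_pair.integrable_fst[OF ki] by simp
    then show "integrable lborel (\<lambda>x. u x * gauss d x)"
      unfolding K complex_of_real_integrable_eq .
    define c where "c = sqrt (2 * pi / d) ^ DIM('a)"
    have "complex_of_real (LINT x|lborel. u x * gauss d x) = (CLINT x|lborel. CLINT y|lborel. k x y)"
      unfolding K by (rule integral_complex_of_real[symmetric])
    also have "\<dots> = (CLINT y|lborel. CLINT x|lborel. k x y)"
      by (rule lborel_pair.Fubini_integral[OF ki, symmetric])
    also have "\<dots> = (CLINT y|lborel. ?G y * of_real (c * gauss (1 / d) y))"
    proof (rule Bochner_Integration.integral_cong[OF refl])
      fix y :: 'a
      have "(CLINT x|lborel. k x y) = (CLINT x|lborel. ?G y * (of_real (gauss d x) * iexp (y \<bullet> x)))"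
        unfolding k_def by (simp add: mult_ac inner_commute)
      also have "\<dots> = ?G y * of_real (c * gauss (1 / d) y)"
        unfolding integral_mult_right_zero gauss_fourier[OF d] c_def ..
      finally show "(CLINT x|lborel. k x y) = ?G y * of_real (c * gauss (1 / d) y)" .
    qed
    finally have "norm (LINT x|lborel. u x * gauss d x) = norm (CLINT y|lborel. ?G y * of_real (c * gauss (1 / d) y))"
      by (metis norm_of_real real_norm_def)
    also have "\<dots> \<le> (LINT y::'a|lborel. (B * c) * gauss (1 / d) y)"
    proof (rule Bochner_Integration.integral_norm_bound_integral)
      have c: "c \<ge> 0" using d by (simp add: c_def)
      have le: "norm (?G y * of_real (c * gauss (1 / d) y)) \<le> B * c * gauss (1 / d) y" for y
      proof -
        have "norm (?G y) \<le> B * 1"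
          unfolding norm_mult using g(2)[of y] B gauss_le_1[of e y] e by (intro mult_mono) auto
        then have "norm (?G y) * (c * gauss (1 / d) y) \<le> B * (c * gauss (1 / d) y)"
          using c by (intro mult_right_mono) auto
        then show ?thesis using c by (simp add: norm_mult mult_ac)
      qed
      then show "norm (?G y * of_real (c * gauss (1 / d) y)) \<le> B * c * gauss (1 / d) y" for y .
      show i: "integrable lborel (\<lambda>y::'a. B * c * gauss (1 / d) y)"
        using gauss_integrable[of "1/d", where ?'a = 'a] d by simp
      show "integrable lborel (\<lambda>y. ?G y * of_real (c * gauss (1 / d) y))"
      proof (rule Bochner_Integration.integrable_bound[OF i])
        show "AE y in lborel. norm (?G y * of_real (c * gauss (1 / d) y)) \<le> norm (B * c * gauss (1 / d) y)"
          unfolding real_norm_def by (intro always_eventually allI order_trans[OF le abs_ge_self])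
      qed measurable
    qed
    \<comment> \<open>The masses of \<open>gauss d\<close> and \<open>gauss (1 / d)\<close> multiply
      to \<open>(2 * pi) ^ DIM('a)\<close>: the dependence on \<open>d\<close> cancels, and that on
      \<open>e\<close> went with \<open>gauss e y <= 1\<close>.\<close>
    also have "\<dots> = B * (sqrt (2 * pi / d) * sqrt (2 * pi * d)) ^ DIM('a)"
      using gauss_integral[of "1/d", where ?'a='a] d by (simp add: c_def power_mult_distrib)
    also have "sqrt (2 * pi / d) * sqrt (2 * pi * d) = 2 * pi"
    proof -
      have "(2 * pi / d) * (2 * pi * d) = (2 * pi)\<^sup>2"
        using d by (simp add: power2_eq_square)
      then show ?thesis
        by (simp only: real_sqrt_abs flip: real_sqrt_mult) (simp only: abs_of_pos pi_gt_zero mult_pos_pos zero_less_numeral)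
    qed
    also have "B * (2 * pi) ^ DIM('a) = (2 * pi) ^ DIM('a) * B"
      by (rule mult.commute)
    finally show "(LINT x|lborel. u x * gauss d x) \<le> (2 * pi) ^ DIM('a) * B" by simp
  qed
  \<comment> \<open>The auxiliary weight is removed along \<open>d = 1 / (n + 1)\<close>; the bound
    does not see \<open>d\<close>, so it survives.\<close>
  define w where "w = (\<lambda>n x. u x * gauss (inverse (real (Suc n))) x)"
  have lim: "(\<lambda>n. w n x) \<longlonglongrightarrow> u x" for x
    using tendsto_mult[OF tendsto_const gauss_inverse_Suc_tendsto, of "u x" x] by (simp add: w_def)
  have "integrable lborel (w n)" "(LINT x|lborel. norm (w n x)) \<le> (2 * pi) ^ DIM('a) * B" for n
    using D[of "inverse (real (Suc n))"] u(2) by (simp_all add: w_def)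
  note Fatou = L1_Fatou[of u lborel w, OF _ lim this]
  show "integrable lborel (gauss_kernel g e)"
    unfolding u(1)[abs_def] by (intro integrable_of_real Fatou(1)) simp
  show "(LINT x|lborel. cmod (gauss_kernel g e x)) \<le> (2 * pi) ^ DIM('a) * B"
    using Fatou(2) unfolding u(1) by simp
qed

section \<open>Smooth functions of compact support\<close>

text \<open>\<open>C_k\<close> is phrased with \<open>frechet_derivative\<close>; by uniqueness of
  derivatives any explicitly known derivative may stand in for it.\<close>

lemma C_k_SucI:
  assumes "\<And>x. (f has_derivative f' x) (at x)" "\<And>i. C_k k (\<lambda>x. f' x (axis i 1))"
  shows "C_k (Suc k) f"
proof -
  have "frechet_derivative f (at x) = f' x" for x
    using frechet_derivative_at[OF assms(1)] by simp
  then show ?thesis using assms by (auto simp: differentiable_def)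
qed

lemma C_k_SucD: "C_k (Suc k) f \<Longrightarrow> C_k k f"
proof (induction k arbitrary: f)
  case 0
  then show ?case
    by (auto intro!: differentiable_imp_continuous_on simp: differentiable_on_def differentiable_at_withinI)
next
  case (Suc k)
  then show ?case by (simp only: C_k.simps) blast
qed

lemma C_k_Suc_has_derivative:
  "C_k (Suc k) f \<Longrightarrow> (f has_derivative frechet_derivative f (at x)) (at x)"
  by (simp add: frechet_derivative_works[symmetric])

lemma C_k_const: "C_k k (\<lambda>x. c)"
  by (induction k arbitrary: c) auto

lemma C_k_add: "C_k k f \<Longrightarrow> C_k k g \<Longrightarrow> C_k k (\<lambda>x. f x + g x)"
proof (induction k arbitrary: f g)
  case 0
  then show ?case by (simp add: continuous_on_add)
next
  case (Suc k)
  show ?case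
    by (rule C_k_SucI[OF has_derivative_add[OF C_k_Suc_has_derivative[OF Suc.prems(1)] C_k_Suc_has_derivative[OF Suc.prems(2)]]])
      (use Suc in auto)
qed

lemma C_k_bounded_linear:
  assumes "bounded_linear L"
  shows "C_k k f \<Longrightarrow> C_k k (\<lambda>x. L (f x))"
proof (induction k arbitrary: f)
  case 0
  then show ?case using bounded_linear.continuous_on[OF assms] by simp
next
  case (Suc k)
  show ?case
    by (rule C_k_SucI[OF bounded_linear.has_derivative[OF assms C_k_Suc_has_derivative[OF Suc.prems(1)]]])
      (use Suc in auto)
qed

lemma C_k_mult:
  fixes f g :: "real^'n \<Rightarrow> 'b::real_normed_algebra"
  shows "C_k k f \<Longrightarrow> C_k k g \<Longrightarrow> C_k k (\<lambda>x. f x * g x)"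
proof (induction k arbitrary: f g)
  case 0
  then show ?case by (simp add: continuous_on_mult)
next
  case (Suc k)
  show ?case
    by (rule C_k_SucI[OF has_derivative_mult[OF C_k_Suc_has_derivative[OF Suc.prems(1)] C_k_Suc_has_derivative[OF Suc.prems(2)]]])
      (use Suc C_k_SucD[OF Suc.prems(1)] C_k_SucD[OF Suc.prems(2)] in \<open>auto intro!: C_k_add\<close>)
qed

lemma C_k_prod:
  fixes f :: "'i \<Rightarrow> real^'n \<Rightarrow> 'b::{real_normed_algebra, comm_ring_1}"
  shows "(\<And>i. i \<in> I \<Longrightarrow> C_k k (f i)) \<Longrightarrow> C_k k (\<lambda>x. \<Prod>i\<in>I. f i x)"
  by (induction I rule: infinite_finite_induct) (auto intro: C_k_const C_k_mult)

lemma C_k_iexp: "C_k k (\<lambda>x. iexp (a \<bullet> x))"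
proof (induction k)
  case 0
  then show ?case by (auto intro!: continuous_intros)
next
  case (Suc k)
  have d: "((\<lambda>x. iexp (a \<bullet> x)) has_derivative (\<lambda>h. iexp (a \<bullet> x) * (\<i> * of_real (a \<bullet> h)))) (at x)" for x
  proof -
    have "((\<lambda>x. \<i> * of_real (a \<bullet> x)) has_derivative (\<lambda>h. \<i> * of_real (a \<bullet> h))) (at x)"
      by (auto intro!: derivative_eq_intros)
    from has_derivative_compose[OF this DERIV_exp[unfolded has_field_derivative_def]] show ?thesis .
  qed
  show ?case
    by (rule C_k_SucI[OF d]) (intro C_k_mult C_k_const Suc)
qed

text \<open>The polynomial factor makes the family closed under differentiation.\<close>

definition bump :: "real poly \<Rightarrow> real \<Rightarrow> real" where
  "bump p t = (if t \<le> 0 then 0 else poly p (inverse t) * exp (- inverse t))"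

lemma poly_mult_exp_minus_tendsto:
  fixes p :: "real poly"
  shows "((\<lambda>u. poly p u * exp (- u)) \<longlongrightarrow> 0) at_top"
proof -
  have "((\<lambda>u. \<Sum>i\<le>degree p. coeff p i * (u ^ i / exp u)) \<longlongrightarrow> (\<Sum>i\<le>degree p. coeff p i * 0)) at_top"
    by (intro tendsto_intros tendsto_power_div_exp_0)
  then show ?thesis
    by (simp add: poly_altdef sum_distrib_right sum_distrib_left exp_minus divide_inverse mult_ac)
qed

text \<open>With \<open>u = 1 / t\<close> the chain rule contributes the factor
  \<open>- u^2\<close>, so differentiating \<open>p(u) * exp (- u)\<close> gives
  \<open>u^2 * (p - p')(u) * exp (- u)\<close>; this is the origin of the new polynomial.\<close>

lemma bump_has_real_derivative:
  "(bump p has_real_derivative bump ([:0, 0, 1:] * (p - pderiv p)) t) (at t)"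
proof -
  consider "t < 0" | "t = 0" | "t > 0" by linarith
  then show ?thesis
  proof cases
    case 1
    have "((\<lambda>_. 0) has_real_derivative 0) (at t)" by simp
    moreover have "eventually (\<lambda>s. 0 = bump p s) (nhds t)"
      using eventually_nhds_in_open[of "{..<0}" t] 1 by (auto elim!: eventually_mono simp: bump_def)
    ultimately have "(bump p has_real_derivative 0) (at t)"
      using DERIV_cong_ev[OF refl _ refl, of "\<lambda>_. 0" "bump p" t 0] by simp
    then show ?thesis using 1 by (simp add: bump_def)
  next
    case 3
    have "((\<lambda>s. poly p (inverse s) * exp (- inverse s)) has_real_derivative
        poly p (inverse t) * (exp (- inverse t) * (inverse t ^ 2)) - poly (pderiv p) (inverse t) * (inverse t ^ 2) * exp (- inverse t)) (at t)"
      using 3 by (auto intro!: derivative_eq_intros DERIV_chain2[OF poly_DERIV] simp: power2_eq_square)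
    moreover have "eventually (\<lambda>s. poly p (inverse s) * exp (- inverse s) = bump p s) (nhds t)"
      using eventually_nhds_in_open[of "{0<..}" t] 3 by (auto elim!: eventually_mono simp: bump_def)
    ultimately have "(bump p has_real_derivative
        poly p (inverse t) * (exp (- inverse t) * (inverse t ^ 2)) - poly (pderiv p) (inverse t) * (inverse t ^ 2) * exp (- inverse t)) (at t)"
      by (rule DERIV_cong_ev[OF refl _ refl, THEN iffD1, rotated])
    then show ?thesis using 3
      by (simp add: bump_def power2_eq_square algebra_simps)
  next
    case 2
    \<comment> \<open>For \<open>h > 0\<close> the quotient \<open>bump p h / h\<close> is this
      expression at \<open>u = 1 / h\<close>; dividing by \<open>h\<close> multiplies the polynomial
      by its variable.\<close>
    have "((\<lambda>u. poly ([:0, 1:] * p) u * exp (- u)) \<longlongrightarrow> 0) at_top"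
      by (rule poly_mult_exp_minus_tendsto)
    then have "((\<lambda>h. poly ([:0, 1:] * p) (inverse h) * exp (- inverse h)) \<longlongrightarrow> 0) (at_right 0)"
      by (rule filterlim_compose) (rule filterlim_inverse_at_top_right)
    then have r: "((\<lambda>h. bump p h / h) \<longlongrightarrow> 0) (at_right 0)"
      by (rule Lim_transform_eventually)
        (auto simp: bump_def eventually_at_right_less divide_inverse intro!: eventually_at_rightI[of 0 1])
    have l: "((\<lambda>h. bump p h / h) \<longlongrightarrow> 0) (at_left 0)"
      by (rule Lim_transform_eventually[OF tendsto_const])
        (auto simp: bump_def intro!: eventually_at_leftI[of "-1" 0])
    have "((\<lambda>h. bump p h / h) \<longlongrightarrow> 0) (at 0)"
      using r l by (simp add: filterlim_split_at_real filterlim_at_split)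
    then show ?thesis using 2
      by (simp add: has_field_derivative_iff bump_def)
  qed
qed

lemma C_k_bump: "C_k k (\<lambda>x. complex_of_real (bump p (c + a \<bullet> x)))"
proof (induction k arbitrary: p)
  case 0
  have "continuous_on UNIV (bump p)"
    using bump_has_real_derivative by (intro DERIV_continuous_on) (auto intro: has_field_derivative_at_within)
  then have "continuous_on UNIV (\<lambda>x. bump p (c + a \<bullet> x))"
    by (rule continuous_on_compose2) (auto intro!: continuous_intros)
  then show ?case by (simp add: continuous_on_of_real)
next
  case (Suc k)
  let ?q = "[:0, 0, 1:] * (p - pderiv p)"
  have d: "((\<lambda>x. complex_of_real (bump p (c + a \<bullet> x))) has_derivative
      (\<lambda>h. of_real (a \<bullet> h) * of_real (bump ?q (c + a \<bullet> x)))) (at x)" for x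
  proof -
    have "((\<lambda>x. c + a \<bullet> x) has_derivative (\<lambda>h. a \<bullet> h)) (at x)"
      by (auto intro!: derivative_eq_intros)
    from has_derivative_of_real[OF has_derivative_compose[OF this bump_has_real_derivative[unfolded has_field_derivative_def]]]
    show ?thesis by (simp add: mult.commute)
  qed
  show ?case
    by (rule C_k_SucI[OF d]) (intro C_k_mult C_k_const Suc)
qed

text \<open>For \<open>r > 0\<close> each factor vanishes exactly outside an open half-space, so the
  product is positive precisely on the open box. A large \<open>r\<close> steepens the walls towards
  the indicator.\<close>

definition box_bump :: "real \<Rightarrow> real^'n \<Rightarrow> real^'n \<Rightarrow> real^'n \<Rightarrow> real" where
  "box_bump r a b x = (\<Prod>i\<in>UNIV. bump 1 (r * (x $ i - a $ i)) * bump 1 (r * (b $ i - x $ i)))"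

lemma bump_1_bounds: "0 \<le> bump 1 t" "bump 1 t \<le> 1" "bump 1 t = 0 \<longleftrightarrow> t \<le> 0"
  by (auto simp: bump_def)

lemma box_bump_nonneg: "0 \<le> box_bump r a b x"
  unfolding box_bump_def by (intro prod_nonneg) (auto simp: bump_1_bounds)

lemma box_bump_le_1: "box_bump r a b x \<le> 1"
  unfolding box_bump_def by (intro prod_le_1) (auto simp: bump_1_bounds mult_le_one)

lemma box_bump_eq_0_iff: "r > 0 \<Longrightarrow> box_bump r a b x = 0 \<longleftrightarrow> x \<notin> box a b"
  by (auto simp: box_bump_def bump_1_bounds mem_box_cart mult_le_0_iff not_less)

lemma box_bump_tendsto_indicator:
  "(\<lambda>n. box_bump (real (Suc n)) a b x) \<longlonglongrightarrow> indicator (box a b) x"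
proof (cases "x \<in> box a b")
  case False
  then show ?thesis using box_bump_eq_0_iff[of "real (Suc n)" a b x for n] by simp
next
  case True
  have b: "(\<lambda>n. bump 1 (real (Suc n) * t)) \<longlonglongrightarrow> 1" if "t > 0" for t
  proof -
    have "(\<lambda>n. exp (- (inverse (real (Suc n)) * inverse t))) \<longlonglongrightarrow> exp (- (0 * inverse t))"
      by (intro tendsto_intros LIMSEQ_inverse_real_of_nat)
    moreover have "bump 1 (real (Suc n) * t) = exp (- (inverse (real (Suc n)) * inverse t))" for n
      using that by (simp add: bump_def mult_le_0_iff)
    ultimately show ?thesis by simp
  qed
  have "(\<lambda>n. box_bump (real (Suc n)) a b x) \<longlonglongrightarrow> (\<Prod>i\<in>(UNIV::'a set). 1 * 1)"
    unfolding box_bump_def using True by (intro tendsto_prod tendsto_mult b) (auto simp: mem_box_cart)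
  then show ?thesis using True by simp
qed

lemma C_k_box_bump: "C_k k (\<lambda>x. complex_of_real (box_bump r a b x))"
proof -
  have 1: "r * (x $ i - a $ i) = - r * a $ i + (r *\<^sub>R axis i 1) \<bullet> x"
    "r * (b $ i - x $ i) = r * b $ i + (- r *\<^sub>R axis i 1) \<bullet> x" for x i
    by (simp_all add: inner_axis' algebra_simps)
  show ?thesis
    unfolding box_bump_def of_real_prod of_real_mult 1
    by (intro C_k_prod C_k_mult C_k_bump)
qed

section \<open>Closure properties and integrability of smooth functions of compact support\<close>

lemma Cc_infinityI:
  assumes "\<And>k. C_k k f" "compact K" "\<And>x. x \<notin> K \<Longrightarrow> f x = 0"
  shows "f \<in> Cc_infinity"
proof -
  have "closure {x. f x \<noteq> 0} \<subseteq> K"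
    using assms(2,3) by (intro closure_minimal) (auto intro: compact_imp_closed)
  then have "K \<inter> closure {x. f x \<noteq> 0} = closure {x. f x \<noteq> 0}" by blast
  then have "compact (closure {x. f x \<noteq> 0})"
    using compact_Int_closed[OF assms(2) closed_closure[of "{x. f x \<noteq> 0}"]] by simp
  then show ?thesis using assms(1) by (simp add: Cc_infinity_def)
qed

lemma Cc_infinityD:
  assumes "f \<in> Cc_infinity"
  shows "C_k k f" "compact (closure {x. f x \<noteq> 0})" "x \<notin> closure {x. f x \<noteq> 0} \<Longrightarrow> f x = 0"
  using assms closure_subset[of "{x. f x \<noteq> 0}"] unfolding Cc_infinity_def by blast+

lemma Cc_infinity_box_bump:
  assumes "r > 0"
  shows "(\<lambda>x. complex_of_real (box_bump r a b x)) \<in> Cc_infinity"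
proof (rule Cc_infinityI[OF C_k_box_bump compact_cbox[of a b]])
  show "complex_of_real (box_bump r a b x) = 0" if "x \<notin> cbox a b" for x
    using box_bump_eq_0_iff[OF assms, of a b x] box_subset_cbox[of a b] that by auto
qed

lemma Cc_infinity_add:
  assumes "f \<in> Cc_infinity" "g \<in> Cc_infinity"
  shows "(\<lambda>x. f x + g x) \<in> Cc_infinity"
proof (rule Cc_infinityI[OF _ compact_Un[OF Cc_infinityD(2)[OF assms(1)] Cc_infinityD(2)[OF assms(2)]]])
  show "C_k k (\<lambda>x. f x + g x)" for k
    by (intro C_k_add Cc_infinityD(1) assms)
  show "f x + g x = 0" if "x \<notin> closure {x. f x \<noteq> 0} \<union> closure {x. g x \<noteq> 0}" for x
    using Cc_infinityD(3)[OF assms(1), of x] Cc_infinityD(3)[OF assms(2), of x] that by simp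
qed

lemma Cc_infinity_bounded_linear:
  assumes "bounded_linear L" "f \<in> Cc_infinity"
  shows "(\<lambda>x. L (f x)) \<in> Cc_infinity"
proof (rule Cc_infinityI[OF C_k_bounded_linear[OF assms(1) Cc_infinityD(1)[OF assms(2)]] Cc_infinityD(2)[OF assms(2)]])
  show "L (f x) = 0" if "x \<notin> closure {x. f x \<noteq> 0}" for x
    unfolding Cc_infinityD(3)[OF assms(2) that] by (rule linear_0[OF bounded_linear.linear[OF assms(1)]])
qed

lemma Cc_infinity_zero: "(\<lambda>x. 0) \<in> Cc_infinity"
  by (rule Cc_infinityI[OF C_k_const compact_empty]) simp

lemma Cc_infinity_sum:
  "(\<And>i. i \<in> I \<Longrightarrow> f i \<in> Cc_infinity) \<Longrightarrow> (\<lambda>x. \<Sum>i\<in>I. f i x) \<in> Cc_infinity"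
  by (induction I rule: infinite_finite_induct) (auto intro: Cc_infinity_zero Cc_infinity_add)

text \<open>The entries are reassembled by the linear maps \<open>E i j\<close> that place a scalar
  at one position, so sums and linear images suffice.\<close>

lemma Cc_infinity_matrix:
  fixes f :: "real^'n \<Rightarrow> 'b::euclidean_space^'m^'k"
  assumes "\<And>i j. (\<lambda>x. f x $ i $ j) \<in> Cc_infinity"
  shows "f \<in> Cc_infinity"
proof -
  define E where "E = (\<lambda>i j (z::'b). (\<chi> i' j'. if i = i' \<and> j = j' then z else 0) :: 'b^'m^'k)"
  have "bounded_linear (E i j)" for i j
  proof -
    have "linear (E i j)" by (intro linearI) (auto simp: vec_eq_iff E_def)
    then show ?thesis by (simp add: linear_conv_bounded_linear)
  qed
  note E = Cc_infinity_bounded_linear[OF this assms]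
  have "f x = (\<Sum>i\<in>UNIV. \<Sum>j\<in>UNIV. E i j (f x $ i $ j))" for x
  proof -
    have "(\<Sum>j\<in>UNIV. if i = a \<and> j = b then f x $ i $ j else 0) = (if i = a then f x $ i $ b else 0)" for i a b
      by simp
    then show ?thesis by (simp add: vec_eq_iff E_def)
  qed
  then have "f = (\<lambda>x. \<Sum>i\<in>UNIV. \<Sum>j\<in>UNIV. E i j (f x $ i $ j))" by (rule ext)
  also have "\<dots> \<in> Cc_infinity" by (intro Cc_infinity_sum E)
  finally show ?thesis .
qed

lemma Cc_infinity_mult:
  fixes f g :: "real^'n \<Rightarrow> 'b::real_normed_algebra"
  assumes "f \<in> Cc_infinity" "\<And>k. C_k k g"
  shows "(\<lambda>x. f x * g x) \<in> Cc_infinity"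
proof (rule Cc_infinityI[OF C_k_mult[OF Cc_infinityD(1)[OF assms(1)] assms(2)] Cc_infinityD(2)[OF assms(1)]])
  show "f x * g x = 0" if "x \<notin> closure {x. f x \<noteq> 0}" for x
    unfolding Cc_infinityD(3)[OF assms(1) that] by (rule mult_zero_left)
qed

lemma Cc_infinity_continuous: "f \<in> Cc_infinity \<Longrightarrow> continuous_on UNIV f"
  using Cc_infinityD(1)[of f 0] by simp

lemma Cc_infinity_measurable: "f \<in> Cc_infinity \<Longrightarrow> f \<in> borel_measurable borel"
  by (intro borel_measurable_continuous_onI Cc_infinity_continuous)

lemma Cc_infinity_has_derivative:
  "f \<in> Cc_infinity \<Longrightarrow> (f has_derivative frechet_derivative f (at x)) (at x)"
  using C_k_Suc_has_derivative Cc_infinityD(1) by blast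

lemma Cc_infinity_bounded:
  assumes "f \<in> Cc_infinity"
  obtains M where "\<And>x. norm (f x) \<le> M" "M \<ge> 0"
proof -
  define K where "K = closure {x. f x \<noteq> 0}"
  have "compact (f ` K)"
    unfolding K_def
    using Cc_infinity_continuous[OF assms] Cc_infinityD(2)[OF assms]
    by (intro compact_continuous_image) (auto intro: continuous_on_subset)
  then have "bounded (f ` K)" by (rule compact_imp_bounded)
  then obtain M where M: "\<forall>y\<in>f ` K. norm y \<le> M"
    unfolding bounded_iff by (elim exE)
  have "norm (f x) \<le> max M 0" for x
  proof (cases "x \<in> K")
    case True
    then have "norm (f x) \<le> M" using M by blast
    then show ?thesis by simp
  next
    case False
    then have "f x = 0" unfolding K_def by (rule Cc_infinityD(3)[OF assms])
    then show ?thesis by simp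
  qed
  then show ?thesis using that[of "max M 0"] by simp
qed

lemma Cc_infinity_integrable:
  fixes f :: "real^'n \<Rightarrow> 'b::{banach, second_countable_topology}"
  assumes "f \<in> Cc_infinity"
  shows "integrable lborel f"
proof -
  let ?K = "closure {x. f x \<noteq> 0}"
  have "integrable lborel (\<lambda>x. indicator ?K x *\<^sub>R f x)"
    using Cc_infinity_continuous[OF assms]
    by (intro borel_integrable_compact Cc_infinityD(2)[OF assms]) (auto intro: continuous_on_subset)
  moreover have "indicator ?K x *\<^sub>R f x = f x" for x
    using Cc_infinityD(3)[OF assms, of x] by (cases "x \<in> ?K") auto
  ultimately show ?thesis by simp
qed

lemma Cc_infinity_partial:
  assumes "f \<in> Cc_infinity"
  shows "(\<lambda>x. frechet_derivative f (at x) (axis i 1)) \<in> Cc_infinity"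
proof (rule Cc_infinityI[OF _ Cc_infinityD(2)[OF assms]])
  show "C_k k (\<lambda>x. frechet_derivative f (at x) (axis i 1))" for k
    using Cc_infinityD(1)[OF assms, of "Suc k"] by simp
next
  fix x assume x: "x \<notin> closure {x. f x \<noteq> 0}"
  have "(f has_derivative (\<lambda>_. 0)) (at x)"
  proof (rule has_derivative_transform_within_open[OF has_derivative_const[of 0]])
    show "open (- closure {x. f x \<noteq> 0})" by (intro open_Compl closed_closure)
    show "x \<in> - closure {x. f x \<noteq> 0}" by (rule ComplI) (erule notE[OF x])
    show "0 = f y" if "y \<in> - closure {x. f x \<noteq> 0}" for y
      using that by (intro Cc_infinityD(3)[OF assms, symmetric] ComplD)
  qed
  then show "frechet_derivative f (at x) (axis i 1) = 0"
    using frechet_derivative_at by metis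
qed

section \<open>Decay of Fourier integrals\<close>

text \<open>The sign sits in \<open>- y\<close>, so that all facts about
  \<open>iexp (x \<bullet> y)\<close> apply; normalising constants are postponed to
  \<open>\<kappa>\<close>.\<close>

definition fourier_integral :: "('a::euclidean_space \<Rightarrow> complex) \<Rightarrow> 'a \<Rightarrow> complex" where
  "fourier_integral f y = (CLINT x|lborel. iexp ((- y) \<bullet> x) * f x)"

lemma continuous_fourier_integral':
  assumes "integrable lborel f"
  shows "continuous_on UNIV (fourier_integral f)"
  unfolding fourier_integral_def
  by (rule continuous_on_compose2[OF continuous_fourier_integral[OF assms], of UNIV uminus])
    (auto intro!: continuous_intros)

lemma fourier_integral_norm_le:
  assumes "integrable lborel f"
  shows "cmod (fourier_integral f y) \<le> (LINT x|lborel. cmod (f x))"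
proof -
  have "cmod (fourier_integral f y) \<le> (LINT x|lborel. cmod (iexp ((- y) \<bullet> x) * f x))"
    unfolding fourier_integral_def by (rule integral_norm_bound)
  then show ?thesis by (simp add: norm_mult)
qed

text \<open>Translation invariance turns the difference quotient of the transform's phase into the
  transform of the difference quotient.\<close>

lemma fourier_integral_translate:
  assumes f: "integrable lborel f"
  shows "fourier_integral (\<lambda>x. f (x + v)) y = iexp (y \<bullet> v) * fourier_integral f y"
proof -
  have [measurable]: "f \<in> borel_measurable borel" using f by auto
  have "fourier_integral f y = (CLINT x|lborel. iexp ((- y) \<bullet> (v + x)) * f (v + x))"
    unfolding fourier_integral_def
    using lborel_integral_affine[of 1 "\<lambda>x. iexp ((- y) \<bullet> x) * f x" v] by simp
  also have "\<dots> = (CLINT x|lborel. iexp ((- y) \<bullet> v) * (iexp ((- y) \<bullet> x) * f (x + v)))"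
    by (intro Bochner_Integration.integral_cong refl)
      (simp only: inner_add_right of_real_add distrib_left exp_add mult_ac add.commute)
  also have "\<dots> = iexp ((- y) \<bullet> v) * fourier_integral (\<lambda>x. f (x + v)) y"
    unfolding fourier_integral_def by simp
  finally have e: "fourier_integral f y = iexp ((- y) \<bullet> v) * fourier_integral (\<lambda>x. f (x + v)) y" .
  have "iexp (y \<bullet> v) * iexp ((- y) \<bullet> v) = 1"
    by (simp flip: exp_add)
  then show ?thesis unfolding e by (simp only: mult.assoc[symmetric] mult_1)
qed

lemma iexp_difference_quotient:
  "(\<lambda>n. of_nat (Suc n) * (iexp (t * inverse (real (Suc n))) - 1)) \<longlonglongrightarrow> \<i> * of_real t"
  using exp_difference_quotient_tendsto[of "\<i> * of_real t"] by (simp add: mult_ac del: of_nat_Suc)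

text \<open>By the mean value inequality the quotient is at most a bound \<open>M\<close> of the
  partial derivative, and for steps up to 1 it vanishes outside the closed unit neighbourhood of the
  support. The dominating function is therefore independent of the step.\<close>

lemma Cc_infinity_difference_quotient_bound:
  fixes f :: "real^'n \<Rightarrow> complex"
  assumes f: "f \<in> Cc_infinity"
  obtains w where "integrable lborel w"
    "\<And>h x. 0 < h \<Longrightarrow> h \<le> 1 \<Longrightarrow> cmod (f (x + h *\<^sub>R axis i 1) - f x) \<le> h * w x"
proof -
  let ?e = "axis i 1 :: real^'n"
  define K where "K = closure {x. f x \<noteq> 0}"
  have K: "compact K" unfolding K_def by (rule Cc_infinityD(2)[OF f])
  have f0: "f x = 0" if "x \<notin> K" for x using that unfolding K_def by (rule Cc_infinityD(3)[OF f])
  obtain M where M: "\<And>x. cmod (frechet_derivative f (at x) ?e) \<le> M" "M \<ge> 0"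
    using Cc_infinity_bounded[OF Cc_infinity_partial[OF f, of i]] by blast
  define K' where "K' = {x + y |x y. x \<in> K \<and> y \<in> cball 0 1}"
  have K': "compact K'" unfolding K'_def by (intro compact_sums K compact_cball)
  define w where "w = (\<lambda>x. indicator K' x *\<^sub>R M)"
  have "integrable lborel w"
    unfolding w_def by (intro borel_integrable_compact K' continuous_on_const)
  moreover have "cmod (f (x + h *\<^sub>R ?e) - f x) \<le> h * w x" if h: "0 < h" "h \<le> 1" for h x
  proof (cases "x \<in> K'")
    case True
    have d: "((\<lambda>s. f (x + s *\<^sub>R ?e)) has_derivative (\<lambda>t. t *\<^sub>R frechet_derivative f (at (x + s *\<^sub>R ?e)) ?e)) (at s within UNIV)" for s
    proof -
      have "((\<lambda>s. x + s *\<^sub>R ?e) has_derivative (\<lambda>t. t *\<^sub>R ?e)) (at s)"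
        by (auto intro!: derivative_eq_intros)
      from has_derivative_compose[OF this Cc_infinity_has_derivative[OF f]] show ?thesis
        using linear_scale[OF has_derivative_linear[OF Cc_infinity_has_derivative[OF f]]] by simp
    qed
    have "norm (f (x + h *\<^sub>R ?e) - f (x + 0 *\<^sub>R ?e)) \<le> M * norm (h - 0)"
    proof (rule differentiable_bound[OF convex_UNIV d])
      fix s
      show "onorm (\<lambda>t. t *\<^sub>R frechet_derivative f (at (x + s *\<^sub>R ?e)) ?e) \<le> M"
        using M(1)[of "x + s *\<^sub>R ?e"] by (intro onorm_le) (auto simp: mult.commute[of M] intro!: mult_left_mono)
    qed auto
    then show ?thesis using True h by (simp add: w_def mult.commute)
  next
    case False
    have "x \<notin> K" using False unfolding K'_def by force
    moreover have "x + h *\<^sub>R ?e \<notin> K"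
    proof
      assume a: "x + h *\<^sub>R ?e \<in> K"
      have "x = (x + h *\<^sub>R ?e) + (- h *\<^sub>R ?e)" "- h *\<^sub>R ?e \<in> cball 0 1"
        using h by simp_all
      then have "x \<in> K'" using a unfolding K'_def by blast
      then show False using False by simp
    qed
    ultimately show ?thesis by (simp add: f0 w_def False)
  qed
  ultimately show ?thesis by (rule that)
qed

text \<open>Takes the place of integration by parts: the transforms of the difference quotients
  \<open>q n\<close> are known from translation, and the limit is computed once through the phase
  factors and once by dominated convergence.\<close>

lemma fourier_integral_partial:
  fixes f :: "real^'n \<Rightarrow> complex"
  assumes f: "f \<in> Cc_infinity"
  shows "fourier_integral (\<lambda>x. frechet_derivative f (at x) (axis i 1)) y = \<i> * of_real (y $ i) * fourier_integral f y"
proof -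
  let ?e = "axis i 1 :: real^'n"
  let ?D = "\<lambda>x. frechet_derivative f (at x) ?e"
  define h where "h = (\<lambda>n. inverse (real (Suc n)))"
  have h: "0 < h n" "h n \<le> 1" "inverse (h n) = real (Suc n)" for n by (simp_all add: h_def inverse_le_1_iff)
  have hlim: "h \<longlonglongrightarrow> 0" unfolding h_def by (rule LIMSEQ_inverse_real_of_nat)
  have fi: "integrable lborel f" by (rule Cc_infinity_integrable[OF f])
  have [measurable]: "f \<in> borel_measurable borel" using fi by auto
  have dm[measurable]: "?D \<in> borel_measurable borel"
    by (rule Cc_infinity_measurable[OF Cc_infinity_partial[OF f]])
  obtain w where w: "integrable lborel w"
    "\<And>h x. 0 < h \<Longrightarrow> h \<le> 1 \<Longrightarrow> cmod (f (x + h *\<^sub>R ?e) - f x) \<le> h * w x"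
    using Cc_infinity_difference_quotient_bound[OF f] by blast
  define q where "q = (\<lambda>n x. of_real (inverse (h n)) * (f (x + h n *\<^sub>R ?e) - f x))"
  have shift: "integrable lborel (\<lambda>x. f (x + h n *\<^sub>R ?e))" for n
    using lborel_integrable_affine[OF _ fi, of 1 "h n *\<^sub>R ?e"] by (simp add: add.commute)
  have ft: "fourier_integral (q n) y = of_nat (Suc n) * (iexp (y $ i * inverse (real (Suc n))) - 1) * fourier_integral f y" for n
  proof -
    have i1: "integrable lborel (\<lambda>x. iexp ((- y) \<bullet> x) * f x)"
      "integrable lborel (\<lambda>x. iexp ((- y) \<bullet> x) * f (x + h n *\<^sub>R ?e))"
      by (subst iexp_mult_integrable_iff; simp add: fi shift)+
    have "fourier_integral (q n) y = (CLINT x|lborel. of_real (inverse (h n)) *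
        (iexp ((- y) \<bullet> x) * f (x + h n *\<^sub>R ?e) - iexp ((- y) \<bullet> x) * f x))"
      unfolding fourier_integral_def q_def by (simp only: right_diff_distrib mult_ac)
    also have "\<dots> = of_real (inverse (h n)) * (fourier_integral (\<lambda>x. f (x + h n *\<^sub>R ?e)) y - fourier_integral f y)"
      unfolding fourier_integral_def integral_mult_right_zero Bochner_Integration.integral_diff[OF i1(2) i1(1)] ..
    also have "\<dots> = of_real (inverse (h n)) * (iexp (y \<bullet> (h n *\<^sub>R ?e)) - 1) * fourier_integral f y"
      unfolding fourier_integral_translate[OF fi] by (simp only: left_diff_distrib right_diff_distrib mult_1 mult.assoc)
    also have "y \<bullet> (h n *\<^sub>R ?e) = y $ i * inverse (real (Suc n))"
      by (simp add: inner_axis h_def)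
    finally show ?thesis unfolding h(3) by simp
  qed
  have "(\<lambda>n. fourier_integral (q n) y) \<longlonglongrightarrow> \<i> * of_real (y $ i) * fourier_integral f y"
    unfolding ft by (intro tendsto_mult iexp_difference_quotient tendsto_const)
  moreover have "(\<lambda>n. fourier_integral (q n) y) \<longlonglongrightarrow> fourier_integral ?D y"
    unfolding fourier_integral_def
  proof (rule integral_dominated_convergence[where w=w])
    have "(\<lambda>n. q n x) \<longlonglongrightarrow> ?D x" for x
    proof -
      have "((\<lambda>s. f (x + s *\<^sub>R ?e)) has_vector_derivative ?D x) (at 0)"
      proof -
        have "((\<lambda>s. x + s *\<^sub>R ?e) has_derivative (\<lambda>t. t *\<^sub>R ?e)) (at 0)"
          by (auto intro!: derivative_eq_intros)
        moreover have "(f has_derivative frechet_derivative f (at x)) (at (x + 0 *\<^sub>R ?e))"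
          using Cc_infinity_has_derivative[OF f, of x] by simp
        ultimately have "((\<lambda>s. f (x + s *\<^sub>R ?e)) has_derivative (\<lambda>t. frechet_derivative f (at x) (t *\<^sub>R ?e))) (at 0)"
          by (rule has_derivative_compose)
        then show ?thesis
          unfolding has_vector_derivative_def
          using linear_scale[OF has_derivative_linear[OF Cc_infinity_has_derivative[OF f]]] by simp
      qed
      then have L: "((\<lambda>s. (f (x + s *\<^sub>R ?e) - f x - s *\<^sub>R ?D x) /\<^sub>R \<bar>s\<bar>) \<longlongrightarrow> 0) (at 0)"
        by (simp add: has_vector_derivative_def has_derivative_at_within)
      have "filterlim h (at 0) sequentially"
        unfolding filterlim_at using hlim h(1) by (auto simp: less_imp_neq[symmetric] intro!: always_eventually)
      from filterlim_compose[OF L this]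
      have "(\<lambda>n. (f (x + h n *\<^sub>R ?e) - f x - h n *\<^sub>R ?D x) /\<^sub>R \<bar>h n\<bar>) \<longlonglongrightarrow> 0" .
      moreover have "(f (x + h n *\<^sub>R ?e) - f x - h n *\<^sub>R ?D x) /\<^sub>R \<bar>h n\<bar>
          = q n x - ?D x" for n
        using h(1)[of n] by (simp add: q_def scaleR_conv_of_real right_diff_distrib)
      ultimately show ?thesis by (simp only: LIM_zero_iff)
    qed
    then show "AE x in lborel. (\<lambda>n. iexp ((- y) \<bullet> x) * q n x) \<longlonglongrightarrow> iexp ((- y) \<bullet> x) * ?D x"
      by (intro always_eventually allI tendsto_mult tendsto_const)
    have "cmod (iexp ((- y) \<bullet> x) * q n x) \<le> w x" for n x
    proof -
      have "cmod (q n x) = inverse (h n) * cmod (f (x + h n *\<^sub>R ?e) - f x)"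
        unfolding q_def norm_mult norm_of_real using h(1)[of n] by simp
      also have "\<dots> \<le> inverse (h n) * (h n * w x)"
        using h(1)[of n] by (intro mult_left_mono w(2) h) simp_all
      also have "\<dots> = w x" using h(1)[of n] by simp
      finally show ?thesis by (simp add: norm_mult)
    qed
    then show "AE x in lborel. norm (iexp ((- y) \<bullet> x) * q n x) \<le> w x" for n by simp
    show "(\<lambda>x. iexp ((- y) \<bullet> x) * q n x) \<in> borel_measurable lborel" for n
      unfolding q_def by measurable
  qed (use w in measurable)
  ultimately show ?thesis by (rule LIMSEQ_unique[symmetric])
qed

text \<open>Induction over coordinates: the new factor adds to the transform of \<open>f\<close>
  that of its second partial derivative in modulus, and the induction hypothesis covers both. The
  weight is a product because its inverse is then integrable coordinate by coordinate.\<close>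

lemma Cc_infinity_fourier_decay:
  fixes f :: "real^'n \<Rightarrow> complex"
  assumes "f \<in> Cc_infinity" "finite I"
  shows "\<exists>C. \<forall>y. (\<Prod>i\<in>I. 1 + (y $ i)\<^sup>2) * cmod (fourier_integral f y) \<le> C"
  using assms(2,1)
proof (induction I arbitrary: f rule: finite_induct)
  case empty
  then show ?case
    using fourier_integral_norm_le[OF Cc_infinity_integrable[OF empty.prems]] by auto
next
  case (insert j I)
  define D where "D = (\<lambda>(f::real^'n \<Rightarrow> complex) x. frechet_derivative f (at x) (axis j 1))"
  have D: "D f \<in> Cc_infinity" "fourier_integral (D f) y = \<i> * of_real (y $ j) * fourier_integral f y"
    if "f \<in> Cc_infinity" for f y
    unfolding D_def using that by (rule Cc_infinity_partial fourier_integral_partial)+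
  obtain C1 where C1: "\<And>y. (\<Prod>i\<in>I. 1 + (y $ i)\<^sup>2) * cmod (fourier_integral f y) \<le> C1"
    using insert.IH[OF insert.prems] by blast
  obtain C2 where C2: "\<And>y. (\<Prod>i\<in>I. 1 + (y $ i)\<^sup>2) * cmod (fourier_integral (D (D f)) y) \<le> C2"
    using insert.IH[OF D(1)[OF D(1)[OF insert.prems]]] by blast
  have "(\<Prod>i\<in>insert j I. 1 + (y $ i)\<^sup>2) * cmod (fourier_integral f y) \<le> C1 + C2" for y
  proof -
    have "cmod (fourier_integral (D (D f)) y) = (y $ j)\<^sup>2 * cmod (fourier_integral f y)"
      unfolding D(2)[OF D(1)[OF insert.prems]] D(2)[OF insert.prems]
      by (simp add: norm_mult power2_eq_square)
    then have "(\<Prod>i\<in>insert j I. 1 + (y $ i)\<^sup>2) * cmod (fourier_integral f y) =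
      (\<Prod>i\<in>I. 1 + (y $ i)\<^sup>2) * cmod (fourier_integral f y) +
      (\<Prod>i\<in>I. 1 + (y $ i)\<^sup>2) * cmod (fourier_integral (D (D f)) y)"
      using insert.hyps by (simp add: algebra_simps)
    then show ?thesis using add_mono[OF C1 C2] by simp
  qed
  then show ?case by blast
qed

lemma integrable_prod_inverse_square:
  "integrable lborel (\<lambda>y::real^'n. inverse (\<Prod>i\<in>UNIV. 1 + (y $ i)\<^sup>2))"
proof -
  have "integrable lborel (\<lambda>t::real. inverse (1 + t\<^sup>2))"
    using integrable_inverse_1_plus_square by (simp add: set_integrable_def)
  then have "integrable lborel (\<lambda>t::real. complex_of_real (inverse (1 + t\<^sup>2)))"
    by (rule integrable_of_real)
  then have "integrable lborel (\<lambda>y::real^'n. \<Prod>b\<in>Basis. complex_of_real (inverse (1 + (y \<bullet> b)\<^sup>2)))"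
    by (rule lborel_integrable_prod)
  moreover have "(\<Prod>b\<in>Basis. complex_of_real (inverse (1 + (y \<bullet> b)\<^sup>2))) =
      complex_of_real (inverse (\<Prod>i\<in>UNIV. 1 + (y $ i)\<^sup>2))" for y :: "real^'n"
  proof -
    have B: "Basis = range (\<lambda>i. axis i 1 :: real^'n)" by (auto simp: Basis_vec_def)
    have i: "inj (\<lambda>i. axis i 1 :: real^'n)" by (auto simp: inj_on_def axis_eq_axis)
    have "(\<Prod>b\<in>Basis. complex_of_real (inverse (1 + (y \<bullet> b)\<^sup>2))) =
       (\<Prod>i\<in>UNIV. complex_of_real (inverse (1 + (y \<bullet> axis i 1)\<^sup>2)))"
      unfolding B prod.reindex[OF i] o_def ..
    then show ?thesis
      using prod_inversef[of "\<lambda>i. 1 + (complex_of_real (y $ i))\<^sup>2" UNIV]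
      by (simp add: inner_axis o_def)
  qed
  ultimately show ?thesis by (simp only: complex_of_real_integrable_eq)
qed

lemma Cc_infinity_fourier_integrable:
  fixes f :: "real^'n \<Rightarrow> complex"
  assumes "f \<in> Cc_infinity"
  shows "integrable lborel (fourier_integral f)"
proof -
  obtain C where C: "\<And>y. (\<Prod>i\<in>UNIV. 1 + (y $ i)\<^sup>2) * cmod (fourier_integral f y) \<le> C"
    using Cc_infinity_fourier_decay[OF assms finite] by blast
  have "integrable lborel (\<lambda>y::real^'n. C * inverse (\<Prod>i\<in>UNIV. 1 + (y $ i)\<^sup>2))"
    by (intro integrable_mult_right integrable_prod_inverse_square)
  then show ?thesis
  proof (rule Bochner_Integration.integrable_bound)
    show "fourier_integral f \<in> borel_measurable lborel"
      using continuous_fourier_integral'[OF Cc_infinity_integrable[OF assms]]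
      by (simp add: borel_measurable_continuous_onI)
    have "cmod (fourier_integral f y) \<le> \<bar>C * inverse (\<Prod>i\<in>UNIV. 1 + (y $ i)\<^sup>2)\<bar>" for y
    proof -
      have p: "(\<Prod>i\<in>UNIV. 1 + (y $ i)\<^sup>2) > 0" by (intro prod_pos) (simp add: add_pos_nonneg)
      then have "cmod (fourier_integral f y) \<le> C * inverse (\<Prod>i\<in>UNIV. 1 + (y $ i)\<^sup>2)"
        using C[of y] by (simp add: field_simps)
      then show ?thesis by linarith
    qed
    then show "AE y in lborel. norm (fourier_integral f y) \<le> norm (C * inverse (\<Prod>i\<in>UNIV. 1 + (y $ i)\<^sup>2))"
      by simp
  qed
qed

section \<open>Multipliers with positive definite symbol\<close>

text \<open>The scalar building block: entries of \<open>fourier_multiplier\<close> are sums of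
  these times \<open>\<kappa>\<close>.\<close>

definition multiplier_integral :: "('a::euclidean_space \<Rightarrow> complex) \<Rightarrow> ('a \<Rightarrow> complex) \<Rightarrow> 'a \<Rightarrow> complex" where
  "multiplier_integral g h x = (CLINT y|lborel. iexp (x \<bullet> y) * (fourier_integral h y * g y))"

lemma integrable_mult_bounded:
  fixes f g :: "'a::euclidean_space \<Rightarrow> complex"
  assumes f: "integrable lborel f" and [measurable]: "g \<in> borel_measurable borel" and B: "\<And>x. cmod (g x) \<le> B"
  shows "integrable lborel (\<lambda>x. f x * g x)"
proof (rule Bochner_Integration.integrable_bound[of _ "\<lambda>x. cmod (f x) * B"])
  have "B \<ge> 0" using norm_ge_zero[of "g 0"] B[of 0] by linarith
  then show "AE x in lborel. norm (f x * g x) \<le> norm (cmod (f x) * B)"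
    using B by (auto simp: norm_mult mult_left_mono)
qed (use f in auto)

lemma continuous_multiplier_integral:
  assumes "integrable lborel (fourier_integral h)" "g \<in> borel_measurable borel" "\<And>x. cmod (g x) \<le> B"
  shows "continuous_on UNIV (multiplier_integral g h)"
  unfolding multiplier_integral_def
  by (intro continuous_fourier_integral integrable_mult_bounded[OF assms])

text \<open>Translation invariance in the inner integral; this is the core of Young's inequality for
  \<open>L^1\<close>.\<close>

lemma shifted_kernel_integrable:
  fixes h k :: "'a::euclidean_space \<Rightarrow> complex"
  assumes h: "integrable lborel h" and k: "integrable lborel k"
  shows "integrable (lborel \<Otimes>\<^sub>M lborel) (\<lambda>(z, x). h z * k (x - z))"
    and "(LINT z|lborel. LINT x|lborel. cmod (h z * k (x - z))) = (LINT z|lborel. cmod (h z)) * (LINT x|lborel. cmod (k x))"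
proof -
  have [measurable]: "h \<in> borel_measurable borel" "k \<in> borel_measurable borel" using h k by auto
  have s: "integrable lborel (\<lambda>x. k (x - z))" for z
    using lborel_integrable_affine[OF _ k, of 1 "- z"] by simp
  have "(LINT x|lborel. cmod (k (x - z))) = (LINT x|lborel. cmod (k x))" for z
    using lborel_integral_affine[of 1 "\<lambda>x. cmod (k x)" "- z"] by simp
  then have i: "(LINT x|lborel. cmod (h z * k (x - z))) = cmod (h z) * (LINT x|lborel. cmod (k x))" for z
    by (simp add: norm_mult)
  show "integrable (lborel \<Otimes>\<^sub>M lborel) (\<lambda>(z, x). h z * k (x - z))"
  proof (rule lborel_pair.Fubini_integrable)
    show "integrable lborel (\<lambda>z. LINT x|lborel. norm (case (z, x) of (z, x) \<Rightarrow> h z * k (x - z)))"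
      using h by (simp add: i)
    show "AE z in lborel. integrable lborel (\<lambda>x. case (z, x) of (z, x) \<Rightarrow> h z * k (x - z))"
      using s by simp
  qed measurable
  show "(LINT z|lborel. LINT x|lborel. cmod (h z * k (x - z))) = (LINT z|lborel. cmod (h z)) * (LINT x|lborel. cmod (k x))"
    unfolding i by simp
qed

text \<open>The damped symbol is integrable, so the integrals may be exchanged and the one over
  \<open>y\<close> collapses to the kernel. The formula holds at every \<open>x\<close>, not just
  almost everywhere.\<close>

lemma multiplier_integral_gauss:
  fixes h g :: "'a::euclidean_space \<Rightarrow> complex"
  assumes h: "integrable lborel h" and g: "g \<in> borel_measurable borel" "\<And>x. cmod (g x) \<le> B" and e: "e > 0"
  shows "multiplier_integral (\<lambda>y. g y * of_real (gauss e y)) h x = (CLINT z|lborel. h z * gauss_kernel g e (x - z))"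
proof -
  have [measurable]: "g \<in> borel_measurable borel" "h \<in> borel_measurable borel" using g h by auto
  let ?G = "\<lambda>y. g y * of_real (gauss e y)"
  have G: "integrable lborel ?G" by (rule gauss_mult_integrable[OF g e])
  define k where "k = (\<lambda>z y. h z * (iexp ((x - z) \<bullet> y) * ?G y))"
  have km[measurable]: "(\<lambda>(z, y). k z y) \<in> borel_measurable (borel \<Otimes>\<^sub>M borel)"
    unfolding k_def by measurable
  have ki: "integrable (lborel \<Otimes>\<^sub>M lborel) (\<lambda>(z, y). k z y)"
  proof (rule lborel_pair.Fubini_integrable)
    have "(LINT y|lborel. norm (k z y)) = norm (h z) * (LINT y|lborel. norm (?G y))" for z
      unfolding k_def by (simp add: norm_mult)
    then show "integrable lborel (\<lambda>z. LINT y|lborel. norm (case (z, y) of (z, y) \<Rightarrow> k z y))"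
      using h by simp
    have "integrable lborel (\<lambda>y. iexp ((x - z) \<bullet> y) * ?G y)" for z
      using G by (subst iexp_mult_integrable_iff) auto
    then show "AE z in lborel. integrable lborel (\<lambda>y. case (z, y) of (z, y) \<Rightarrow> k z y)"
      unfolding k_def prod.case by (intro always_eventually allI integrable_mult_right)
  qed simp
  have "(CLINT z|lborel. k z y) = iexp (x \<bullet> y) * (fourier_integral h y * ?G y)" for y
  proof -
    have "(CLINT z|lborel. k z y) = (CLINT z|lborel. iexp (x \<bullet> y) * ?G y * (iexp ((- y) \<bullet> z) * h z))"
    proof (rule Bochner_Integration.integral_cong[OF refl])
      fix z
      have "iexp ((x - z) \<bullet> y) = iexp (x \<bullet> y) * iexp ((- y) \<bullet> z)"
        by (simp add: inner_diff_left inner_diff_right inner_commute right_diff_distrib flip: exp_add)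
      then show "k z y = iexp (x \<bullet> y) * ?G y * (iexp ((- y) \<bullet> z) * h z)"
        unfolding k_def by (simp only: mult_ac)
    qed
    then show ?thesis
      unfolding fourier_integral_def integral_mult_right_zero by (simp only: mult_ac)
  qed
  then have "multiplier_integral ?G h x = (CLINT y|lborel. CLINT z|lborel. k z y)"
    unfolding multiplier_integral_def by simp
  also have "\<dots> = (CLINT z|lborel. CLINT y|lborel. k z y)"
    by (rule lborel_pair.Fubini_integral[OF ki])
  also have "\<dots> = (CLINT z|lborel. h z * gauss_kernel g e (x - z))"
    unfolding k_def gauss_kernel_def integral_mult_right_zero by (simp only: mult.assoc)
  finally show ?thesis .
qed

lemma multiplier_integral_limit:
  fixes h g :: "'a::euclidean_space \<Rightarrow> complex"
  assumes h: "integrable lborel (fourier_integral h)" and g: "g \<in> borel_measurable borel" "\<And>x. cmod (g x) \<le> B"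
  shows "(\<lambda>n. multiplier_integral (\<lambda>y. g y * of_real (gauss (inverse (real (Suc n))) y)) h x) \<longlonglongrightarrow>
    multiplier_integral g h x"
proof -
  let ?s = "\<lambda>n y. complex_of_real (gauss (inverse (real (Suc n))) y)"
  show ?thesis
    unfolding multiplier_integral_def
  proof (rule integral_dominated_convergence[where w="\<lambda>y. cmod (fourier_integral h y * g y)"])
    have [measurable]: "g \<in> borel_measurable borel" "fourier_integral h \<in> borel_measurable borel" using g h by auto
    have i: "integrable lborel (\<lambda>y. fourier_integral h y * g y)"
      by (rule integrable_mult_bounded[OF h g])
    then show "integrable lborel (\<lambda>y. cmod (fourier_integral h y * g y))" by (rule integrable_norm)
    show "(\<lambda>y. iexp (x \<bullet> y) * (fourier_integral h y * g y)) \<in> borel_measurable lborel"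
      "(\<lambda>y. iexp (x \<bullet> y) * (fourier_integral h y * (g y * ?s n y))) \<in> borel_measurable lborel" for n
      by measurable
    have "(\<lambda>n. iexp (x \<bullet> y) * (fourier_integral h y * (g y * ?s n y))) \<longlonglongrightarrow>
        iexp (x \<bullet> y) * (fourier_integral h y * (g y * of_real 1))" for y
      by (intro tendsto_mult tendsto_const tendsto_of_real gauss_inverse_Suc_tendsto)
    then show "AE y in lborel. (\<lambda>n. iexp (x \<bullet> y) * (fourier_integral h y * (g y * ?s n y))) \<longlonglongrightarrow>
        iexp (x \<bullet> y) * (fourier_integral h y * g y)" by simp
    have "cmod (iexp (x \<bullet> y) * (fourier_integral h y * (g y * ?s n y))) \<le>
        cmod (fourier_integral h y * g y)" for y n
      using mult_left_mono[OF gauss_le_1[of "inverse (real (Suc n))" y], of "cmod (fourier_integral h y * g y)"]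
      by (simp add: norm_mult mult.assoc)
    then show "AE y in lborel. norm (iexp (x \<bullet> y) * (fourier_integral h y * (g y * ?s n y))) \<le>
        cmod (fourier_integral h y * g y)" for n by simp
  qed
qed

lemma multiplier_integral_mass:
  fixes h g :: "'a::euclidean_space \<Rightarrow> complex"
  assumes h: "integrable lborel h" "integrable lborel (fourier_integral h)"
    and g: "g \<in> borel_measurable borel" "\<And>x. cmod (g x) \<le> B"
    and k: "\<And>e. e > 0 \<Longrightarrow> integrable lborel (gauss_kernel g e)"
      "\<And>e. e > 0 \<Longrightarrow> (LINT x|lborel. cmod (gauss_kernel g e x)) \<le> C"
  shows "integrable lborel (multiplier_integral g h)"
    and "(LINT x|lborel. cmod (multiplier_integral g h x)) \<le> C * (LINT x|lborel. cmod (h x))"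
proof -
  have mm: "multiplier_integral g h \<in> borel_measurable borel"
    by (intro borel_measurable_continuous_onI continuous_multiplier_integral[OF h(2) g])
  define e where "e = (\<lambda>n. inverse (real (Suc n)))"
  have e: "e n > 0" for n by (simp add: e_def)
  define a where "a = (\<lambda>n x. CLINT z|lborel. h z * gauss_kernel g (e n) (x - z))"
  define D where "D = C * (LINT x|lborel. cmod (h x))"
  have "0 \<le> (LINT x|lborel. cmod (gauss_kernel g 1 x))" by simp
  then have C: "C \<ge> 0" using k(2)[of 1] by linarith
  have lim: "(\<lambda>n. a n x) \<longlonglongrightarrow> multiplier_integral g h x" for x
    using multiplier_integral_limit[OF h(2) g, of x] multiplier_integral_gauss[OF h(1) g e]
    unfolding a_def e_def by simp
  have a: "integrable lborel (a n)" "(LINT x|lborel. cmod (a n x)) \<le> D" for n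
  proof -
    note K = shifted_kernel_integrable[OF h(1) k(1)[OF e[of n]]]
    show i: "integrable lborel (a n)"
      unfolding a_def using lborel_pair.integrable_snd[OF K(1)] .
    have n: "integrable (lborel \<Otimes>\<^sub>M lborel) (\<lambda>(z, x). cmod (h z * gauss_kernel g (e n) (x - z)))"
      using integrable_norm[OF K(1)] by (simp add: split_beta')
    have "(LINT x|lborel. cmod (a n x)) \<le> (LINT x|lborel. LINT z|lborel. cmod (h z * gauss_kernel g (e n) (x - z)))"
      using i lborel_pair.integrable_snd[OF n] unfolding a_def
      by (intro integral_mono integrable_norm integral_norm_bound)
    also have "\<dots> = (LINT z|lborel. LINT x|lborel. cmod (h z * gauss_kernel g (e n) (x - z)))"
      by (rule lborel_pair.Fubini_integral[OF n])
    also have "\<dots> \<le> D"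
      unfolding K(2) D_def mult.commute[of C] by (intro mult_left_mono k(2) e) simp
    finally show "(LINT x|lborel. cmod (a n x)) \<le> D" .
  qed
  from L1_Fatou[OF _ lim a] mm
  show "integrable lborel (multiplier_integral g h)"
    and "(LINT x|lborel. cmod (multiplier_integral g h x)) \<le> C * (LINT x|lborel. cmod (h x))"
    unfolding D_def by simp_all
qed

lemma integral_nonneg_Reals:
  assumes "\<And>x. f x \<in> \<real>\<^sub>\<ge>\<^sub>0"
  shows "integral\<^sup>L M f \<in> (\<real>\<^sub>\<ge>\<^sub>0 :: complex set)"
proof -
  have f: "f x = complex_of_real (Re (f x))" "Re (f x) \<ge> 0" for x
    using assms[of x] by (auto simp: complex_nonneg_Reals_iff complex_eq_iff)
  have "integral\<^sup>L M f = (CLINT x|M. complex_of_real (Re (f x)))"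
    by (rule Bochner_Integration.integral_cong[OF refl f(1)])
  also have "\<dots> = complex_of_real (LINT x|M. Re (f x))"
    by (rule integral_complex_of_real)
  finally have "integral\<^sup>L M f = complex_of_real (LINT x|M. Re (f x))" .
  moreover have "(LINT x|M. Re (f x)) \<ge> 0" by (intro Bochner_Integration.integral_nonneg f(2))
  ultimately show ?thesis by simp
qed

text \<open>Contraction with a fixed \<open>c\<close> reduces matrix symbols to scalar ones: the
  product vectors \<open>u (x p) * c j\<close> are admissible in the form of the block
  matrix.\<close>

lemma psd_fun_quadratic_form_kernel:
  fixes G :: "real^'n \<Rightarrow> complex^'m^'m"
  assumes "psd_fun G"
  shows "psd_kernel (\<lambda>y. \<Sum>j\<in>UNIV. \<Sum>k\<in>UNIV. cnj (c j) * G y $ j $ k * c k)"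
  unfolding psd_kernel_def psd_on_def
proof (intro allI impI)
  fix A :: "(real^'n) set" and u assume "finite A"
  then obtain x where x: "bij_betw x {..<card A} A"
    using ex_bij_betw_nat_finite[of A] by (auto simp: atLeast0LessThan)
  let ?I = "{..<card A} \<times> (UNIV :: 'm set)"
  let ?d = "\<lambda>(p, j). u (x p) * c j"
  have "(\<Sum>s\<in>A. \<Sum>t\<in>A. cnj (u s) * (\<Sum>j\<in>UNIV. \<Sum>k\<in>UNIV. cnj (c j) * G (s - t) $ j $ k * c k) * u t) =
     (\<Sum>p<card A. \<Sum>q<card A. cnj (u (x p)) * (\<Sum>j\<in>UNIV. \<Sum>k\<in>UNIV. cnj (c j) * G (x p - x q) $ j $ k * c k) * u (x q))"
    unfolding sum.reindex_bij_betw[OF x, symmetric] ..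
  also have "\<dots> = (\<Sum>p<card A. \<Sum>j\<in>UNIV. \<Sum>q<card A. \<Sum>k\<in>UNIV. cnj (?d (p, j)) * block_matrix G x (p, j) (q, k) * ?d (q, k))"
    by (intro sum.cong refl, subst sum.swap, intro sum.cong refl)
      (simp add: block_matrix_def sum_distrib_left sum_distrib_right mult_ac)
  also have "\<dots> = (\<Sum>a\<in>?I. \<Sum>b\<in>?I. cnj (?d a) * block_matrix G x a b * ?d b)"
    unfolding sum.cartesian_product' ..
  also have "\<dots> \<in> \<real>\<^sub>\<ge>\<^sub>0"
    using assms psd_onD unfolding psd_fun_def by blast
  finally show "(\<Sum>s\<in>A. \<Sum>t\<in>A. cnj (u s) * (\<Sum>j\<in>UNIV. \<Sum>k\<in>UNIV. cnj (c j) * G (s - t) $ j $ k * c k) * u t) \<in> \<real>\<^sub>\<ge>\<^sub>0" .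
qed

section \<open>Positivity and mass of matrix kernels\<close>

locale bounded_symbol =
  fixes G :: "real^'n \<Rightarrow> complex^'m^'m" and B :: real
  assumes cont: "continuous_on UNIV G" and bound: "\<And>x j k. cmod (G x $ j $ k) \<le> B"
begin

lemma cont_entry: "continuous_on UNIV (\<lambda>y. G y $ j $ k)"
  by (intro continuous_intros cont)

lemma measurable_entry: "(\<lambda>y. G y $ j $ k) \<in> borel_measurable borel"
  by (intro borel_measurable_continuous_onI cont_entry)

end

locale psd_symbol = bounded_symbol G B
  for G :: "real^'n \<Rightarrow> complex^'m^'m" and B :: real +
  assumes psd: "psd_fun G"
begin

text \<open>\<open>gauss_kernel\<close> is linear in the symbol, so the form of the kernel matrix at
  \<open>c\<close> is the kernel of the scalar positive definite function obtained by contracting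
  \<open>G\<close> with \<open>c\<close>.\<close>

lemma gauss_kernel_psd:
  assumes e: "e > 0"
  shows "psd_on UNIV (\<lambda>j k. gauss_kernel (\<lambda>y. G y $ j $ k) e x)"
  unfolding psd_on_def
proof
  fix c
  let ?g = "\<lambda>y. \<Sum>j\<in>UNIV. \<Sum>k\<in>UNIV. cnj (c j) * G y $ j $ k * c k"
  have "cmod (?g y) \<le> (\<Sum>j\<in>UNIV. \<Sum>k\<in>UNIV. cmod (c j) * B * cmod (c k))" for y
    by (intro order_trans[OF norm_sum] sum_mono) (auto simp: norm_mult intro!: mult_left_mono mult_right_mono bound)
  then have "gauss_kernel ?g e x \<in> \<real>\<^sub>\<ge>\<^sub>0"
    by (intro gauss_kernel_nonneg[OF _ _ psd_fun_quadratic_form_kernel[OF psd] e] continuous_intros cont)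
  also have "gauss_kernel ?g e x = (CLINT y|lborel. \<Sum>j\<in>UNIV. \<Sum>k\<in>UNIV.
      cnj (c j) * (iexp (x \<bullet> y) * G y $ j $ k * of_real (gauss e y)) * c k)"
    unfolding gauss_kernel_def by (simp add: sum_distrib_left sum_distrib_right mult_ac)
  also have "\<dots> = (\<Sum>j\<in>UNIV. \<Sum>k\<in>UNIV. cnj (c j) * gauss_kernel (\<lambda>y. G y $ j $ k) e x * c k)"
    unfolding gauss_kernel_def using gauss_kernel_integrable[OF measurable_entry bound e, of x] by simp
  finally show "(\<Sum>j\<in>UNIV. \<Sum>k\<in>UNIV. cnj (c j) * gauss_kernel (\<lambda>y. G y $ j $ k) e x * c k) \<in> \<real>\<^sub>\<ge>\<^sub>0" .
qed

lemma gauss_kernel_mass_diag: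
  assumes e: "e > 0"
  shows "integrable lborel (gauss_kernel (\<lambda>y. G y $ j $ j) e)"
    and "(LINT x|lborel. cmod (gauss_kernel (\<lambda>y. G y $ j $ j) e x)) \<le> (2 * pi) ^ CARD('n) * B"
proof -
  define c where "c = (\<lambda>i. if i = j then 1 else 0 :: complex)"
  have "(\<Sum>i\<in>UNIV. \<Sum>k\<in>UNIV. cnj (c i) * G y $ i $ k * c k) = G y $ j $ j" for y
    by (simp add: c_def if_distrib[of cnj] if_distrib[of "\<lambda>x. x * _"] if_distrib[of "\<lambda>x. _ * x"] cong: if_cong)
  then have P: "psd_kernel (\<lambda>y. G y $ j $ j)"
    using psd_fun_quadratic_form_kernel[OF psd, of c] by simp
  show "integrable lborel (gauss_kernel (\<lambda>y. G y $ j $ j) e)"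
    and "(LINT x|lborel. cmod (gauss_kernel (\<lambda>y. G y $ j $ j) e x)) \<le> (2 * pi) ^ CARD('n) * B"
    using gauss_kernel_mass[OF cont_entry bound P e] by simp_all
qed

text \<open>An off-diagonal entry is in general no positive definite function; positivity of the
  kernel matrix bounds its kernel pointwise by the average of two diagonal kernels, which preserves
  the constant.\<close>

lemma gauss_kernel_mass_entry:
  assumes e: "e > 0"
  shows "integrable lborel (gauss_kernel (\<lambda>y. G y $ j $ k) e)"
    and "(LINT x|lborel. cmod (gauss_kernel (\<lambda>y. G y $ j $ k) e x)) \<le> (2 * pi) ^ CARD('n) * B"
proof -
  let ?k = "\<lambda>i. gauss_kernel (\<lambda>y. G y $ i $ i) e"
  have le: "cmod (gauss_kernel (\<lambda>y. G y $ j $ k) e x) \<le> (cmod (?k j x) + cmod (?k k x)) / 2" for x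
    using psd_on_offdiag_le[OF finite gauss_kernel_psd[OF e], of j k x] complex_Re_le_cmod[of "?k j x"] complex_Re_le_cmod[of "?k k x"]
    by simp
  have i: "integrable lborel (\<lambda>x. (cmod (?k j x) + cmod (?k k x)) / 2)"
    using gauss_kernel_mass_diag(1)[OF e] by simp
  show ki: "integrable lborel (gauss_kernel (\<lambda>y. G y $ j $ k) e)"
  proof (rule Bochner_Integration.integrable_bound[OF i])
    show "gauss_kernel (\<lambda>y. G y $ j $ k) e \<in> borel_measurable lborel"
      using continuous_gauss_kernel[OF measurable_entry bound e] by (simp add: borel_measurable_continuous_onI)
    show "AE x in lborel. norm (gauss_kernel (\<lambda>y. G y $ j $ k) e x) \<le> norm ((cmod (?k j x) + cmod (?k k x)) / 2)"
      unfolding real_norm_def by (intro always_eventually allI order_trans[OF le abs_ge_self])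
  qed
  have "(LINT x|lborel. cmod (gauss_kernel (\<lambda>y. G y $ j $ k) e x)) \<le> (LINT x|lborel. (cmod (?k j x) + cmod (?k k x)) / 2)"
    by (intro integral_mono integrable_norm ki i le)
  also have "\<dots> = ((LINT x|lborel. cmod (?k j x)) + (LINT x|lborel. cmod (?k k x))) / 2"
    using gauss_kernel_mass_diag(1)[OF e] by simp
  also have "\<dots> \<le> (2 * pi) ^ CARD('n) * B"
    using gauss_kernel_mass_diag(2)[OF e, of j] gauss_kernel_mass_diag(2)[OF e, of k] by simp
  finally show "(LINT x|lborel. cmod (gauss_kernel (\<lambda>y. G y $ j $ k) e x)) \<le> (2 * pi) ^ CARD('n) * B" .
qed

end

section \<open>Density of smooth functions in \<open>L\<^sup>1\<close>\<close>

lemma L1_triangle: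
  fixes f g h :: "'a \<Rightarrow> 'b::{banach, second_countable_topology}"
  assumes "integrable M f" "integrable M g" "integrable M h"
  shows "(LINT x|M. norm (f x - h x)) \<le> (LINT x|M. norm (f x - g x)) + (LINT x|M. norm (g x - h x))"
proof -
  have "(LINT x|M. norm (f x - h x)) \<le> (LINT x|M. norm (f x - g x) + norm (g x - h x))"
    using assms by (intro integral_mono) (auto intro: norm_diff_triangle_le)
  then show ?thesis using assms by simp
qed

lemma L1_dominated_convergence:
  fixes f :: "'a \<Rightarrow> 'b::{banach, second_countable_topology}"
  assumes s: "\<And>n. integrable M (s n)" and f: "integrable M f" and w: "integrable M w"
    and lim: "AE x in M. (\<lambda>n. s n x) \<longlonglongrightarrow> f x" and bd: "\<And>n. AE x in M. norm (s n x) \<le> w x"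
  shows "(\<lambda>n. LINT x|M. norm (f x - s n x)) \<longlonglongrightarrow> 0"
proof -
  have "(\<lambda>n. LINT x|M. norm (f x - s n x)) \<longlonglongrightarrow> (LINT x|M. 0 :: real)"
  proof (rule integral_dominated_convergence[where w="\<lambda>x. norm (f x) + w x"])
    show "AE x in M. (\<lambda>n. norm (f x - s n x)) \<longlonglongrightarrow> 0"
      using lim
    proof eventually_elim
      case (elim x)
      then show ?case using tendsto_norm[OF tendsto_diff[OF tendsto_const elim, of "f x"]] by simp
    qed
    show "AE x in M. norm (norm (f x - s n x)) \<le> norm (f x) + w x" for n
      using bd[of n]
    proof eventually_elim
      case (elim x)
      then show ?case using norm_triangle_ineq4[of "f x" "s n x"] by simp
    qed
  qed (use s f w borel_measurable_integrable in auto)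
  then show ?thesis by simp
qed

text \<open>Density expressed as a property of a single function, so that inductions over sets and
  integrable functions can carry it.\<close>

definition approximable :: "(real^'n \<Rightarrow> 'b::{banach, second_countable_topology}) \<Rightarrow> bool" where
  "approximable f \<longleftrightarrow> (\<forall>e>0. \<exists>g\<in>Cc_infinity. (LINT x|lebesgue. norm (f x - g x)) < e)"

lemma Cc_infinity_integrable_lebesgue:
  fixes f :: "real^'n \<Rightarrow> 'b::{banach, second_countable_topology}"
  shows "f \<in> Cc_infinity \<Longrightarrow> integrable lebesgue f"
  using Cc_infinity_integrable[of f] Cc_infinity_measurable[of f] by (simp add: integrable_completion)

lemma approximable_Cc_infinity: "f \<in> Cc_infinity \<Longrightarrow> approximable f"
  unfolding approximable_def by (auto intro!: bexI[of _ f])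

lemma approximable_tendsto:
  fixes f :: "real^'n \<Rightarrow> 'b::{banach, second_countable_topology}"
  assumes s: "\<And>n. integrable lebesgue (s n)" "\<And>n. approximable (s n)" and f: "integrable lebesgue f"
    and lim: "(\<lambda>n. LINT x|lebesgue. norm (f x - s n x)) \<longlonglongrightarrow> 0"
  shows "approximable f"
  unfolding approximable_def
proof (intro allI impI)
  fix e :: real assume e: "e > 0"
  have "\<forall>\<^sub>F n in sequentially. (LINT x|lebesgue. norm (f x - s n x)) < e / 2"
    using order_tendstoD(2)[OF lim, of "e / 2"] e by simp
  then obtain n where n: "(LINT x|lebesgue. norm (f x - s n x)) < e / 2"
    by (auto simp: eventually_sequentially)
  obtain g where g: "g \<in> Cc_infinity" "(LINT x|lebesgue. norm (s n x - g x)) < e / 2"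
    using s(2)[of n] e unfolding approximable_def by (meson half_gt_zero)
  have "(LINT x|lebesgue. norm (f x - g x)) < e"
    using L1_triangle[OF f s(1) Cc_infinity_integrable_lebesgue[OF g(1)], of n] n g(2) by simp
  then show "\<exists>g\<in>Cc_infinity. (LINT x|lebesgue. norm (f x - g x)) < e"
    using g(1) by blast
qed

lemma approximable_dominated:
  fixes f :: "real^'n \<Rightarrow> 'b::{banach, second_countable_topology}"
  assumes s: "\<And>n. integrable lebesgue (s n)" "\<And>n. approximable (s n)"
    and f: "integrable lebesgue f" and w: "integrable lebesgue w"
    and lim: "\<And>x. (\<lambda>n. s n x) \<longlonglongrightarrow> f x" and bd: "\<And>n x. norm (s n x) \<le> w x"
  shows "approximable f"
proof (rule approximable_tendsto[OF s f])
  show "(\<lambda>n. LINT x|lebesgue. norm (f x - s n x)) \<longlonglongrightarrow> 0"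
    using lim bd by (intro L1_dominated_convergence[OF s(1) f w] always_eventually allI)
qed

lemma approximable_add:
  fixes f g :: "real^'n \<Rightarrow> 'b::{banach, second_countable_topology}"
  assumes f: "integrable lebesgue f" "approximable f" and g: "integrable lebesgue g" "approximable g"
  shows "approximable (\<lambda>x. f x + g x)"
  unfolding approximable_def
proof (intro allI impI)
  fix e :: real assume e: "e > 0"
  obtain u where u: "u \<in> Cc_infinity" "(LINT x|lebesgue. norm (f x - u x)) < e / 2"
    using f(2) e unfolding approximable_def by (meson half_gt_zero)
  obtain v where v: "v \<in> Cc_infinity" "(LINT x|lebesgue. norm (g x - v x)) < e / 2"
    using g(2) e unfolding approximable_def by (meson half_gt_zero)
  note i = f(1) g(1) Cc_infinity_integrable_lebesgue[OF u(1)] Cc_infinity_integrable_lebesgue[OF v(1)]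
  have "(LINT x|lebesgue. norm (f x + g x - (u x + v x))) \<le> (LINT x|lebesgue. norm (f x - u x) + norm (g x - v x))"
    using i by (intro integral_mono) (auto intro: norm_diff_triangle_ineq)
  also have "\<dots> < e" using u(2) v(2) i by simp
  finally show "\<exists>h\<in>Cc_infinity. (LINT x|lebesgue. norm (f x + g x - h x)) < e"
    using Cc_infinity_add[OF u(1) v(1)] by (auto intro!: bexI[of _ "\<lambda>x. u x + v x"])
qed

lemma approximable_bounded_linear:
  fixes L :: "'b::{banach, second_countable_topology} \<Rightarrow> 'c::{banach, second_countable_topology}"
  assumes L: "bounded_linear L" and f: "integrable lebesgue f" "approximable f"
  shows "approximable (\<lambda>x::real^'n. L (f x))"
  unfolding approximable_def
proof (intro allI impI)
  fix e :: real assume e: "e > 0"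
  obtain K where K: "K > 0" "\<And>x. norm (L x) \<le> norm x * K"
    using bounded_linear.pos_bounded[OF L] by blast
  have "0 < e / K" using e K by simp
  then obtain u where u: "u \<in> Cc_infinity" "(LINT x|lebesgue. norm (f x - u x)) < e / K"
    using f(2) unfolding approximable_def by meson
  note i = f(1) Cc_infinity_integrable_lebesgue[OF u(1)]
  have il: "integrable lebesgue (\<lambda>x. L (f x) - L (u x))"
    using i by (intro Bochner_Integration.integrable_diff integrable_bounded_linear[OF L])
  have le: "norm (L (f x) - L (u x)) \<le> norm (f x - u x) * K" for x
    using K(2)[of "f x - u x"] linear_diff[OF bounded_linear.linear[OF L]] by simp
  have "(LINT x|lebesgue. norm (L (f x) - L (u x))) \<le> (LINT x|lebesgue. norm (f x - u x) * K)"
    using i by (intro integral_mono integrable_norm[OF il] le) simp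
  also have "\<dots> < e" using u(2) i K by (simp add: field_simps)
  finally show "\<exists>h\<in>Cc_infinity. (LINT x|lebesgue. norm (L (f x) - h x)) < e"
    using Cc_infinity_bounded_linear[OF L u(1)] by (auto intro!: bexI[of _ "\<lambda>x. L (u x)"])
qed

lemma indicator_integrable_lebesgue:
  "A \<in> sets borel \<Longrightarrow> emeasure lborel A < \<infinity> \<Longrightarrow> integrable lebesgue (\<lambda>x. indicator A x :: complex)"
proof -
  assume A: "A \<in> sets borel" "emeasure lborel A < \<infinity>"
  then have "integrable lborel (\<lambda>x. complex_of_real (indicator A x))"
    by (intro integrable_of_real integrable_real_indicator) auto
  also have "(\<lambda>x. complex_of_real (indicator A x)) = (\<lambda>x. indicator A x)"
    by (auto simp: indicator_def)
  finally show ?thesis using A(1) by (simp add: integrable_completion)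
qed

lemma approximable_box:
  "approximable (\<lambda>x::real^'n. indicator (box a b) x :: complex)"
proof (rule approximable_dominated)
  show "integrable lebesgue (\<lambda>x. complex_of_real (box_bump (real (Suc n)) a b x))"
    "approximable (\<lambda>x. complex_of_real (box_bump (real (Suc n)) a b x))" for n
    using Cc_infinity_box_bump[of "real (Suc n)" a b]
    by (simp_all add: Cc_infinity_integrable_lebesgue approximable_Cc_infinity del: of_nat_Suc)
  show i: "integrable lebesgue (\<lambda>x. indicator (box a b) x :: complex)"
    by (rule indicator_integrable_lebesgue) (simp, rule emeasure_lborel_box_finite)
  then show "integrable lebesgue (\<lambda>x. norm (indicator (box a b) x :: complex))"
    by (rule integrable_norm)
  show "(\<lambda>n. complex_of_real (box_bump (real (Suc n)) a b x)) \<longlonglongrightarrow> indicator (box a b) x" for x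
    using tendsto_of_real[OF box_bump_tendsto_indicator[of a b x], where ?'a = complex]
    by (cases "x \<in> box a b") (simp_all del: of_nat_Suc)
  show "norm (complex_of_real (box_bump (real (Suc n)) a b x)) \<le> norm (indicator (box a b) x :: complex)" for n x
    using box_bump_nonneg[of "real (Suc n)" a b x] box_bump_le_1[of "real (Suc n)" a b x]
      box_bump_eq_0_iff[of "real (Suc n)" a b x]
    by (auto simp: indicator_def simp del: of_nat_Suc)
qed

text \<open>Dynkin's argument: boxes generate the Borel sets and are stable under intersection, and
  the property passes to complements and countable disjoint unions. Cutting with a fixed box keeps
  every indicator integrable.\<close>

lemma approximable_borel_Int_box:
  fixes E :: "(real^'n) set"
  assumes "E \<in> sets borel"
  shows "approximable (\<lambda>x. indicator (E \<inter> box u v) x :: complex)"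
proof -
  let ?W = "box u v"
  have E: "E \<in> sigma_sets UNIV (range (\<lambda>(a, b). box a b))"
    using assms unfolding borel_eq_box by simp
  have S: "A \<in> sets borel" if "A \<in> sigma_sets UNIV (range (\<lambda>(a, b). box a b))" for A :: "(real^'n) set"
    using that unfolding borel_eq_box by simp
  have i: "integrable lebesgue (\<lambda>x. indicator (A \<inter> ?W) x :: complex)" if "A \<in> sets borel" for A
  proof (rule indicator_integrable_lebesgue)
    have "emeasure lborel (A \<inter> ?W) \<le> emeasure lborel ?W" by (intro emeasure_mono) auto
    then show "emeasure lborel (A \<inter> ?W) < \<infinity>" using emeasure_lborel_box_finite[of u v] by (auto intro: le_less_trans)
  qed (use that in auto)
  have ist: "Int_stable (range (\<lambda>(a, b). box a b :: (real^'n) set))"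
    by (auto simp: Int_stable_def box_Int_box)
  have sub: "range (\<lambda>(a, b). box a b :: (real^'n) set) \<subseteq> Pow UNIV" by simp
  show ?thesis
  proof (induction rule: sigma_sets_induct_disjoint[OF ist sub E])
    case (1 A)
    then show ?case using approximable_box by (auto simp: box_Int_box)
  next
    case 2
    show ?case by (simp add: approximable_Cc_infinity Cc_infinity_zero)
  next
    case (3 A)
    have "approximable (\<lambda>x. indicator ?W x + (- 1) * indicator (A \<inter> ?W) x :: complex)"
      using i[OF S[OF 3(1)]] i[of UNIV] 3(2)
      by (intro approximable_add approximable_bounded_linear[OF bounded_linear_mult_right] approximable_box) simp_all
    moreover have "indicator ?W x + (- 1) * indicator (A \<inter> ?W) x = (indicator ((UNIV - A) \<inter> ?W) x :: complex)" for x
      by (auto simp: indicator_def)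
    ultimately show ?case by simp
  next
    case (4 A)
    have A: "A n \<in> sets borel" for n using 4(2) S by blast
    have fin: "integrable lebesgue (\<lambda>x. \<Sum>i<n. indicator (A i \<inter> ?W) x :: complex)
      \<and> approximable (\<lambda>x. \<Sum>i<n. indicator (A i \<inter> ?W) x :: complex)" for n
    proof (induction n)
      case 0
      show ?case by (simp add: approximable_Cc_infinity Cc_infinity_zero)
    next
      case (Suc n)
      then show ?case using i[OF A, of n] 4(3)[of n] by (simp add: approximable_add)
    qed
    have ind: "(\<Sum>i<n. indicator (A i \<inter> ?W) x :: complex) = indicator (\<Union>i<n. A i \<inter> ?W) x" for n x
      using 4(1) by (intro indicator_UN_disjoint[symmetric]) (auto simp: disjoint_family_on_def)
    show ?case
    proof (rule approximable_dominated[where s="\<lambda>n x. \<Sum>i<n. indicator (A i \<inter> ?W) x :: complex" and w="\<lambda>x. norm (indicator ?W x :: complex)"])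
      show "integrable lebesgue (\<lambda>x. indicator ((\<Union>i. A i) \<inter> ?W) x :: complex)"
        by (intro i) (use A in auto)
      show "integrable lebesgue (\<lambda>x. norm (indicator ?W x :: complex))"
        using i[of UNIV] by (intro integrable_norm) simp
      show "(\<lambda>n. \<Sum>i<n. indicator (A i \<inter> ?W) x :: complex) \<longlonglongrightarrow> indicator ((\<Union>i. A i) \<inter> ?W) x" for x
        unfolding ind using LIMSEQ_indicator_UN[of "\<lambda>i. A i \<inter> ?W" x, where ?'a = complex] by simp
      show "norm (\<Sum>i<n. indicator (A i \<inter> ?W) x :: complex) \<le> norm (indicator ?W x :: complex)" for n x
        unfolding ind by (auto simp: indicator_def)
    qed (use fin in auto)
  qed
qed

lemma approximable_indicator:
  fixes E :: "(real^'n) set"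
  assumes E: "E \<in> sets borel" "emeasure lborel E < \<infinity>"
  shows "approximable (\<lambda>x. indicator E x :: complex)"
proof -
  let ?W = "\<lambda>n. box (- real n *\<^sub>R One) (real n *\<^sub>R One) :: (real^'n) set"
  show ?thesis
  proof (rule approximable_dominated[where s="\<lambda>n x. indicator (E \<inter> ?W n) x :: complex"
        and w="\<lambda>x. norm (indicator E x :: complex)"])
  show i: "integrable lebesgue (\<lambda>x. indicator E x :: complex)"
    by (rule indicator_integrable_lebesgue[OF E])
  then show "integrable lebesgue (\<lambda>x. norm (indicator E x :: complex))" by (rule integrable_norm)
  show "approximable (\<lambda>x. indicator (E \<inter> ?W n) x :: complex)" for n
    by (rule approximable_borel_Int_box[OF E(1)])
  show "integrable lebesgue (\<lambda>x. indicator (E \<inter> ?W n) x :: complex)" for n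
  proof (rule indicator_integrable_lebesgue)
    have "emeasure lborel (E \<inter> ?W n) \<le> emeasure lborel E" using E by (intro emeasure_mono) auto
    then show "emeasure lborel (E \<inter> ?W n) < \<infinity>" using E(2) by (rule le_less_trans)
  qed (use E in auto)
  show "(\<lambda>n. indicator (E \<inter> ?W n) x :: complex) \<longlonglongrightarrow> indicator E x" for x
  proof -
    obtain N :: nat where N: "norm x < real N" using reals_Archimedean2 by blast
    have "x \<in> ?W n" if "n \<ge> N" for n
    proof -
      have "\<bar>x \<bullet> b\<bar> < real n" if "b \<in> Basis" for b
        using Basis_le_norm[OF that, of x] N \<open>n \<ge> N\<close> by linarith
      then show ?thesis by (fastforce simp: mem_box abs_less_iff)
    qed
    then have "\<forall>\<^sub>F n in sequentially. indicator E x = (indicator (E \<inter> ?W n) x :: complex)"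
      unfolding eventually_sequentially by (intro exI[of _ N]) (auto simp: indicator_def)
    then show ?thesis by (rule Lim_transform_eventually[OF tendsto_const])
  qed
  show "norm (indicator (E \<inter> ?W n) x :: complex) \<le> norm (indicator E x :: complex)" for n x
    by (auto simp: indicator_def)
qed
qed

lemma Cc_infinity_dense_L1:
  fixes f :: "real^'n \<Rightarrow> 'b::{banach, second_countable_topology}"
  assumes "integrable lebesgue f"
  shows "approximable f"
  using assms
proof (induction rule: integrable_induct)
  case (base A c)
  \<comment> \<open>A Lebesgue set differs from a Borel set \<open>S\<close> by a null set, which
    does not affect \<open>L^1\<close> distances.\<close>
  then obtain S N N' where A: "A = S \<union> N" "N \<subseteq> N'" "N' \<in> null_sets lborel" "S \<in> sets lborel"
    by (auto elim!: sets_completionE)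
  have "emeasure lebesgue S \<le> emeasure lebesgue A"
    using base A by (intro emeasure_mono) auto
  then have fin: "emeasure lborel S < \<infinity>"
    using base A(4) by (auto simp: emeasure_completion intro: le_less_trans)
  have S: "S \<in> sets borel" using A(4) by simp
  \<comment> \<open>Indicators were treated with complex values; a real-linear map carries them to
    multiples of the vector \<open>c\<close>.\<close>
  have "approximable (\<lambda>x. Re (indicator S x) *\<^sub>R c)"
    by (intro approximable_bounded_linear[of "\<lambda>z. Re z *\<^sub>R c"] approximable_indicator
        indicator_integrable_lebesgue S fin bounded_linear_scaleR_const bounded_linear_Re)
  moreover have "Re (indicator S x) *\<^sub>R c = indicator S x *\<^sub>R c" for x
    by (simp add: indicator_def)
  ultimately have "approximable (\<lambda>x. indicator S x *\<^sub>R c)"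
    by simp
  moreover have "(LINT x|lebesgue. norm (indicator A x *\<^sub>R c - g x)) = (LINT x|lebesgue. norm (indicator S x *\<^sub>R c - g x))"
    if "g \<in> Cc_infinity" for g
  proof (rule integral_cong_AE)
    have "AE x in lebesgue. x \<notin> N'"
      using A(3) by (intro AE_not_in) (simp add: null_sets_completionI)
    then show "AE x in lebesgue. norm (indicator A x *\<^sub>R c - g x) = norm (indicator S x *\<^sub>R c - g x)"
      by eventually_elim (use A(1,2) in \<open>auto simp: indicator_def\<close>)
    have "S \<in> sets lebesgue" using A(4) by simp
    then show "(\<lambda>x. norm (indicator A x *\<^sub>R c - g x)) \<in> borel_measurable lebesgue"
      "(\<lambda>x. norm (indicator S x *\<^sub>R c - g x)) \<in> borel_measurable lebesgue"
      using base(1) borel_measurable_integrable[OF Cc_infinity_integrable_lebesgue[OF that]] by measurable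
  qed
  ultimately show ?case unfolding approximable_def by simp
next
  case (add f g)
  then show ?case by (intro approximable_add)
next
  case (lim f s)
  show ?case
    by (rule approximable_dominated[where s=s and w="\<lambda>x. 2 * norm (f x)"]) (use lim in auto)
qed

section \<open>Extension of operators to \<open>L\<^sup>1\<close>\<close>

text \<open>A sequence with summable consecutive distances telescopes to an absolutely convergent series.\<close>

lemma L1_fast_Cauchy_convergent:
  fixes q :: "nat \<Rightarrow> 'a \<Rightarrow> 'b::{banach, second_countable_topology}"
  assumes q: "\<And>n. integrable M (q n)"
    and sm: "summable (\<lambda>n. LINT x|M. norm (q (Suc n) x - q n x))"
  obtains t where "integrable M t" "(\<lambda>n. LINT x|M. norm (t x - q n x)) \<longlonglongrightarrow> 0"
proof -
  define d where "d = (\<lambda>n x. q (Suc n) x - q n x)"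
  have d: "integrable M (d n)" for n unfolding d_def using q by simp
  have [measurable]: "d n \<in> borel_measurable M" for n using d[of n] by auto
  have "(\<integral>\<^sup>+x. (\<Sum>n. ennreal (norm (d n x))) \<partial>M) = (\<Sum>n. \<integral>\<^sup>+x. ennreal (norm (d n x)) \<partial>M)"
    by (rule nn_integral_suminf) simp
  also have "\<dots> = (\<Sum>n. ennreal (LINT x|M. norm (d n x)))"
    using d by (intro suminf_cong nn_integral_eq_integral) auto
  also have "\<dots> \<noteq> \<infinity>"
    using sm unfolding d_def infinity_ennreal_def by (intro ennreal_suminf_neq_top) auto
  finally have "AE x in M. (\<Sum>n. ennreal (norm (d n x))) \<noteq> \<infinity>"
    by (intro nn_integral_PInf_AE) auto
  then have ae: "AE x in M. summable (\<lambda>n. norm (d n x))"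
    by eventually_elim (auto intro: summable_suminf_not_top)
  define t where "t = (\<lambda>x. q 0 x + (\<Sum>n. d n x))"
  define w where "w = (\<lambda>x. norm (q 0 x) + (\<Sum>n. norm (d n x)))"
  have sm': "summable (\<lambda>n. LINT x|M. norm (d n x))" using sm by (simp add: d_def)
  have t: "integrable M t"
    unfolding t_def by (intro Bochner_Integration.integrable_add q integrable_suminf d ae sm')
  have "integrable M (\<lambda>x. \<Sum>n. norm (d n x))"
    by (rule integrable_suminf[OF integrable_norm[OF d]]) (use ae sm' in simp_all)
  then have w: "integrable M w"
    unfolding w_def using q by simp
  have tel: "q n x = q 0 x + (\<Sum>i<n. d i x)" for n x
    using sum_lessThan_telescope[of "\<lambda>i. q i x" n] by (simp add: d_def)
  have "(\<lambda>n. LINT x|M. norm (t x - q n x)) \<longlonglongrightarrow> 0"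
  proof (rule L1_dominated_convergence[OF q t w])
    show "AE x in M. (\<lambda>n. q n x) \<longlonglongrightarrow> t x"
      using ae
    proof eventually_elim
      case (elim x)
      have "(\<lambda>n. \<Sum>i<n. d i x) \<longlonglongrightarrow> (\<Sum>n. d n x)"
        by (rule summable_LIMSEQ[OF summable_norm_cancel[OF elim]])
      then show ?case unfolding t_def by (subst tel) (intro tendsto_intros)
    qed
    show "AE x in M. norm (q n x) \<le> w x" for n
      using ae
    proof eventually_elim
      case (elim x)
      have "norm (q n x) \<le> norm (q 0 x) + (\<Sum>i<n. norm (d i x))"
        by (subst tel) (intro order_trans[OF norm_triangle_ineq] add_left_mono norm_sum)
      also have "(\<Sum>i<n. norm (d i x)) \<le> (\<Sum>n. norm (d n x))"
        by (intro sum_le_suminf elim) auto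
      finally show ?case by (simp add: w_def)
    qed
  qed
  with t show ?thesis by (rule that)
qed

text \<open>\<open>T f\<close> is a limit of images of approximants of \<open>f\<close>. The
  conclusion retains only the estimate against every \<open>g\<close> in \<open>D\<close>: by
  density it determines \<open>T f\<close> up to null sets, so further properties of
  \<open>T\<close> can be derived from it.\<close>

lemma L1_extension:
  fixes Q :: "('a \<Rightarrow> 'b::{banach, second_countable_topology}) \<Rightarrow> 'a \<Rightarrow> 'b"
  assumes D: "\<And>g. g \<in> D \<Longrightarrow> integrable M g"
    and dense: "\<And>f e. integrable M f \<Longrightarrow> e > 0 \<Longrightarrow> \<exists>g\<in>D. (LINT x|M. norm (f x - g x)) < e"
    and Q: "\<And>g. g \<in> D \<Longrightarrow> integrable M (Q g)"
      "\<And>g h. g \<in> D \<Longrightarrow> h \<in> D \<Longrightarrow> (LINT x|M. norm (Q g x - Q h x)) \<le> C * (LINT x|M. norm (g x - h x))"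
    and C: "C \<ge> 0"
  obtains T where "\<And>f. integrable M f \<Longrightarrow> integrable M (T f)"
    "\<And>f g. integrable M f \<Longrightarrow> g \<in> D \<Longrightarrow> (LINT x|M. norm (T f x - Q g x)) \<le> C * (LINT x|M. norm (f x - g x))"
proof -
  let ?d = "\<lambda>f g. LINT x|M. norm (f x - g x)"
  have "\<exists>t. integrable M t \<and> (\<forall>g\<in>D. ?d t (Q g) \<le> C * ?d f g)"
    if f: "integrable M f" for f
  proof -
    \<comment> \<open>The geometric rate makes the consecutive distances of the images
      summable.\<close>
    have "\<exists>g\<in>D. ?d f g < (1/2) ^ n" for n :: nat
      by (intro dense f) simp
    then obtain g where g: "\<And>n. g n \<in> D" "\<And>n. ?d f (g n) < (1/2) ^ n"
      by metis
    have "?d (Q (g (Suc n))) (Q (g n)) \<le> 2 * C * (1/2) ^ n" for n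
    proof -
      have "?d (g (Suc n)) (g n) \<le> ?d f (g (Suc n)) + ?d f (g n)"
        using L1_triangle[OF D[OF g(1)[of "Suc n"]] f D[OF g(1)[of n]]] by (simp add: norm_minus_commute)
      also have "\<dots> \<le> 2 * (1/2) ^ n"
      proof -
        have "(1/2) ^ Suc n \<le> (1/2 :: real) ^ n" by simp
        then show ?thesis using g(2)[of n] g(2)[of "Suc n"] by linarith
      qed
      finally have "C * ?d (g (Suc n)) (g n) \<le> C * (2 * (1/2) ^ n)"
        using C by (rule mult_left_mono)
      then show ?thesis using Q(2)[OF g(1) g(1), of "Suc n" n] by simp
    qed
    then have le: "norm (?d (Q (g (Suc n))) (Q (g n))) \<le> 2 * C * (1/2) ^ n" for n
      by simp
    have sg: "summable (\<lambda>n. 2 * C * (1/2) ^ n)"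
      by (rule summable_mult[OF summable_geometric]) simp
    have "summable (\<lambda>n. ?d (Q (g (Suc n))) (Q (g n)))"
      by (rule summable_comparison_test'[OF sg, of 0]) (rule le)
    from L1_fast_Cauchy_convergent[of M "\<lambda>n. Q (g n)", OF Q(1)[OF g(1)] this]
    obtain t where t: "integrable M t" "(\<lambda>n. ?d t (Q (g n))) \<longlonglongrightarrow> 0" by blast
    have "?d t (Q h) \<le> C * ?d f h" if h: "h \<in> D" for h
    proof (rule LIMSEQ_le_const)
      have p: "(\<lambda>n. (1/2) ^ n) \<longlonglongrightarrow> (0::real)" by (rule LIMSEQ_power_zero) simp
      have "(\<lambda>n. ?d t (Q (g n)) + C * ((1/2) ^ n + ?d f h)) \<longlonglongrightarrow>
          0 + C * (0 + ?d f h)"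
        by (intro tendsto_add tendsto_mult tendsto_const t(2) p)
      then show "(\<lambda>n. ?d t (Q (g n)) + C * ((1/2) ^ n + ?d f h)) \<longlonglongrightarrow>
          C * ?d f h" by simp
      have "?d t (Q h) \<le> ?d t (Q (g n)) + C * ((1/2) ^ n + ?d f h)" for n
      proof -
        have "?d (g n) h \<le> ?d f (g n) + ?d f h"
          using L1_triangle[OF D[OF g(1)[of n]] f D[OF h]] by (simp add: norm_minus_commute)
        also have "\<dots> \<le> (1/2) ^ n + ?d f h"
          using g(2)[of n] by simp
        finally have "C * ?d (g n) h \<le> C * ((1/2) ^ n + ?d f h)"
          using C by (rule mult_left_mono)
        then show ?thesis
          using L1_triangle[OF t(1) Q(1)[OF g(1)[of n]] Q(1)[OF h]] Q(2)[OF g(1)[of n] h] by simp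
      qed
      then show "\<exists>N. \<forall>n\<ge>N. ?d t (Q h) \<le> ?d t (Q (g n)) + C * ((1/2) ^ n + ?d f h)"
        by blast
    qed
    with t(1) show ?thesis by blast
  qed
  then show ?thesis using that by metis
qed

lemma L1_eq_AE:
  fixes u v :: "'a \<Rightarrow> 'b::{banach, second_countable_topology}"
  assumes u: "integrable M u" "integrable M v"
    and le: "\<And>e. e > 0 \<Longrightarrow> (LINT x|M. norm (u x - v x)) \<le> K * e"
  shows "AE x in M. u x = v x"
proof -
  have "(LINT x|M. norm (u x - v x)) \<le> 0"
  proof (rule field_le_epsilon)
    fix e :: real assume e: "e > 0"
    \<comment> \<open>The divisor \<open>\<bar>K\<bar> + 1\<close> is positive for every
      \<open>K\<close>, including zero and negative values.\<close>
    have "K * (e / (\<bar>K\<bar> + 1)) \<le> (\<bar>K\<bar> + 1) * (e / (\<bar>K\<bar> + 1))"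
      using e by (intro mult_right_mono) auto
    also have "\<dots> = e" by simp
    finally show "(LINT x|M. norm (u x - v x)) \<le> 0 + e"
      using le[of "e / (\<bar>K\<bar> + 1)"] e by simp
  qed
  then have "(LINT x|M. norm (u x - v x)) = 0"
    by (intro antisym) auto
  then have "AE x in M. norm (u x - v x) = 0"
    using u by (subst (asm) integral_nonneg_eq_0_iff_AE) auto
  then show ?thesis by eventually_elim simp
qed

section \<open>Operator norm against the Euclidean norm on matrices\<close>

lemma matrix_vector_mult_bounded_linear:
  fixes A :: "complex^'m^'k"
  shows "bounded_linear (\<lambda>v. A *v v)"
proof -
  have "A *v (r *\<^sub>R v) = r *\<^sub>R (A *v v)" for r :: real and v
    by (simp add: matrix_vector_mult_def vec_eq_iff scaleR_sum_right)
  then have "linear (\<lambda>v. A *v v)"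
    by (intro linearI) (simp_all add: matrix_vector_right_distrib)
  then show ?thesis by (simp add: linear_conv_bounded_linear)
qed

lemma norm_vec_le_sum: "norm (x :: 'b::real_normed_vector ^ 'k) \<le> (\<Sum>i\<in>UNIV. norm (x $ i))"
  unfolding norm_vec_def by (rule L2_set_le_sum) simp

lemma norm_matrix_le_sum: "norm (A :: complex^'m^'k) \<le> (\<Sum>j\<in>UNIV. \<Sum>k\<in>UNIV. cmod (A $ j $ k))"
  by (rule order_trans[OF norm_vec_le_sum]) (intro sum_mono norm_vec_le_sum)

lemma cmod_entry_le_norm: "cmod ((A :: complex^'m^'k) $ j $ k) \<le> norm A"
  by (meson Finite_Cartesian_Product.norm_nth_le order_trans)

lemma cmod_entry_le_mat_opnorm: "cmod (A $ j $ k) \<le> mat_opnorm A"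
proof -
  have "cmod (A $ j $ k) = cmod ((A *v axis k 1) $ j)"
    by (simp add: matrix_vector_mult_def axis_def if_distrib cong: if_cong)
  also have "\<dots> \<le> norm (A *v axis k 1)" by (rule Finite_Cartesian_Product.norm_nth_le)
  also have "\<dots> \<le> mat_opnorm A * norm (axis k 1 :: complex^'a)"
    unfolding mat_opnorm_def by (rule onorm[OF matrix_vector_mult_bounded_linear])
  finally show ?thesis by simp
qed

text \<open>A crude constant that counts the entries; boundedness on \<open>L1\<close> depends only
  on the two norms being equivalent.\<close>

lemma norm_le_mat_opnorm: "norm (A :: complex^'m^'m) \<le> (real CARD('m))\<^sup>2 * mat_opnorm A"
proof -
  have "norm A \<le> (\<Sum>j\<in>(UNIV::'m set). \<Sum>k\<in>(UNIV::'m set). mat_opnorm A)"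
    by (rule order_trans[OF norm_matrix_le_sum]) (intro sum_mono cmod_entry_le_mat_opnorm)
  then show ?thesis by (simp add: power2_eq_square mult.assoc)
qed

lemma mat_opnorm_nonneg: "0 \<le> mat_opnorm A"
  unfolding mat_opnorm_def by (rule onorm_pos_le[OF matrix_vector_mult_bounded_linear])

lemma mat_opnorm_le_norm: "mat_opnorm (A :: complex^'m^'m) \<le> (real CARD('m))\<^sup>2 * norm A"
  unfolding mat_opnorm_def
proof (rule onorm_le)
  fix v :: "complex^'m"
  have "norm (A *v v) \<le> (\<Sum>j\<in>UNIV. norm ((A *v v) $ j))" by (rule norm_vec_le_sum)
  also have "\<dots> \<le> (\<Sum>j\<in>(UNIV::'m set). \<Sum>k\<in>(UNIV::'m set). norm A * norm v)"
  proof (rule sum_mono)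
    fix j
    have "norm ((A *v v) $ j) \<le> (\<Sum>k\<in>UNIV. norm (A $ j $ k * v $ k))"
      unfolding matrix_vector_mult_def vec_lambda_beta by (rule norm_sum)
    also have "\<dots> \<le> (\<Sum>k\<in>(UNIV::'m set). norm A * norm v)"
      by (intro sum_mono) (auto simp: norm_mult intro!: mult_mono cmod_entry_le_norm Finite_Cartesian_Product.norm_nth_le)
    finally show "norm ((A *v v) $ j) \<le> (\<Sum>k\<in>(UNIV::'m set). norm A * norm v)" .
  qed
  also have "\<dots> = (real CARD('m))\<^sup>2 * norm A * norm v"
    by (simp add: power2_eq_square mult.assoc)
  finally show "norm (A *v v) \<le> (real CARD('m))\<^sup>2 * norm A * norm v" .
qed

lemma mat_opnorm_triangle: "mat_opnorm (A + B) \<le> mat_opnorm A + mat_opnorm B"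
  unfolding mat_opnorm_def matrix_vector_mult_add_rdistrib
  by (rule onorm_triangle[OF matrix_vector_mult_bounded_linear matrix_vector_mult_bounded_linear])

lemma continuous_mat_opnorm: "continuous_on UNIV (mat_opnorm :: complex^'m^'m \<Rightarrow> real)"
proof -
  define K where "K = (real CARD('m))\<^sup>2"
  have d: "\<bar>mat_opnorm A - mat_opnorm B\<bar> \<le> K * norm (A - B)" for A B :: "complex^'m^'m"
    using mat_opnorm_triangle[of "A - B" B] mat_opnorm_triangle[of "B - A" A]
      mat_opnorm_le_norm[of "A - B"] mat_opnorm_le_norm[of "B - A"]
    by (simp add: K_def norm_minus_commute abs_le_iff)
  have "K-lipschitz_on UNIV (mat_opnorm :: complex^'m^'m \<Rightarrow> real)"
    by (rule lipschitz_onI) (auto simp: dist_norm d, simp add: K_def)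
  then show ?thesis by (rule lipschitz_on_continuous_on)
qed

lemma measurable_mat_opnorm[measurable]: "mat_opnorm \<in> borel_measurable borel"
  by (rule borel_measurable_continuous_onI[OF continuous_mat_opnorm])

text \<open>Equivalence of norms moves the problem to Bochner integrability in the norm of the type,
  where the general lemmas above apply.\<close>

lemma L1_iff_integrable: "f \<in> L1 \<longleftrightarrow> integrable lebesgue f"
proof
  assume f: "f \<in> L1"
  then have m: "f \<in> borel_measurable lebesgue" and i: "integrable lebesgue (\<lambda>x. mat_opnorm (f x))"
    by (auto simp: L1_def)
  show "integrable lebesgue f"
  proof (rule Bochner_Integration.integrable_bound)
    show "integrable lebesgue (\<lambda>x. (real CARD('b))\<^sup>2 * mat_opnorm (f x))" using i by simp
    show "AE x in lebesgue. norm (f x) \<le> norm ((real CARD('b))\<^sup>2 * mat_opnorm (f x))"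
      unfolding real_norm_def by (intro always_eventually allI order_trans[OF norm_le_mat_opnorm abs_ge_self])
  qed fact
next
  assume i: "integrable lebesgue f"
  then have m: "f \<in> borel_measurable lebesgue" by auto
  have "integrable lebesgue (\<lambda>x. mat_opnorm (f x))"
  proof (rule Bochner_Integration.integrable_bound)
    show "integrable lebesgue (\<lambda>x. (real CARD('b))\<^sup>2 * norm (f x))" using i by simp
    show "(\<lambda>x. mat_opnorm (f x)) \<in> borel_measurable lebesgue" using m by measurable
    show "AE x in lebesgue. norm (mat_opnorm (f x)) \<le> norm ((real CARD('b))\<^sup>2 * norm (f x))"
      unfolding real_norm_def abs_of_nonneg[OF mat_opnorm_nonneg]
      by (intro always_eventually allI order_trans[OF mat_opnorm_le_norm abs_ge_self])
  qed
  with m show "f \<in> L1" by (simp add: L1_def)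
qed

lemma L1_norm_le:
  fixes f :: "real^'n \<Rightarrow> complex^'m^'m"
  assumes "integrable lebesgue f"
  shows "L1_norm f \<le> (real CARD('m))\<^sup>2 * (LINT x|lebesgue. norm (f x))"
    and "(LINT x|lebesgue. norm (f x)) \<le> (real CARD('m))\<^sup>2 * L1_norm f"
proof -
  have i: "integrable lebesgue (\<lambda>x. mat_opnorm (f x))"
    using assms L1_iff_integrable[of f] by (simp add: L1_def)
  have "L1_norm f \<le> (LINT x|lebesgue. (real CARD('m))\<^sup>2 * norm (f x))"
    unfolding L1_norm_def using assms i by (intro integral_mono mat_opnorm_le_norm) auto
  then show "L1_norm f \<le> (real CARD('m))\<^sup>2 * (LINT x|lebesgue. norm (f x))" by simp
  have "(LINT x|lebesgue. norm (f x)) \<le> (LINT x|lebesgue. (real CARD('m))\<^sup>2 * mat_opnorm (f x))"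
    using assms i by (intro integral_mono norm_le_mat_opnorm) auto
  then show "(LINT x|lebesgue. norm (f x)) \<le> (real CARD('m))\<^sup>2 * L1_norm f" by (simp add: L1_norm_def)
qed

lemma bounded_linear_cscale_mat: "bounded_linear (cscale_mat a :: complex^'m^'m \<Rightarrow> complex^'m^'m)"
proof -
  have "linear (cscale_mat a :: complex^'m^'m \<Rightarrow> complex^'m^'m)"
    by (intro linearI) (simp_all add: cscale_mat_def vec_eq_iff algebra_simps)
  then show ?thesis by (simp add: linear_conv_bounded_linear)
qed

text \<open>The algebraic requirements on \<open>T\<close> all come from \<open>uniq\<close>: a
  function that is approximated by \<open>Q g\<close> while \<open>g\<close> approximates
  \<open>f\<close> equals \<open>T f\<close> almost everywhere. It is applied with the candidates
  for \<open>T\<close> of a sum, of a multiple, and of an almost equal function.\<close>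

lemma bounded_operator_L1_extension:
  fixes Q :: "(real^'n \<Rightarrow> complex^'m^'m) \<Rightarrow> real^'n \<Rightarrow> complex^'m^'m"
  assumes Q: "\<And>g. g \<in> Cc_infinity \<Longrightarrow> integrable lebesgue (Q g)"
      "\<And>g. g \<in> Cc_infinity \<Longrightarrow> (LINT x|lebesgue. norm (Q g x)) \<le> C * (LINT x|lebesgue. norm (g x))"
    and add: "\<And>g h x. g \<in> Cc_infinity \<Longrightarrow> h \<in> Cc_infinity \<Longrightarrow> Q (\<lambda>x. g x + h x) x = Q g x + Q h x"
    and scale: "\<And>a g x. g \<in> Cc_infinity \<Longrightarrow> Q (\<lambda>x. cscale_mat a (g x)) x = cscale_mat a (Q g x)"
    and C: "C \<ge> 0"
  shows "\<exists>T. bounded_operator_L1 T \<and> (\<forall>f\<in>Cc_infinity. AE x in lebesgue. T f x = Q f x)"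
proof -
  let ?I = "\<lambda>f::real^'n \<Rightarrow> complex^'m^'m. LINT x|lebesgue. norm (f x)"
  note D = Cc_infinity_integrable_lebesgue[where ?'b = "complex^'m^'m"]
  have dense: "\<exists>g\<in>Cc_infinity. ?I (\<lambda>x. f x - g x) < e" if "integrable lebesgue f" "e > 0" for f e
    using Cc_infinity_dense_L1[OF that(1)] that(2) by (auto simp: approximable_def)
  have Qdiff: "?I (\<lambda>x. Q g x - Q h x) \<le> C * ?I (\<lambda>x. g x - h x)" if "g \<in> Cc_infinity" "h \<in> Cc_infinity" for g h
  proof -
    \<comment> \<open>Differences are obtained from additivity and scaling by
      \<open>- 1\<close>.\<close>
    have s: "cscale_mat (-1) A = - A" for A :: "complex^'m^'m" by (simp add: cscale_mat_def vec_eq_iff)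
    have m: "(\<lambda>x. cscale_mat (-1) (h x)) \<in> Cc_infinity"
      using Cc_infinity_bounded_linear[OF bounded_linear_cscale_mat that(2)] .
    have "Q (\<lambda>x. g x + cscale_mat (-1) (h x)) x = Q g x - Q h x" for x
      by (simp only: add[OF that(1) m] scale[OF that(2)]) (simp add: s)
    moreover have "?I (Q (\<lambda>x. g x + cscale_mat (-1) (h x))) \<le> C * ?I (\<lambda>x. g x + cscale_mat (-1) (h x))"
      by (intro Q(2) Cc_infinity_add that m)
    ultimately show ?thesis by (simp add: s)
  qed
  obtain T where T: "\<And>f. integrable lebesgue f \<Longrightarrow> integrable lebesgue (T f)"
    "\<And>f g. integrable lebesgue f \<Longrightarrow> g \<in> Cc_infinity \<Longrightarrow> ?I (\<lambda>x. T f x - Q g x) \<le> C * ?I (\<lambda>x. f x - g x)"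
    using L1_extension[where D=Cc_infinity and M=lebesgue and Q=Q and C=C, OF D dense Q(1) Qdiff C] by blast
  have uniq: "AE x in lebesgue. u x = T f x"
    if f: "integrable lebesgue f" and u: "integrable lebesgue u"
      and K: "\<And>e. e > 0 \<Longrightarrow> \<exists>g\<in>Cc_infinity. ?I (\<lambda>x. f x - g x) \<le> e \<and> ?I (\<lambda>x. u x - Q g x) \<le> K * e" for f u K
  proof (rule L1_eq_AE[OF u T(1)[OF f], of "K + C"])
    fix e :: real assume "e > 0"
    then obtain g where g: "g \<in> Cc_infinity" "?I (\<lambda>x. f x - g x) \<le> e" "?I (\<lambda>x. u x - Q g x) \<le> K * e"
      using K by blast
    have "?I (\<lambda>x. Q g x - T f x) \<le> C * e"
      using T(2)[OF f g(1)] mult_left_mono[OF g(2) C] by (simp add: norm_minus_commute)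
    then show "?I (\<lambda>x. u x - T f x) \<le> (K + C) * e"
      using L1_triangle[OF u Q(1)[OF g(1)] T(1)[OF f]] g(3) by (simp add: distrib_right)
  qed
  have ext: "AE x in lebesgue. T f x = Q f x" if f: "f \<in> Cc_infinity" for f
  proof -
    have "AE x in lebesgue. Q f x = T f x"
      by (rule uniq[OF D[OF f] Q(1)[OF f], of 0]) (auto intro!: bexI[OF _ f])
    then show ?thesis by eventually_elim simp
  qed
  have approx: "\<exists>g\<in>Cc_infinity. ?I (\<lambda>x. f x - g x) \<le> e \<and> ?I (\<lambda>x. T f x - Q g x) \<le> C * e"
    if f: "integrable lebesgue f" and e: "e > 0" for f e
  proof -
    obtain g where "g \<in> Cc_infinity" "?I (\<lambda>x. f x - g x) < e" using dense[OF f e] by blast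
    then show ?thesis
      using T(2)[OF f, of g] mult_left_mono[OF less_imp_le C, of "?I (\<lambda>x. f x - g x)" e]
      by (intro bexI[of _ g]) auto
  qed
  have "bounded_operator_L1 T"
    unfolding bounded_operator_L1_def L1_iff_integrable
  proof (intro conjI ballI allI impI; (simp only: L1_iff_integrable)?)
    show "integrable lebesgue (T f)" if "integrable lebesgue f" for f by (rule T(1)[OF that])
  next
    fix f g :: "real^'n \<Rightarrow> complex^'m^'m"
    assume f: "integrable lebesgue f" and g: "integrable lebesgue g" and eq: "AE x in lebesgue. f x = g x"
    show "AE x in lebesgue. T f x = T g x"
    proof (rule uniq[OF g T(1)[OF f], of C])
      fix e :: real assume "e > 0"
      then obtain h where h: "h \<in> Cc_infinity" "?I (\<lambda>x. f x - h x) \<le> e" "?I (\<lambda>x. T f x - Q h x) \<le> C * e"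
        using approx[OF f] by blast
      have "?I (\<lambda>x. g x - h x) = ?I (\<lambda>x. f x - h x)"
        using f g D[OF h(1)] eq by (intro integral_cong_AE) auto
      then show "\<exists>h\<in>Cc_infinity. ?I (\<lambda>x. g x - h x) \<le> e \<and> ?I (\<lambda>x. T f x - Q h x) \<le> C * e"
        using h by (intro bexI[of _ h]) auto
    qed
  next
    fix f g :: "real^'n \<Rightarrow> complex^'m^'m"
    assume f: "integrable lebesgue f" and g: "integrable lebesgue g"
    have "AE x in lebesgue. T f x + T g x = T (\<lambda>y. f y + g y) x"
    proof (rule uniq[of _ _ C])
      fix e :: real assume "e > 0"
      then have "e / 2 > 0" by simp
      obtain u where u: "u \<in> Cc_infinity" "?I (\<lambda>x. f x - u x) \<le> e / 2" "?I (\<lambda>x. T f x - Q u x) \<le> C * (e / 2)"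
        using approx[OF f \<open>e / 2 > 0\<close>] by blast
      obtain v where v: "v \<in> Cc_infinity" "?I (\<lambda>x. g x - v x) \<le> e / 2" "?I (\<lambda>x. T g x - Q v x) \<le> C * (e / 2)"
        using approx[OF g \<open>e / 2 > 0\<close>] by blast
      have s: "?I (\<lambda>x. a x + b x - (c x + d x)) \<le> ?I (\<lambda>x. a x - c x) + ?I (\<lambda>x. b x - d x)"
        if "integrable lebesgue a" "integrable lebesgue b" "integrable lebesgue c" "integrable lebesgue d" for a b c d
      proof -
        have "?I (\<lambda>x. a x + b x - (c x + d x)) \<le> (LINT x|lebesgue. norm (a x - c x) + norm (b x - d x))"
          using that by (intro integral_mono) (auto intro: norm_diff_triangle_ineq)
        then show ?thesis using that by simp
      qed
      show "\<exists>h\<in>Cc_infinity. ?I (\<lambda>x. f x + g x - h x) \<le> e \<and> ?I (\<lambda>x. T f x + T g x - Q h x) \<le> C * e"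
        using s[OF f g D[OF u(1)] D[OF v(1)]] s[OF T(1)[OF f] T(1)[OF g] Q(1)[OF u(1)] Q(1)[OF v(1)]] u v
        by (intro bexI[of _ "\<lambda>x. u x + v x"]) (auto simp: add Cc_infinity_add)
    qed (use f g T in auto)
    then show "AE x in lebesgue. T (\<lambda>y. f y + g y) x = T f x + T g x" by eventually_elim simp
  next
    fix a and f :: "real^'n \<Rightarrow> complex^'m^'m"
    assume f: "integrable lebesgue f"
    obtain L where L: "L > 0" "\<And>A::complex^'m^'m. norm (cscale_mat a A) \<le> norm A * L"
      using bounded_linear.pos_bounded[OF bounded_linear_cscale_mat] by blast
    note ci = integrable_bounded_linear[OF bounded_linear_cscale_mat]
    have "AE x in lebesgue. cscale_mat a (T f x) = T (\<lambda>y. cscale_mat a (f y)) x"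
    proof (rule uniq[where K = C])
      fix e :: real assume "e > 0"
      then have "e / L > 0" using L by simp
      obtain u where u: "u \<in> Cc_infinity" "?I (\<lambda>x. f x - u x) \<le> e / L" "?I (\<lambda>x. T f x - Q u x) \<le> C * (e / L)"
        using approx[OF f \<open>e / L > 0\<close>] by blast
      have s: "?I (\<lambda>x. cscale_mat a (b x) - cscale_mat a (c x)) \<le> ?I (\<lambda>x. b x - c x) * L"
        if "integrable lebesgue b" "integrable lebesgue c" for b c
      proof -
        have "?I (\<lambda>x. cscale_mat a (b x) - cscale_mat a (c x)) = ?I (\<lambda>x. cscale_mat a (b x - c x))"
          unfolding linear_diff[OF bounded_linear.linear[OF bounded_linear_cscale_mat]] ..
        also have "\<dots> \<le> (LINT x|lebesgue. norm (b x - c x) * L)"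
          using that by (intro integral_mono L integrable_norm ci) auto
        finally show ?thesis using that by simp
      qed
      have "?I (\<lambda>x. cscale_mat a (f x) - cscale_mat a (u x)) \<le> e"
        using s[OF f D[OF u(1)]] mult_right_mono[OF u(2), of L] L(1) by simp
      moreover have "?I (\<lambda>x. cscale_mat a (T f x) - cscale_mat a (Q u x)) \<le> C * e"
        using s[OF T(1)[OF f] Q(1)[OF u(1)]] mult_right_mono[OF u(3), of L] L(1) by simp
      ultimately show "\<exists>h\<in>Cc_infinity. ?I (\<lambda>x. cscale_mat a (f x) - h x) \<le> e \<and> ?I (\<lambda>x. cscale_mat a (T f x) - Q h x) \<le> C * e"
        using scale[OF u(1)] Cc_infinity_bounded_linear[OF bounded_linear_cscale_mat u(1)]
        by (intro bexI[of _ "\<lambda>x. cscale_mat a (u x)"]) auto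
    qed (use ci[OF f] ci[OF T(1)[OF f]] in auto)
    then show "AE x in lebesgue. T (\<lambda>y. cscale_mat a (f y)) x = cscale_mat a (T f x)" by eventually_elim simp
  next
    let ?N = "(real CARD('m))\<^sup>2"
    show "\<exists>C. \<forall>f\<in>L1. L1_norm (T f) \<le> C * L1_norm f"
    proof (intro exI[of _ "?N * C * ?N"] ballI)
      fix f :: "real^'n \<Rightarrow> complex^'m^'m" assume "f \<in> L1"
      then have f: "integrable lebesgue f" by (simp add: L1_iff_integrable)
      \<comment> \<open>The estimate for \<open>T\<close> against \<open>g = 0\<close> is the norm
        bound; scaling by 0 shows that \<open>Q\<close> maps zero to zero.\<close>
      have "(\<lambda>x. 0) \<in> (Cc_infinity :: (real^'n \<Rightarrow> complex^'m^'m) set)"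
        by (rule Cc_infinity_zero)
      moreover from scale[OF this, of 0] have "Q (\<lambda>x. 0) x = 0" for x
        by (simp add: cscale_mat_def vec_eq_iff flip: zero_vec_def)
      ultimately have le: "?I (T f) \<le> C * ?I f"
        using T(2)[OF f, of "\<lambda>x. 0"] by simp
      have "L1_norm (T f) \<le> ?N * ?I (T f)" by (rule L1_norm_le(1)[OF T(1)[OF f]])
      also have "\<dots> \<le> ?N * (C * (?N * L1_norm f))"
        by (intro mult_left_mono order_trans[OF le] L1_norm_le(2)[OF f] C) auto
      finally show "L1_norm (T f) \<le> ?N * C * ?N * L1_norm f" by (simp add: mult.assoc)
    qed
  qed
  with ext show ?thesis by blast
qed

section \<open>Matrix-valued multipliers\<close>

lemma Cc_infinity_entry:
  fixes f :: "real^'n \<Rightarrow> complex^'m^'k"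
  assumes "f \<in> Cc_infinity"
  shows "(\<lambda>x. f x $ j $ k) \<in> Cc_infinity"
  using Cc_infinity_bounded_linear[OF bounded_linear_compose[OF bounded_linear_vec_nth bounded_linear_vec_nth] assms] .

lemma fourier_entry:
  fixes f :: "real^'n \<Rightarrow> complex^'m^'m"
  assumes "f \<in> Cc_infinity"
  shows "fourier f y $ j $ k = of_real ((2 * pi) powr (- real CARD('n) / 2)) * fourier_integral (\<lambda>x. f x $ j $ k) y"
proof -
  have [measurable]: "(\<lambda>x. f x $ j $ k) \<in> borel_measurable borel"
    by (rule Cc_infinity_measurable[OF Cc_infinity_entry[OF assms]])
  have "(LINT x|lebesgue. exp (- \<i> * of_real (y \<bullet> x)) * f x $ j $ k) = (CLINT x|lebesgue. iexp ((- y) \<bullet> x) * f x $ j $ k)"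
    by simp
  also have "\<dots> = fourier_integral (\<lambda>x. f x $ j $ k) y"
    unfolding fourier_integral_def by (rule integral_completion) measurable
  finally show ?thesis by (simp add: fourier_def)
qed

lemma multiplier_integral_integrable:
  fixes h g :: "real^'n \<Rightarrow> complex"
  assumes h: "h \<in> Cc_infinity" and g: "g \<in> borel_measurable borel" "\<And>x. cmod (g x) \<le> B"
  shows "integrable lborel (\<lambda>y. iexp (x \<bullet> y) * (fourier_integral h y * g y))"
proof -
  have i: "integrable lborel (\<lambda>y. fourier_integral h y * g y)"
    by (rule integrable_mult_bounded[OF Cc_infinity_fourier_integrable[OF h] g])
  then show ?thesis by (subst iexp_mult_integrable_iff) auto
qed

lemma multiplier_integral_sum:
  fixes h :: "'i \<Rightarrow> real^'n \<Rightarrow> complex"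
  assumes h: "\<And>i. i \<in> I \<Longrightarrow> h i \<in> Cc_infinity" and g: "g \<in> borel_measurable borel" "\<And>x. cmod (g x) \<le> B"
  shows "multiplier_integral g (\<lambda>x. \<Sum>i\<in>I. a i * h i x) x = (\<Sum>i\<in>I. a i * multiplier_integral g (h i) x)"
proof -
  have i: "integrable lborel (\<lambda>x. iexp ((- y) \<bullet> x) * h i x)" if "i \<in> I" for i y
    using Cc_infinity_integrable[OF h[OF that]] by (subst iexp_mult_integrable_iff) auto
  have "fourier_integral (\<lambda>x. \<Sum>i\<in>I. a i * h i x) y = (\<Sum>i\<in>I. a i * fourier_integral (h i) y)" for y
  proof -
    have "fourier_integral (\<lambda>x. \<Sum>i\<in>I. a i * h i x) y = (CLINT x|lborel. \<Sum>i\<in>I. a i * (iexp ((- y) \<bullet> x) * h i x))"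
      unfolding fourier_integral_def sum_distrib_left by (simp only: mult_ac)
    also have "\<dots> = (\<Sum>i\<in>I. CLINT x|lborel. a i * (iexp ((- y) \<bullet> x) * h i x))"
      by (intro Bochner_Integration.integral_sum integrable_mult_right i)
    finally show ?thesis unfolding fourier_integral_def integral_mult_right_zero .
  qed
  then have "multiplier_integral g (\<lambda>x. \<Sum>i\<in>I. a i * h i x) x =
      (CLINT y|lborel. \<Sum>i\<in>I. a i * (iexp (x \<bullet> y) * (fourier_integral (h i) y * g y)))"
    unfolding multiplier_integral_def by (simp only: sum_distrib_left sum_distrib_right mult_ac)
  also have "\<dots> = (\<Sum>i\<in>I. CLINT y|lborel. a i * (iexp (x \<bullet> y) * (fourier_integral (h i) y * g y)))"
    by (intro Bochner_Integration.integral_sum integrable_mult_right multiplier_integral_integrable[OF h g])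
  finally show ?thesis unfolding multiplier_integral_def integral_mult_right_zero .
qed

lemma multiplier_integral_add:
  fixes h h' :: "real^'n \<Rightarrow> complex"
  assumes "h \<in> Cc_infinity" "h' \<in> Cc_infinity" "g \<in> borel_measurable borel" "\<And>x. cmod (g x) \<le> B"
  shows "multiplier_integral g (\<lambda>x. h x + h' x) x = multiplier_integral g h x + multiplier_integral g h' x"
  using multiplier_integral_sum[of UNIV "\<lambda>b. if b then h else h'" g B "\<lambda>_. 1" x] assms
  by (simp add: UNIV_bool add.commute)

lemma multiplier_integral_cmult:
  fixes h :: "real^'n \<Rightarrow> complex"
  assumes "h \<in> Cc_infinity" "g \<in> borel_measurable borel" "\<And>x. cmod (g x) \<le> B"
  shows "multiplier_integral g (\<lambda>x. a * h x) x = a * multiplier_integral g h x"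
  using multiplier_integral_sum[of UNIV "\<lambda>_::unit. h" g B "\<lambda>_. a" x] assms by simp

context bounded_symbol
begin

text \<open>The normalising factors of \<open>fourier\<close> and \<open>inv_fourier\<close>
  multiplied together, that is, \<open>2 * pi\<close> to the power \<open>- n\<close>.\<close>

definition \<kappa> :: real where
  "\<kappa> = ((2 * pi) powr (- real CARD('n) / 2))\<^sup>2"

lemma \<kappa>_pos: "\<kappa> > 0"
  by (simp add: \<kappa>_def)

text \<open>The symbol acts from the right, so \<open>f x $ j $ l\<close> meets
  \<open>G y $ l $ k\<close>. Constants and the change from \<open>lebesgue\<close> to
  \<open>lborel\<close> are settled here once and for all.\<close>

lemma fourier_multiplier_entry:
  assumes f: "f \<in> Cc_infinity"
  shows "fourier_multiplier G f x $ j $ k =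
    of_real \<kappa> * (\<Sum>l\<in>UNIV. multiplier_integral (\<lambda>y. G y $ l $ k) (\<lambda>x. f x $ j $ l) x)"
proof -
  let ?c = "complex_of_real ((2 * pi) powr (- real CARD('n) / 2))"
  let ?h = "\<lambda>l y. iexp (x \<bullet> y) * (fourier_integral (\<lambda>x. f x $ j $ l) y * G y $ l $ k)"
  have h: "integrable lborel (?h l)" for l
    by (rule multiplier_integral_integrable[OF Cc_infinity_entry[OF f] measurable_entry bound])
  have "exp (\<i> * of_real (x \<bullet> y)) * (fourier f y ** G y) $ j $ k = ?c * (\<Sum>l\<in>UNIV. ?h l y)" for y
    unfolding matrix_matrix_mult_def vec_lambda_beta fourier_entry[OF f] sum_distrib_left
    by (simp only: mult_ac)
  then have "fourier_multiplier G f x $ j $ k = ?c * (CLINT y|lebesgue. ?c * (\<Sum>l\<in>UNIV. ?h l y))"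
    by (simp only: fourier_multiplier_def inv_fourier_def vec_lambda_beta)
  also have "(CLINT y|lebesgue. ?c * (\<Sum>l\<in>UNIV. ?h l y)) = (CLINT y|lborel. ?c * (\<Sum>l\<in>UNIV. ?h l y))"
    by (rule integral_completion)
      (intro borel_measurable_times borel_measurable_const borel_measurable_sum borel_measurable_integrable[OF h])
  also have "\<dots> = ?c * (\<Sum>l\<in>UNIV. CLINT y|lborel. ?h l y)"
    unfolding integral_mult_right_zero by (subst Bochner_Integration.integral_sum[OF h]) (rule refl)
  finally show ?thesis
    by (simp add: \<kappa>_def multiplier_integral_def power2_eq_square mult.assoc)
qed

lemma fourier_multiplier_add:
  assumes "f \<in> Cc_infinity" "g \<in> Cc_infinity"
  shows "fourier_multiplier G (\<lambda>x. f x + g x) x = fourier_multiplier G f x + fourier_multiplier G g x"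
  using assms
  by (simp add: vec_eq_iff fourier_multiplier_entry Cc_infinity_add
      multiplier_integral_add[OF Cc_infinity_entry Cc_infinity_entry measurable_entry bound]
      sum.distrib distrib_left)

lemma fourier_multiplier_cscale_mat:
  assumes "f \<in> Cc_infinity"
  shows "fourier_multiplier G (\<lambda>x. cscale_mat a (f x)) x = cscale_mat a (fourier_multiplier G f x)"
proof -
  have "(\<lambda>x. cscale_mat a (f x)) \<in> Cc_infinity"
    by (rule Cc_infinity_bounded_linear[OF bounded_linear_cscale_mat assms])
  then show ?thesis
    using assms
    by (simp add: vec_eq_iff fourier_multiplier_entry)
      (simp add: cscale_mat_def multiplier_integral_cmult[OF Cc_infinity_entry measurable_entry bound] fourier_multiplier_entry
        sum_distrib_left mult_ac)
qed

lemma trace_fourier_multiplier: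
  assumes "f \<in> Cc_infinity"
  shows "trace (fourier_multiplier G f x) =
    of_real \<kappa> * (\<Sum>j\<in>UNIV. \<Sum>l\<in>UNIV. multiplier_integral (\<lambda>y. G y $ l $ j) (\<lambda>x. f x $ j $ l) x)"
  by (simp add: trace_def fourier_multiplier_entry[OF assms] sum_distrib_left)

lemma continuous_fourier_multiplier_entry:
  assumes "f \<in> Cc_infinity"
  shows "continuous_on UNIV (\<lambda>x. fourier_multiplier G f x $ j $ k)"
  unfolding fourier_multiplier_entry[OF assms]
  by (intro continuous_intros continuous_multiplier_integral[OF _ measurable_entry bound]
      Cc_infinity_fourier_integrable Cc_infinity_entry assms)

lemma continuous_fourier_multiplier:
  assumes "f \<in> Cc_infinity"
  shows "continuous_on UNIV (fourier_multiplier G f)"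
proof -
  have "continuous_on UNIV (\<lambda>x. \<chi> j k. fourier_multiplier G f x $ j $ k)"
    by (intro continuous_on_vec_lambda continuous_fourier_multiplier_entry assms)
  then show ?thesis by simp
qed

end

context psd_symbol
begin

text \<open>Each of the \<open>m^2\<close> entries is a sum of \<open>m\<close> scalar multipliers,
  whence the third power; the rest of the constant is \<open>\<kappa>\<close> times the kernel
  mass.\<close>

lemma fourier_multiplier_integrable:
  assumes f: "f \<in> Cc_infinity"
  shows "integrable lebesgue (fourier_multiplier G f)"
    and "(LINT x|lebesgue. norm (fourier_multiplier G f x)) \<le>
      real CARD('m) ^ 3 * \<kappa> * ((2 * pi) ^ CARD('n) * B) * (LINT x|lebesgue. norm (f x))"
proof -
  let ?e = "\<lambda>j k x. fourier_multiplier G f x $ j $ k"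
  let ?F = "LINT x|lborel. norm (f x)"
  let ?C = "(2 * pi) ^ CARD('n) * B"
  \<comment> \<open>\<open>undefined\<close> merely names some index; any entry would do.\<close>
  have B: "B \<ge> 0" using norm_ge_zero[of "G 0 $ undefined $ undefined"] bound[of 0 undefined undefined] by linarith
  have m[measurable]: "fourier_multiplier G f \<in> borel_measurable borel" "f \<in> borel_measurable borel"
    by (intro borel_measurable_continuous_onI continuous_fourier_multiplier Cc_infinity_continuous f)+
  have fi: "integrable lborel f" by (rule Cc_infinity_integrable[OF f])
  note fe = Cc_infinity_entry[OF f]
  note M = multiplier_integral_mass[OF Cc_infinity_integrable[OF fe] Cc_infinity_fourier_integrable[OF fe]
      measurable_entry bound gauss_kernel_mass_entry]
  have le: "(LINT x|lborel. cmod (f x $ j $ l)) \<le> ?F" for j l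
    by (intro integral_mono integrable_norm Cc_infinity_integrable fe f cmod_entry_le_norm)
  have e: "integrable lborel (?e j k)"
    "(LINT x|lborel. cmod (?e j k x)) \<le> real CARD('m) * \<kappa> * ?C * ?F" for j k
  proof -
    let ?m = "\<lambda>l. multiplier_integral (\<lambda>y. G y $ l $ k) (\<lambda>x. f x $ j $ l)"
    show "integrable lborel (?e j k)"
      unfolding fourier_multiplier_entry[OF f] by (intro integrable_mult_right Bochner_Integration.integrable_sum M(1))
    have "(LINT x|lborel. cmod (?e j k x)) \<le> (LINT x|lborel. \<kappa> * (\<Sum>l\<in>UNIV. cmod (?m l x)))"
      using \<kappa>_pos by (intro integral_mono integrable_norm integrable_mult_right Bochner_Integration.integrable_sum M(1))
        (auto simp: fourier_multiplier_entry[OF f] norm_mult intro!: integrable_mult_right Bochner_Integration.integrable_sum M(1) mult_left_mono norm_sum)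
    also have "\<dots> = \<kappa> * (\<Sum>l\<in>UNIV. LINT x|lborel. cmod (?m l x))"
      using M(1) by simp
    also have "\<dots> \<le> \<kappa> * (\<Sum>l\<in>(UNIV::'m set). ?C * ?F)"
      using \<kappa>_pos B by (intro mult_left_mono sum_mono order_trans[OF M(2)] le) auto
    finally show "(LINT x|lborel. cmod (?e j k x)) \<le> real CARD('m) * \<kappa> * ?C * ?F"
      by (simp add: mult_ac)
  qed
  have s: "integrable lborel (\<lambda>x. \<Sum>j\<in>UNIV. \<Sum>k\<in>UNIV. cmod (?e j k x))"
    by (intro Bochner_Integration.integrable_sum integrable_norm e)
  have i: "integrable lborel (fourier_multiplier G f)"
  proof (rule Bochner_Integration.integrable_bound[OF s])
    show "AE x in lborel. norm (fourier_multiplier G f x) \<le> norm (\<Sum>j\<in>UNIV. \<Sum>k\<in>UNIV. cmod (?e j k x))"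
      unfolding real_norm_def by (intro always_eventually allI order_trans[OF norm_matrix_le_sum abs_ge_self])
  qed simp
  then show "integrable lebesgue (fourier_multiplier G f)" by (simp add: integrable_completion)
  have "(LINT x|lborel. norm (fourier_multiplier G f x)) \<le>
      (LINT x|lborel. (\<Sum>j\<in>UNIV. \<Sum>k\<in>UNIV. cmod (?e j k x)))"
    by (intro integral_mono integrable_norm i s norm_matrix_le_sum)
  also have "\<dots> = (\<Sum>j\<in>UNIV. \<Sum>k\<in>UNIV. LINT x|lborel. cmod (?e j k x))"
    using e(1) by simp
  also have "\<dots> \<le> (\<Sum>j\<in>(UNIV::'m set). \<Sum>k\<in>(UNIV::'m set). real CARD('m) * \<kappa> * ?C * ?F)"
    by (intro sum_mono e(2))
  also have "\<dots> = real CARD('m) ^ 3 * \<kappa> * ?C * ?F"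
    by (simp add: power3_eq_cube mult_ac)
  finally show "(LINT x|lebesgue. norm (fourier_multiplier G f x)) \<le>
      real CARD('m) ^ 3 * \<kappa> * ?C * (LINT x|lebesgue. norm (f x))"
    by (simp add: integral_completion)
qed

lemma extends_bounded: "extends_bounded_L1 G"
  unfolding extends_bounded_L1_def
proof (rule bounded_operator_L1_extension)
  have "B \<ge> 0" using norm_ge_zero[of "G 0 $ undefined $ undefined"] bound[of 0 undefined undefined] by linarith
  then show "real CARD('m) ^ 3 * \<kappa> * ((2 * pi) ^ CARD('n) * B) \<ge> 0" using \<kappa>_pos by simp
qed (rule fourier_multiplier_integrable fourier_multiplier_add fourier_multiplier_cscale_mat; assumption)+

text \<open>For the damped symbol the trace is, up to \<open>\<kappa>\<close>, the integral over
  \<open>z\<close> of the trace of \<open>f z\<close> times the kernel matrix at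
  \<open>x - z\<close>. The damping is removed at fixed \<open>x\<close>, so no exceptional points
  arise.\<close>

lemma trace_nonneg:
  assumes f: "f \<in> Cc_infinity" and pos: "\<And>x. psd_mat (f x)"
  shows "trace (fourier_multiplier G f x) \<in> \<real>\<^sub>\<ge>\<^sub>0"
proof -
  note fe = Cc_infinity_entry[OF f]
  let ?g = "\<lambda>n l j y. G y $ l $ j * of_real (gauss (inverse (real (Suc n))) y)"
  have "(\<lambda>n. \<Sum>j\<in>UNIV. \<Sum>l\<in>UNIV. multiplier_integral (?g n l j) (\<lambda>x. f x $ j $ l) x) \<longlonglongrightarrow>
      (\<Sum>j\<in>UNIV. \<Sum>l\<in>UNIV. multiplier_integral (\<lambda>y. G y $ l $ j) (\<lambda>x. f x $ j $ l) x)"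
    by (intro tendsto_sum multiplier_integral_limit[OF _ measurable_entry bound] Cc_infinity_fourier_integrable fe)
  moreover have "(\<Sum>j\<in>UNIV. \<Sum>l\<in>UNIV. multiplier_integral (?g n l j) (\<lambda>x. f x $ j $ l) x) \<in> \<real>\<^sub>\<ge>\<^sub>0" for n
  proof -
    define e where "e = inverse (real (Suc n))"
    have e: "e > 0" by (simp add: e_def)
    let ?k = "\<lambda>l j. gauss_kernel (\<lambda>y. G y $ l $ j) e"
    have i: "integrable lborel (\<lambda>z. f z $ j $ l * ?k l j (x - z))" for j l
    \<comment> \<open>The kernel is bounded by the \<open>L^1\<close> norm of the damped symbol,
      which makes it a bounded factor for the integrable entry of \<open>f\<close>.\<close>
    proof (rule integrable_mult_bounded[OF Cc_infinity_integrable[OF fe]])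
      have c: "continuous_on UNIV (?k l j)" by (rule continuous_gauss_kernel[OF measurable_entry bound e])
      show "(\<lambda>z. ?k l j (x - z)) \<in> borel_measurable borel"
        by (intro borel_measurable_continuous_onI continuous_on_compose2[OF c] continuous_intros) simp
      show "cmod (?k l j (x - z)) \<le> (LINT y|lborel. cmod (G y $ l $ j * of_real (gauss e y)))" for z
      proof -
        have "cmod (?k l j (x - z)) \<le> (LINT y|lborel. cmod (iexp ((x - z) \<bullet> y) * G y $ l $ j * of_real (gauss e y)))"
          unfolding gauss_kernel_def by (rule integral_norm_bound)
        then show ?thesis by (simp add: norm_mult)
      qed
    qed
    have "(\<Sum>j\<in>UNIV. \<Sum>l\<in>UNIV. multiplier_integral (?g n l j) (\<lambda>x. f x $ j $ l) x) =
       (\<Sum>j\<in>UNIV. \<Sum>l\<in>UNIV. CLINT z|lborel. f z $ j $ l * ?k l j (x - z))"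
      unfolding e_def[symmetric]
      by (intro sum.cong refl multiplier_integral_gauss[OF Cc_infinity_integrable[OF fe] measurable_entry bound e])
    also have "\<dots> = (CLINT z|lborel. \<Sum>j\<in>UNIV. \<Sum>l\<in>UNIV. f z $ j $ l * ?k l j (x - z))"
      using i by simp
    also have "\<dots> \<in> \<real>\<^sub>\<ge>\<^sub>0"
      using pos gauss_kernel_psd[OF e] unfolding psd_mat_def
      by (intro integral_nonneg_Reals psd_on_trace_mult[of UNIV "\<lambda>j l. f z $ j $ l" "\<lambda>l j. ?k l j (x - z)" for z]) auto
    finally show ?thesis .
  qed
  ultimately have "(\<Sum>j\<in>UNIV. \<Sum>l\<in>UNIV. multiplier_integral (\<lambda>y. G y $ l $ j) (\<lambda>x. f x $ j $ l) x) \<in> \<real>\<^sub>\<ge>\<^sub>0"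
    by (rule nonneg_Reals_limI)
  then show ?thesis
    unfolding trace_fourier_multiplier[OF f] using \<kappa>_pos by (intro nonneg_Reals_mult_I) auto
qed

end

section \<open>Recovering the symbol from the trace inequality\<close>

lemma fourier_integral_modulate:
  "fourier_integral (\<lambda>x. iexp (a \<bullet> x) * h x) y = fourier_integral h (y - a)"
proof -
  have "iexp ((- y) \<bullet> x) * iexp (a \<bullet> x) = iexp ((- (y - a)) \<bullet> x)" for x
    by (simp add: inner_diff_left algebra_simps flip: exp_add)
  then show ?thesis
    unfolding fourier_integral_def by (simp only: mult.assoc[symmetric])
qed

lemma fourier_integral_dilate:
  fixes h :: "'a::euclidean_space \<Rightarrow> complex"
  assumes "r > 0" "h \<in> borel_measurable borel"
  shows "fourier_integral (\<lambda>x. h (r *\<^sub>R x)) y = of_real ((1 / r) ^ DIM('a)) * fourier_integral h ((1 / r) *\<^sub>R y)"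
proof -
  have [measurable]: "h \<in> borel_measurable borel" by fact
  have "fourier_integral (\<lambda>x. h (r *\<^sub>R x)) y = \<bar>1 / r\<bar> ^ DIM('a) *\<^sub>R
      (CLINT x|lborel. iexp ((- y) \<bullet> (0 + (1 / r) *\<^sub>R x)) * h (r *\<^sub>R (0 + (1 / r) *\<^sub>R x)))"
    unfolding fourier_integral_def by (rule lborel_integral_affine) (use assms(1) in auto)
  then show ?thesis
    using assms(1) by (simp add: fourier_integral_def scaleR_conv_of_real)
qed

text \<open>The transform of the test function is that of \<open>h\<close>, translated to
  \<open>a\<close> and compressed by \<open>r\<close>; substituting
  \<open>y = a + r *\<^sub>R z\<close> moves \<open>r\<close> into the argument of
  \<open>g\<close>.\<close>

lemma multiplier_integral_modulate_dilate:
  fixes h g :: "'a::euclidean_space \<Rightarrow> complex"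
  assumes r: "r > 0" and h: "integrable lborel h" and g: "g \<in> borel_measurable borel"
  shows "multiplier_integral g (\<lambda>x. iexp (a \<bullet> x) * h (r *\<^sub>R x)) 0 =
    (CLINT z|lborel. fourier_integral h z * g (a + r *\<^sub>R z))"
proof -
  have [measurable]: "h \<in> borel_measurable borel" "g \<in> borel_measurable borel" using h g by auto
  have [measurable]: "fourier_integral h \<in> borel_measurable borel"
    by (intro borel_measurable_continuous_onI continuous_fourier_integral' h)
  let ?c = "complex_of_real ((1 / r) ^ DIM('a))"
  have "multiplier_integral g (\<lambda>x. iexp (a \<bullet> x) * h (r *\<^sub>R x)) 0 =
      (CLINT y|lborel. ?c * fourier_integral h ((1 / r) *\<^sub>R (y - a)) * g y)"
    unfolding multiplier_integral_def fourier_integral_modulate fourier_integral_dilate[OF r \<open>h \<in> borel_measurable borel\<close>]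
    by simp
  also have "\<dots> = \<bar>r\<bar> ^ DIM('a) *\<^sub>R (CLINT z|lborel. ?c * fourier_integral h ((1 / r) *\<^sub>R (a + r *\<^sub>R z - a)) * g (a + r *\<^sub>R z))"
    by (rule lborel_integral_affine) (use r in auto)
  also have "\<dots> = complex_of_real (r ^ DIM('a)) * ?c * (CLINT z|lborel. fourier_integral h z * g (a + r *\<^sub>R z))"
    using r by (simp add: scaleR_conv_of_real mult.assoc)
  also have "complex_of_real (r ^ DIM('a)) * ?c = 1"
    using r by (simp add: power_divide)
  finally show ?thesis by simp
qed

text \<open>Compressed transforms act as an approximate identity at \<open>a\<close>: continuity of
  \<open>g\<close> gives the limit, its bound the domination.\<close>

lemma multiplier_integral_concentrate:
  fixes h g :: "'a::euclidean_space \<Rightarrow> complex"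
  assumes h: "integrable lborel h" "integrable lborel (fourier_integral h)"
    and g: "continuous_on UNIV g" "\<And>x. cmod (g x) \<le> B"
  shows "(\<lambda>n. multiplier_integral g (\<lambda>x. iexp (a \<bullet> x) * h (inverse (real (Suc n)) *\<^sub>R x)) 0) \<longlonglongrightarrow>
    (CLINT z|lborel. fourier_integral h z) * g a"
proof -
  define r where "r = (\<lambda>n. inverse (real (Suc n)))"
  have r: "r n > 0" for n by (simp add: r_def)
  have rl: "r \<longlonglongrightarrow> 0" unfolding r_def by (rule LIMSEQ_inverse_real_of_nat)
  have gm[measurable]: "g \<in> borel_measurable borel" by (rule borel_measurable_continuous_onI[OF g(1)])
  have [measurable]: "fourier_integral h \<in> borel_measurable borel" using h(2) by auto
  have "(\<lambda>n. CLINT z|lborel. fourier_integral h z * g (a + r n *\<^sub>R z)) \<longlonglongrightarrow> (CLINT z|lborel. fourier_integral h z * g a)"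
  proof (rule integral_dominated_convergence[where w="\<lambda>z. cmod (fourier_integral h z) * B"])
    have "(\<lambda>n. fourier_integral h z * g (a + r n *\<^sub>R z)) \<longlonglongrightarrow> fourier_integral h z * g a" for z
    proof -
      have "(\<lambda>n. a + r n *\<^sub>R z) \<longlonglongrightarrow> a + 0 *\<^sub>R z" by (intro tendsto_intros rl)
      then have "(\<lambda>n. g (a + r n *\<^sub>R z)) \<longlonglongrightarrow> g a"
        by (intro continuous_on_tendsto_compose[OF g(1)]) auto
      then show ?thesis by (intro tendsto_mult tendsto_const)
    qed
    then show "AE z in lborel. (\<lambda>n. fourier_integral h z * g (a + r n *\<^sub>R z)) \<longlonglongrightarrow> fourier_integral h z * g a" by simp
    show "AE z in lborel. norm (fourier_integral h z * g (a + r n *\<^sub>R z)) \<le> cmod (fourier_integral h z) * B" for n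
      unfolding norm_mult by (intro always_eventually allI mult_left_mono g(2)) simp
  qed (use h in auto)
  then show ?thesis
    unfolding multiplier_integral_modulate_dilate[OF r h(1) gm, unfolded r_def] r_def by simp
qed

lemma gauss_kernel_one:
  fixes x :: "'a::euclidean_space"
  assumes "e > 0"
  shows "gauss_kernel (\<lambda>_. 1) e x = of_real (sqrt (2 * pi / e) ^ DIM('a) * gauss (1 / e) x)"
  using gauss_fourier[OF assms, of x] by (simp add: gauss_kernel_def mult.commute)

lemma gauss_scale: "e \<ge> 0 \<Longrightarrow> gauss d (sqrt e *\<^sub>R x) = gauss (d * e) x"
  by (simp add: gauss_def power_mult_distrib mult.assoc)

text \<open>Inversion at the origin, used to see that the sampling weight of a cutoff is positive.
  The damped integral of the transform is evaluated as a convolution at 0, and the damping is then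
  removed on both sides.\<close>

lemma fourier_inversion_0:
  fixes h :: "'a::euclidean_space \<Rightarrow> complex"
  assumes h: "integrable lborel h" "integrable lborel (fourier_integral h)"
    and c: "continuous_on UNIV h" "\<And>x. cmod (h x) \<le> M"
  shows "(CLINT z|lborel. fourier_integral h z) = of_real ((2 * pi) ^ DIM('a)) * h 0"
proof -
  have [measurable]: "h \<in> borel_measurable borel" using h by auto
  define e where "e = (\<lambda>n. inverse (real (Suc n)))"
  have e: "e n > 0" for n by (simp add: e_def)
  have el: "e \<longlonglongrightarrow> 0" unfolding e_def by (rule LIMSEQ_inverse_real_of_nat)
  \<comment> \<open>Inversion is the multiplier with constant symbol; the explicit factor 1 is that
    symbol.\<close>
  have L1: "(\<lambda>n. multiplier_integral (\<lambda>y. 1 * of_real (gauss (e n) y)) h 0) \<longlonglongrightarrow> multiplier_integral (\<lambda>_. 1) h 0"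
    unfolding e_def by (rule multiplier_integral_limit[OF h(2), where B=1]) auto
  have e1: "multiplier_integral (\<lambda>_. 1) h 0 = (CLINT z|lborel. fourier_integral h z)"
    by (simp add: multiplier_integral_def)
  let ?i = "\<lambda>n. CLINT u|lborel. h (sqrt (e n) *\<^sub>R u) * of_real (gauss 1 u)"
  have e2: "multiplier_integral (\<lambda>y. 1 * of_real (gauss (e n) y)) h 0 =
      of_real (sqrt (2 * pi) ^ DIM('a)) * ?i n" for n
  proof -
    let ?K = "complex_of_real (sqrt (2 * pi / e n) ^ DIM('a))"
    have "multiplier_integral (\<lambda>y. 1 * of_real (gauss (e n) y)) h 0 = (CLINT z|lborel. h z * gauss_kernel (\<lambda>_. 1) (e n) (0 - z))"
      by (rule multiplier_integral_gauss[OF h(1) _ _ e, where B=1]) auto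
    also have "\<dots> = ?K * (CLINT z|lborel. h z * of_real (gauss (1 / e n) z))"
      unfolding gauss_kernel_one[OF e] of_real_mult integral_mult_right_zero[symmetric] by (simp add: mult_ac)
    \<comment> \<open>Rescaling by \<open>sqrt (e n)\<close> fixes the Gaussian and puts the
      parameter into the argument of \<open>h\<close>, where continuity at 0 applies.\<close>
    also have "(CLINT z|lborel. h z * of_real (gauss (1 / e n) z)) = \<bar>sqrt (e n)\<bar> ^ DIM('a) *\<^sub>R
        (CLINT u|lborel. h (0 + sqrt (e n) *\<^sub>R u) * of_real (gauss (1 / e n) (0 + sqrt (e n) *\<^sub>R u)))"
      by (rule lborel_integral_affine) (use e[of n] in auto)
    also have "\<dots> = of_real (sqrt (e n) ^ DIM('a)) * ?i n"
      using e[of n] by (simp add: gauss_scale scaleR_conv_of_real)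
    also have "?K * (of_real (sqrt (e n) ^ DIM('a)) * ?i n) =
        of_real ((sqrt (2 * pi / e n) * sqrt (e n)) ^ DIM('a)) * ?i n"
      by (simp only: power_mult_distrib of_real_mult mult.assoc)
    also have "sqrt (2 * pi / e n) * sqrt (e n) = sqrt (2 * pi)"
      using e[of n] by (simp flip: real_sqrt_mult)
    finally show ?thesis .
  qed
  have L2: "?i \<longlonglongrightarrow>
      (CLINT u::'a|lborel. h 0 * of_real (gauss 1 u))"
  proof (rule integral_dominated_convergence[where w="\<lambda>u. M * gauss 1 u"])
    have "(\<lambda>n. h (sqrt (e n) *\<^sub>R u) * of_real (gauss 1 u)) \<longlonglongrightarrow> h 0 * of_real (gauss 1 u)" for u
    proof -
      have "(\<lambda>n. sqrt (e n) *\<^sub>R u) \<longlonglongrightarrow> sqrt 0 *\<^sub>R u" by (intro tendsto_intros el)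
      then have "(\<lambda>n. h (sqrt (e n) *\<^sub>R u)) \<longlonglongrightarrow> h 0"
        by (intro continuous_on_tendsto_compose[OF c(1)]) auto
      then show ?thesis by (intro tendsto_mult tendsto_const)
    qed
    then show "AE u in lborel. (\<lambda>n. h (sqrt (e n) *\<^sub>R u) * of_real (gauss 1 u)) \<longlonglongrightarrow> h 0 * of_real (gauss 1 u)" by simp
    show "AE u in lborel. norm (h (sqrt (e n) *\<^sub>R u) * of_real (gauss 1 u)) \<le> M * gauss 1 u" for n
      unfolding norm_mult norm_of_real abs_of_nonneg[OF gauss_nonneg]
      by (intro always_eventually allI mult_right_mono c(2)) simp
  qed (use gauss_integrable[of 1, where ?'a='a] in auto)
  have e3: "complex_of_real (sqrt (2 * pi) ^ DIM('a)) * (CLINT u::'a|lborel. h 0 * of_real (gauss 1 u)) =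
      of_real ((2 * pi) ^ DIM('a)) * h 0"
  proof -
    let ?s = "sqrt (2 * pi) ^ DIM('a)"
    have i: "(CLINT u::'a|lborel. h 0 * of_real (gauss 1 u)) = h 0 * of_real (sqrt (2 * pi) ^ DIM('a))"
      using gauss_integral[of 1, where ?'a='a] by simp
    have s: "?s * ?s = (2 * pi) ^ DIM('a)"
      unfolding power_mult_distrib[symmetric] by simp
    have "of_real ?s * (h 0 * of_real ?s) = of_real (?s * ?s) * h 0"
      by (simp only: of_real_mult mult_ac)
    then show ?thesis unfolding i s .
  qed
  show ?thesis
    using LIMSEQ_unique[OF L1[unfolded e1 e2] tendsto_mult[OF tendsto_const L2]] unfolding e3 .
qed

context bounded_symbol
begin

text \<open>Testing with \<open>\<phi>(x/R) w(x) w(x)\<^sup>*\<close>, where \<open>w\<close> is a trigonometric polynomial with frequencies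
  \<open>-x\<^sub>q\<close>, the multiplier samples \<open>G\<close> near the differences \<open>x\<^sub>p - x\<^sub>q\<close> as \<open>R \<rightarrow> \<infinity>\<close>.\<close>

lemma psd_fun_if_trace_nonneg:
  assumes pos: "\<And>f. f \<in> Cc_infinity \<Longrightarrow> (\<And>x. psd_mat (f x)) \<Longrightarrow> trace (fourier_multiplier G f 0) \<in> \<real>\<^sub>\<ge>\<^sub>0"
  shows "psd_fun G"
  unfolding psd_fun_def psd_on_def
proof (intro allI)
  fix N :: nat and x :: "nat \<Rightarrow> real^'n" and c :: "nat \<times> 'm \<Rightarrow> complex"
  \<comment> \<open>Nonnegative values keep the test matrices positive semidefinite; the positive
    value at 0 makes the weight \<open>J\<close> positive by inversion at the origin.\<close>
  define \<phi> where "\<phi> = (\<lambda>x::real^'n. complex_of_real (box_bump 1 (-1) 1 x))"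
  have \<phi>: "\<phi> \<in> Cc_infinity" unfolding \<phi>_def by (rule Cc_infinity_box_bump) simp
  note \<phi>i = Cc_infinity_integrable[OF \<phi>] Cc_infinity_fourier_integrable[OF \<phi>]
  have \<phi>0: "\<phi> x \<in> \<real>\<^sub>\<ge>\<^sub>0" for x by (simp add: \<phi>_def box_bump_nonneg)
  have dil: "(\<lambda>x. \<phi> (r *\<^sub>R x)) \<in> Cc_infinity" if r: "r > 0" for r
  proof -
    \<comment> \<open>A dilated \<open>box_bump\<close> is a \<open>box_bump\<close> on a rescaled
      box, so its smoothness is already known.\<close>
    have "\<phi> (r *\<^sub>R x) = complex_of_real (box_bump r (- (1 / r) *\<^sub>R 1) ((1 / r) *\<^sub>R 1) x)" for x
    proof -
      have "1 * ((r *\<^sub>R x) $ i - (- 1) $ i) = r * (x $ i - (- (1 / r) *\<^sub>R 1) $ i)"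
        "1 * (1 $ i - (r *\<^sub>R x) $ i) = r * (((1 / r) *\<^sub>R 1) $ i - x $ i)" for i
        using r by (simp_all add: right_diff_distrib distrib_left)
      then show ?thesis by (simp only: \<phi>_def box_bump_def)
    qed
    then show ?thesis using Cc_infinity_box_bump[OF r] by simp
  qed
  define J where "J = (2 * pi) ^ CARD('n) * box_bump 1 (-1) 1 (0 :: real^'n)"
  have "box_bump 1 (-1) 1 (0 :: real^'n) \<noteq> 0"
    by (subst box_bump_eq_0_iff) (auto simp: mem_box_cart)
  then have J: "J > 0"
    using box_bump_nonneg[of 1 "-1" 1 "0 :: real^'n"] by (simp add: J_def)
  have Jeq: "(CLINT z|lborel. fourier_integral \<phi> z) = of_real J"
    using fourier_inversion_0[OF \<phi>i Cc_infinity_continuous[OF \<phi>], of 1]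
    by (simp add: J_def \<phi>_def box_bump_nonneg box_bump_le_1)
  define I where "I = {..<N} \<times> {..<N}"
  \<comment> \<open>One scalar test function per pair of points;
    \<open>inverse (real (Suc n))\<close> plays the role of \<open>1 / R\<close>.\<close>
  define h where "h = (\<lambda>n (p, q) y. iexp ((x p - x q) \<bullet> y) * \<phi> (inverse (real (Suc n)) *\<^sub>R y))"
  have h: "h n i \<in> Cc_infinity" for n i
  proof -
    obtain p q where i: "i = (p, q)" by (cases i)
    have "(\<lambda>y. \<phi> (inverse (real (Suc n)) *\<^sub>R y) * iexp ((x p - x q) \<bullet> y)) \<in> Cc_infinity"
      by (intro Cc_infinity_mult dil C_k_iexp) simp
    then show ?thesis by (simp only: h_def i prod.case mult.commute)
  qed
  define w where "w = (\<lambda>j y. \<Sum>q<N. c (q, j) * iexp ((- x q) \<bullet> y))"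
  \<comment> \<open>The expanded form of the cutoff times \<open>w j\<close> times
    \<open>cnj (w l)\<close>. In the trace the entry \<open>(l, j)\<close> of \<open>G\<close> then
    meets \<open>cnj (c (p, l))\<close> and \<open>c (q, j)\<close>, as in the form of the block
    matrix.\<close>
  define f where "f = (\<lambda>n y. \<chi> j l. \<Sum>i\<in>I. (c (snd i, j) * cnj (c (fst i, l))) * h n i y)"
  have fw: "f n y $ j $ l = \<phi> (inverse (real (Suc n)) *\<^sub>R y) * (w j y * cnj (w l y))" for n y j l
  proof -
    have "w j y * cnj (w l y) = (\<Sum>p<N. \<Sum>q<N. (c (q, j) * cnj (c (p, l))) * iexp ((x p - x q) \<bullet> y))"
    proof -
      have e: "iexp ((- x q) \<bullet> y) * cnj (iexp ((- x p) \<bullet> y)) = iexp ((x p - x q) \<bullet> y)" for p q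
        by (simp add: exp_cnj inner_diff_left algebra_simps flip: exp_add)
      have "w j y * cnj (w l y) = (\<Sum>q<N. \<Sum>p<N. (c (q, j) * iexp ((- x q) \<bullet> y)) * (cnj (c (p, l)) * cnj (iexp ((- x p) \<bullet> y))))"
        unfolding w_def cnj_sum sum_product complex_cnj_mult ..
      also have "\<dots> = (\<Sum>q<N. \<Sum>p<N. (c (q, j) * cnj (c (p, l))) * (iexp ((- x q) \<bullet> y) * cnj (iexp ((- x p) \<bullet> y))))"
        by (simp only: mult_ac)
      also have "\<dots> = (\<Sum>p<N. \<Sum>q<N. (c (q, j) * cnj (c (p, l))) * iexp ((x p - x q) \<bullet> y))"
        unfolding e by (rule sum.swap)
      finally show ?thesis .
    qed
    then show ?thesis
      by (simp add: f_def I_def h_def sum.cartesian_product' sum_distrib_left mult_ac)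
  qed
  have psd: "psd_mat (f n y)" for n y
    unfolding psd_mat_def fw by (intro psd_on_scale psd_on_rank_one \<phi>0)
  have fC: "f n \<in> Cc_infinity" for n
  proof (rule Cc_infinity_matrix)
    show "(\<lambda>y. f n y $ j $ l) \<in> Cc_infinity" for j l
      unfolding f_def vec_lambda_beta
      by (intro Cc_infinity_sum Cc_infinity_bounded_linear[OF bounded_linear_mult_right h])
  qed
  let ?S = "\<lambda>n. \<Sum>j\<in>UNIV. \<Sum>l\<in>UNIV. \<Sum>i\<in>I. (c (snd i, j) * cnj (c (fst i, l))) * multiplier_integral (\<lambda>y. G y $ l $ j) (h n i) 0"
  let ?L = "\<Sum>j\<in>UNIV. \<Sum>l\<in>UNIV. \<Sum>i\<in>I. (c (snd i, j) * cnj (c (fst i, l))) * (of_real J * G (x (fst i) - x (snd i)) $ l $ j)"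
  have "?S \<longlonglongrightarrow> ?L"
  proof (intro tendsto_sum tendsto_mult tendsto_const)
    fix j l :: 'm and i :: "nat \<times> nat"
    obtain p q where i: "i = (p, q)" by (cases i)
    show "(\<lambda>n. multiplier_integral (\<lambda>y. G y $ l $ j) (h n i) 0) \<longlonglongrightarrow> of_real J * G (x (fst i) - x (snd i)) $ l $ j"
      unfolding h_def i prod.case Jeq[symmetric] fst_conv snd_conv
      by (intro multiplier_integral_concentrate[OF \<phi>i _ bound] continuous_intros cont)
  qed
  moreover have "?S n \<in> \<real>\<^sub>\<ge>\<^sub>0" for n
  proof -
    have "trace (fourier_multiplier G (f n) 0) = of_real \<kappa> * ?S n"
      unfolding trace_fourier_multiplier[OF fC] unfolding f_def vec_lambda_beta
      by (simp only: multiplier_integral_sum[OF h measurable_entry bound])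
    then have "?S n = trace (fourier_multiplier G (f n) 0) / of_real \<kappa>"
      using \<kappa>_pos by simp
    then show ?thesis
      using pos[OF fC psd, of n] \<kappa>_pos by (simp only:) (intro nonneg_Reals_divide_I, auto)
  qed
  ultimately have "?L \<in> \<real>\<^sub>\<ge>\<^sub>0" by (rule nonneg_Reals_limI)
  also have "?L = of_real J * (\<Sum>a\<in>{..<N} \<times> UNIV. \<Sum>b\<in>{..<N} \<times> UNIV. cnj (c a) * block_matrix G x a b * c b)"
  proof -
    have "?L = (\<Sum>j\<in>UNIV. \<Sum>l\<in>UNIV. \<Sum>p<N. \<Sum>q<N. of_real J * (cnj (c (p, l)) * G (x p - x q) $ l $ j * c (q, j)))"
      unfolding I_def sum.cartesian_product' by (simp add: mult_ac)
    also have "\<dots> = (\<Sum>l\<in>UNIV. \<Sum>p<N. \<Sum>q<N. \<Sum>j\<in>UNIV. of_real J * (cnj (c (p, l)) * G (x p - x q) $ l $ j * c (q, j)))"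
      by (subst sum.swap, intro sum.cong refl, subst sum.swap, intro sum.cong refl, rule sum.swap)
    also have "\<dots> = (\<Sum>p<N. \<Sum>l\<in>UNIV. \<Sum>q<N. \<Sum>j\<in>UNIV. of_real J * (cnj (c (p, l)) * G (x p - x q) $ l $ j * c (q, j)))"
      by (rule sum.swap)
    finally show ?thesis
      unfolding sum.cartesian_product' by (simp add: block_matrix_def sum_distrib_left)
  qed
  finally have "of_real J * (\<Sum>a\<in>{..<N} \<times> UNIV. \<Sum>b\<in>{..<N} \<times> UNIV. cnj (c a) * block_matrix G x a b * c b) / of_real J \<in> \<real>\<^sub>\<ge>\<^sub>0"
    by (rule nonneg_Reals_divide_I) (use J in simp)
  moreover have "of_real J * z / of_real J = z" for z :: complex using J by simp
  ultimately show "(\<Sum>a\<in>{..<N} \<times> UNIV. \<Sum>b\<in>{..<N} \<times> UNIV. cnj (c a) * block_matrix G x a b * c b) \<in> \<real>\<^sub>\<ge>\<^sub>0"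
    by (simp only:)
qed

end

section \<open>Schoenberg's equivalence for matrix functions and the conclusion\<close>

lemma cond_psd_on_scale:
  assumes "cond_psd_on I A" "r \<ge> 0"
  shows "cond_psd_on I (\<lambda>j k. of_real r * A j k)"
  unfolding cond_psd_on_def
proof (intro conjI ballI allI impI)
  fix j k assume "j \<in> I" "k \<in> I"
  then have "A j k = cnj (A k j)" using assms(1) unfolding cond_psd_on_def by blast
  then show "of_real r * A j k = cnj (of_real r * A k j)" by (metis complex_cnj_complex_of_real complex_cnj_mult)
next
  fix c :: "'a \<Rightarrow> complex" assume "sum c I = 0"
  then have "(\<Sum>j\<in>I. \<Sum>k\<in>I. cnj (c j) * A j k * c k) \<in> \<real>\<^sub>\<ge>\<^sub>0"
    using assms(1) unfolding cond_psd_on_def by blast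
  then have "of_real r * (\<Sum>j\<in>I. \<Sum>k\<in>I. cnj (c j) * A j k * c k) \<in> \<real>\<^sub>\<ge>\<^sub>0"
    using assms(2) by (intro nonneg_Reals_mult_I) simp_all
  then show "(\<Sum>j\<in>I. \<Sum>k\<in>I. cnj (c j) * (of_real r * A j k) * c k) \<in> \<real>\<^sub>\<ge>\<^sub>0"
    by (simp add: sum_distrib_left mult_ac)
qed

lemma hadamard_exp_scaleR_nth: "hadamard_exp (t *\<^sub>R A) $ j $ k = exp (of_real t * A $ j $ k)"
  unfolding hadamard_exp_def vec_lambda_beta vector_scaleR_component
  by (simp add: scaleR_conv_of_real)

lemma continuous_hadamard_exp:
  assumes "continuous_on S F"
  shows "continuous_on S (\<lambda>x. hadamard_exp (t *\<^sub>R F x))"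
  unfolding hadamard_exp_def by (intro continuous_on_vec_lambda continuous_intros assms)

text \<open>The block matrix of the Hadamard exponential is the entrywise exponential of
  \<open>t\<close> times the block matrix of \<open>F\<close>, so the two results on finite matrices
  apply for every \<open>N\<close> and every choice of points.\<close>

lemma psd_fun_hadamard_exp_iff:
  fixes F :: "real^'n \<Rightarrow> complex^'m^'m"
  shows "(\<forall>t>0. psd_fun (\<lambda>x. hadamard_exp (t *\<^sub>R F x))) \<longleftrightarrow> cond_psd_fun F"
proof -
  have b: "block_matrix (\<lambda>x. hadamard_exp (t *\<^sub>R F x)) x = (\<lambda>a b. exp (of_real t * block_matrix F x a b))" for t x
    by (auto simp: block_matrix_def hadamard_exp_scaleR_nth fun_eq_iff)
  have fin: "finite ({..<N} \<times> (UNIV :: 'm set))" for N :: nat by simp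
  show ?thesis
  proof
    assume "\<forall>t>0. psd_fun (\<lambda>x. hadamard_exp (t *\<^sub>R F x))"
    then show "cond_psd_fun F"
      unfolding psd_fun_def cond_psd_fun_def b by (intro allI cond_psd_on_if_exp_psd fin) blast
  next
    assume F: "cond_psd_fun F"
    show "\<forall>t>0. psd_fun (\<lambda>x. hadamard_exp (t *\<^sub>R F x))"
      unfolding psd_fun_def b
    proof (intro allI impI cond_psd_on_exp fin)
      fix t :: real and N x
      assume "t > 0"
      then show "cond_psd_on ({..<N} \<times> UNIV) (\<lambda>a b. of_real t * block_matrix F x a b)"
        using F by (intro cond_psd_on_scale) (auto simp: cond_psd_fun_def)
    qed
  qed
qed

theorem theorem4p11:
  fixes F :: "real^'n \<Rightarrow> complex^'m^'m"
  assumes "continuous_on UNIV F"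
    and "\<exists>c::real. \<forall>x j k. Re (F x $ j $ k) \<le> c"
  defines "cond_i \<equiv>
      (\<forall>t>0. extends_bounded_L1 (\<lambda>x. hadamard_exp (t *\<^sub>R F x))) \<and>
      (\<forall>t>0. \<forall>f\<in>Cc_infinity. (\<forall>x. psd_mat (f x)) \<longrightarrow>
         trace (fourier_multiplier (\<lambda>x. hadamard_exp (t *\<^sub>R F x)) f 0) \<in> \<real>\<^sub>\<ge>\<^sub>0)"
    and "cond_ii \<equiv> (\<forall>t>0. psd_fun (\<lambda>x. hadamard_exp (t *\<^sub>R F x)))"
    and "cond_iii \<equiv> cond_psd_fun F"
  shows "(cond_i \<longleftrightarrow> cond_ii) \<and> (cond_ii \<longleftrightarrow> cond_iii) \<and>
    (cond_i \<or> cond_ii \<or> cond_iii \<longrightarrow>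
      (\<forall>t>0. \<forall>f\<in>Cc_infinity. (\<forall>x. psd_mat (f x)) \<longrightarrow>
         (\<forall>x. trace (fourier_multiplier (\<lambda>x. hadamard_exp (t *\<^sub>R F x)) f x) \<in> \<real>\<^sub>\<ge>\<^sub>0)))"
proof -
  obtain c where c: "\<And>x j k. Re (F x $ j $ k) \<le> c" using assms(2) by blast
  \<comment> \<open>The modulus of \<open>exp (t * z)\<close> is \<open>exp (t * Re z)\<close>, so
    the upper bound on the real parts is what bounds the symbol.\<close>
  have B: "bounded_symbol (\<lambda>x. hadamard_exp (t *\<^sub>R F x)) (exp (t * c))" if t: "t > 0" for t
  proof
    show "continuous_on UNIV (\<lambda>x. hadamard_exp (t *\<^sub>R F x))"
      by (rule continuous_hadamard_exp[OF assms(1)])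
    show "cmod (hadamard_exp (t *\<^sub>R F x) $ j $ k) \<le> exp (t * c)" for x j k
      using c[of x j k] t by (simp add: hadamard_exp_scaleR_nth)
  qed
  have P: "psd_symbol (\<lambda>x. hadamard_exp (t *\<^sub>R F x)) (exp (t * c))" if "t > 0" cond_ii for t
    using that unfolding cond_ii_def by (intro psd_symbol.intro psd_symbol_axioms.intro B) auto
  have "cond_ii" if "cond_i"
    using that unfolding cond_i_def cond_ii_def
    by (intro allI impI bounded_symbol.psd_fun_if_trace_nonneg[OF B]) blast+
  \<comment> \<open>Proved from (ii) at every point: \<open>x = 0\<close> supplies the inequality in
    (i), and as each condition implies (ii), general \<open>x\<close> supplies the additional
    claim.\<close>
  moreover have tr: "trace (fourier_multiplier (\<lambda>x. hadamard_exp (t *\<^sub>R F x)) f x) \<in> \<real>\<^sub>\<ge>\<^sub>0"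
    if "cond_ii" "t > 0" "f \<in> Cc_infinity" "\<forall>x. psd_mat (f x)" for t f x
    using that by (intro psd_symbol.trace_nonneg[OF P]) auto
  moreover have "cond_i" if "cond_ii"
    unfolding cond_i_def using that tr psd_symbol.extends_bounded[OF P] by blast
  moreover have "cond_ii \<longleftrightarrow> cond_iii"
    unfolding cond_ii_def cond_iii_def by (rule psd_fun_hadamard_exp_iff)
  ultimately show ?thesis by blast
qed

end
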